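(* Let $\rho>0$, $a>0$, $\beta\ge 0$, and let $\lambda(\rho,\beta)=\lambda(\rho,\beta,a)=\lim_{n\to\infty}\frac1n\log\mathbb{E}[x_n]$ be the Lyapunov exponent of the stochastic growth process $x_n$ driven by a stationary Ornstein-Uhlenbeck process, as defined in the context. Let $I(x)=x\log x+(1-x)\log(1-x)$ and $K(y,z)=\frac1{2a}e^{-a|y-z|}$ for $y,z\in[0,1]$. (i) The $\beta\to0$ limit of the Lyapunov exponent is $\lambda(\rho,0)=\log(\rho+1)$. (ii) The Lyapunov exponent satisfies $$\bar\lambda(\rho,\beta)\ \ge\ \lambda(\rho,\beta)\ \ge\ \underline{\lambda}(\rho,\beta),$$ where $$\bar\lambda(\rho,\beta):=\sup_{0\le x\le1}\{x\log\rho+\lambda_0(a)\beta x^2-I(x)\},\qquad \underline{\lambda}(\rho,\beta):=\sup_{0\le x\le 1}\{x\log\rho+k(a)\beta x^2-I(x)\},$$ $$k(a)=\int_0^1\!\!\int_0^1K(y,z)\,dy\,dz=\frac{1}{a^3}\left(a+e^{-a}-1\right),$$ and $\lambda_0(a)$ is the largest eigenvalue of the integral equation $\int_0^1K(x,y)f(y)\,dy=\lambda f(x)$, given by $$\lambda_0(a)=\frac{1}{a^2(1+y_0^2)},$$ with $y_0$ the smallest positive root of the equation $y\tan\left(\tfrac12ay\right)=1$.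
   Context: Process: for each $n$ choose $\sigma\ge0$, $\gamma>0$, $\tau>0$ (depending on $n$) with $\frac12\sigma^2\tau n^2=\beta$ and $\gamma\tau n=a$. Let $Z_t$ be the stationary Ornstein-Uhlenbeck process $dZ_t=-\gamma Z_tdt+\sigma dW_t$, $Z_0\sim N(0,\frac{\sigma^2}{2\gamma})$ independent of the Brownian motion $W$, and $Z_i:=Z_{i\tau}$; so $\mathrm{cov}(Z_i,Z_j)=\frac{\beta}{an}e^{-\frac an|i-j|}$. Let $x_{i+1}=(1+\rho e^{Z_i-\frac12\mathrm{Var}(Z_i)})x_i$ for $0\le i\le n-1$, $x_0=1$. The limit $\lambda(\rho,\beta,a)=\lim_{n\to\infty}\frac1n\log\mathbb{E}[x_n]$ at fixed $\rho,\beta,a$ exists and equals $$\sup_{g\in\mathcal{G}}\Big\{\log\rho\;g(1)+\beta\int_0^1\!\!\int_0^1g'(y)g'(z)K(y,z)\,dy\,dz-\int_0^1I(g'(x))\,dx\Big\},$$ where $\mathcal{G}$ is the set of absolutely continuous $g:[0,1]\to[0,1]$ with $g(0)=0$ and $0\le g'\le1$ a.e. Convention $0\log0=0$. Eigenvalues are those of the corresponding integral operator on $L^2[0,1]$. *)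

theory Defs
  imports "HOL-Probability.Probability"
begin

locale brownian_motion = prob_space M
  for M :: "'w measure" +
  fixes W :: "real \<Rightarrow> 'w \<Rightarrow> real"
  assumes W_measurable: "\<And>t. 0 \<le> t \<Longrightarrow> random_variable borel (W t)"
    and W_zero: "AE \<omega> in M. W 0 \<omega> = 0"
    and W_increment: "\<And>s t. 0 \<le> s \<Longrightarrow> s < t \<Longrightarrow>
      distributed M lborel (\<lambda>\<omega>. W t \<omega> - W s \<omega>) (normal_density 0 (sqrt (t - s)))"
    and W_indep: "\<And>(t :: nat \<Rightarrow> real) n. 0 \<le> t 0 \<Longrightarrow> mono t \<Longrightarrow>
      indep_vars (\<lambda>_. borel) (\<lambda>i \<omega>. W (t (Suc i)) \<omega> - W (t i) \<omega>) {..<n}"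
    and W_continuous: "AE \<omega> in M. continuous_on {0..} (\<lambda>t. W t \<omega>)"

text \<open>
  The normal law with mean \<open>m\<close> and variance \<open>v \<ge> 0\<close>; the case \<open>v = 0\<close> is the point mass at
  \<open>m\<close>, for which \<^const>\<open>normal_density\<close> is not meaningful.
\<close>
definition normal_law :: "real \<Rightarrow> real \<Rightarrow> real measure" where
  "normal_law m v =
    (if v = 0 then return borel m else density lborel (\<lambda>x. ennreal (normal_density m (sqrt v) x)))"

text \<open>
  The noise of \<open>dZ = - \<gamma> Z dt + \<sigma> dW\<close> is additive, so the equation is the pathwise integral
  equation below and involves no stochastic integral.
\<close>
locale stationary_OU = brownian_motion M W
  for M :: "'w measure" and W :: "real \<Rightarrow> 'w \<Rightarrow> real" +
  fixes \<gamma> \<sigma> :: real and Z :: "real \<Rightarrow> 'w \<Rightarrow> real"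
  assumes Z_measurable: "\<And>t. 0 \<le> t \<Longrightarrow> random_variable borel (Z t)"
    and Z_initial: "distr M borel (Z 0) = normal_law 0 (\<sigma>\<^sup>2 / (2 * \<gamma>))"
    and Z_indep: "indep_set {Z 0 -` A \<inter> space M | A. A \<in> sets borel}
      (sigma_sets (space M) {W t -` A \<inter> space M | t A. 0 \<le> t \<and> A \<in> sets borel})"
    and Z_continuous: "AE \<omega> in M. continuous_on {0..} (\<lambda>t. Z t \<omega>)"
    and Z_sde: "AE \<omega> in M. \<forall>t\<ge>0.
      Z t \<omega> = Z 0 \<omega> - \<gamma> * integral {0..t} (\<lambda>s. Z s \<omega>) + \<sigma> * W t \<omega>"

primrec growth :: "'w measure \<Rightarrow> real \<Rightarrow> (nat \<Rightarrow> 'w \<Rightarrow> real) \<Rightarrow> nat \<Rightarrow> 'w \<Rightarrow> real" where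
  "growth M \<rho> Y 0 \<omega> = 1"
| "growth M \<rho> Y (Suc i) \<omega> =
    (1 + \<rho> * exp (Y i \<omega> - 1/2 * prob_space.variance M (Y i))) * growth M \<rho> Y i \<omega>"

text \<open>
  For each \<open>n \<ge> 1\<close> a stationary Ornstein-Uhlenbeck process, on its own probability space, whose
  parameters and time step satisfy the scaling that keeps \<open>\<beta>\<close> and \<open>a\<close> fixed.
\<close>
locale scaled_OU =
  fixes a \<beta> :: real
    and \<sigma> \<gamma> \<tau> :: "nat \<Rightarrow> real"
    and M :: "nat \<Rightarrow> 'w measure"
    and W Z :: "nat \<Rightarrow> real \<Rightarrow> 'w \<Rightarrow> real"
  assumes sigma_nonneg: "\<And>n. 1 \<le> n \<Longrightarrow> 0 \<le> \<sigma> n"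
    and gamma_pos: "\<And>n. 1 \<le> n \<Longrightarrow> 0 < \<gamma> n"
    and tau_pos: "\<And>n. 1 \<le> n \<Longrightarrow> 0 < \<tau> n"
    and scaling_beta: "\<And>n. 1 \<le> n \<Longrightarrow> 1/2 * (\<sigma> n)\<^sup>2 * \<tau> n * (real n)\<^sup>2 = \<beta>"
    and scaling_a: "\<And>n. 1 \<le> n \<Longrightarrow> \<gamma> n * \<tau> n * real n = a"
    and OU: "\<And>n. 1 \<le> n \<Longrightarrow> stationary_OU (M n) (W n) (\<gamma> n) (\<sigma> n) (Z n)"

definition log_growth_rate ::
    "real \<Rightarrow> (nat \<Rightarrow> real) \<Rightarrow> (nat \<Rightarrow> 'w measure) \<Rightarrow> (nat \<Rightarrow> real \<Rightarrow> 'w \<Rightarrow> real) \<Rightarrow> nat \<Rightarrow> real" where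
  "log_growth_rate \<rho> \<tau> M Z n =
    1 / real n * ln (prob_space.expectation (M n) (growth (M n) \<rho> (\<lambda>i. Z n (real i * \<tau> n)) n))"

definition lyapunov_exponent ::
    "real \<Rightarrow> (nat \<Rightarrow> real) \<Rightarrow> (nat \<Rightarrow> 'w measure) \<Rightarrow> (nat \<Rightarrow> real \<Rightarrow> 'w \<Rightarrow> real) \<Rightarrow> real" where
  "lyapunov_exponent \<rho> \<tau> M Z = lim (log_growth_rate \<rho> \<tau> M Z)"

text \<open>Since \<open>ln 0 = 0\<close> in the library, this respects the convention \<open>0 log 0 = 0\<close>.\<close>
definition entropy_I :: "real \<Rightarrow> real" where
  "entropy_I x = x * ln x + (1 - x) * ln (1 - x)"

definition kernel_K :: "real \<Rightarrow> real \<Rightarrow> real \<Rightarrow> real" where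
  "kernel_K a y z = 1 / (2 * a) * exp (- a * \<bar>y - z\<bar>)"

text \<open>
  Eigenvalues of the integral operator with a (real symmetric) kernel on the real space
  \<open>L\<^sup>2[0,1]\<close>: an eigenfunction is a square-integrable function that is not almost everywhere zero.
\<close>
definition kernel_eigenvalue :: "(real \<Rightarrow> real \<Rightarrow> real) \<Rightarrow> real \<Rightarrow> bool" where
  "kernel_eigenvalue K \<mu> \<longleftrightarrow>
    (\<exists>f \<in> borel_measurable (lebesgue_on {0..1}).
       integrable (lebesgue_on {0..1}) (\<lambda>x. (f x)\<^sup>2) \<and>
       \<not> (AE x in lebesgue_on {0..1}. f x = 0) \<and>
       (AE x in lebesgue_on {0..1}. (\<integral>y. K x y * f y \<partial>lebesgue_on {0..1}) = \<mu> * f x))"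

definition lambda0 :: "real \<Rightarrow> real" where
  "lambda0 a = (GREATEST \<mu>. kernel_eigenvalue (kernel_K a) \<mu>)"

definition k_const :: "real \<Rightarrow> real" where
  "k_const a = (\<integral>y. (\<integral>z. kernel_K a y z \<partial>lebesgue_on {0..1}) \<partial>lebesgue_on {0..1})"

definition lyapunov_upper :: "real \<Rightarrow> real \<Rightarrow> real \<Rightarrow> real" where
  "lyapunov_upper a \<rho> \<beta> =
    (SUP x\<in>{0..1}. x * ln \<rho> + lambda0 a * \<beta> * x\<^sup>2 - entropy_I x)"

definition lyapunov_lower :: "real \<Rightarrow> real \<Rightarrow> real \<Rightarrow> real" where
  "lyapunov_lower a \<rho> \<beta> =
    (SUP x\<in>{0..1}. x * ln \<rho> + k_const a * \<beta> * x\<^sup>2 - entropy_I x)"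

text \<open>A pole of \<^const>\<open>tan\<close> is not a root, because \<^const>\<open>tan\<close> is \<open>0\<close> there.\<close>
definition smallest_positive_root :: "real \<Rightarrow> real \<Rightarrow> bool" where
  "smallest_positive_root a y0 \<longleftrightarrow>
    0 < y0 \<and> y0 * tan (1/2 * a * y0) = 1 \<and>
    (\<forall>y. 0 < y \<and> y * tan (1/2 * a * y) = 1 \<longrightarrow> y0 \<le> y)"

end

theory Submission
  imports Defs "HOL-Real_Asymp.Real_Asymp"
begin

text \<open>
  Expanding the product over the sites where the noise term is chosen turns \<open>E[x\<^sub>n]\<close> into the partition
  function of a lattice gas on \<open>n\<close> sites with pair interaction \<open>\<beta> K / n\<close>. Since the kernel is positive
  semidefinite, replacing the interaction by its tangent at a density profile \<open>p\<close> bounds the partition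
  function below by \<open>exp\<close> of the mean-field free energy of \<open>p\<close>. Conversely, a configuration with
  given particle numbers in \<open>m\<close> blocks has, up to \<open>exp (O(n / m))\<close>, at most the weight
  \<open>exp (max free energy)\<close> times its probability under the product measure with these block
  densities, and there are only polynomially many block densities. So the growth rate is the limit
  of the maximal free energy per site, which is Cauchy because profiles can be replicated and averaged
  over blocks. Constant profiles give the lower bound. The upper bound follows by maximizing site by
  site after the Schur test with the positive eigenfunction \<open>cos (a y0 (x - 1/2))\<close> has replaced the
  quadratic form by \<open>lambda0\<close> times the squared norm; the same eigenfunction shows that no eigenvalue
  exceeds its own.
\<close>

section \<open>Mean-field free energy\<close>

text \<open>No supremum over a space of functions is formed: for each \<open>n\<close> the
  competitors are densities on \<open>n\<close> sites, and only their optimal values are passed to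
  the limit. Positive semidefiniteness of the interaction relies on its diagonal, whereas the
  variance normalisation of the noise removes the diagonal from \<open>E[x_n]\<close>; the
  discrepancy is at most a factor \<open>exp (\<beta> / (2 * a))\<close>, invisible once the
  logarithm is divided by \<open>n\<close>. The counting bound wants a weight that depends on a
  configuration only through its block densities; the Lipschitz kernel provides this up to an
  exponent of order \<open>n / m\<close>, with \<open>m\<close> fixed while \<open>n\<close> grows.
  The process is given by its integral equation, so its Gaussian law has to be derived. Expanding
  the product calls only for the laws of sums over finite sets of sampling times; these are limits,
  along almost every path, of explicit linear combinations of \<open>Z 0\<close> and Brownian
  increments, and characteristic functions carry the law to the limit. The behaviour as \<beta>
  tends to 0 comes from a cruder comparison of the partition function with
  \<open>(1 + \<rho>) ^ n\<close>.\<close>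

lemma mult_ln_divide_ge:
  fixes x q :: real
  assumes "0 \<le> x" "0 < q"
  shows "x * ln q \<le> x * ln x + (q - x)"
proof (cases "x = 0")
  case False
  then have "x > 0" using assms by simp
  then have "ln (q / x) \<le> q / x - 1" using assms by (intro ln_le_minus_one) auto
  then have "x * ln (q / x) \<le> x * (q / x - 1)" using \<open>x > 0\<close> by (intro mult_left_mono) auto
  then show ?thesis using \<open>x > 0\<close> assms by (simp add: ln_div algebra_simps)
qed (use assms in auto)

text \<open>Nonnegativity of the relative entropy of two Bernoulli laws: the linear error terms for
  \<open>x\<close> and for \<open>1 - x\<close> cancel.\<close>

lemma gibbs_inequality:
  fixes x q :: real
  assumes "0 \<le> x" "x \<le> 1" "0 < q" "q < 1"
  shows "x * ln q + (1 - x) * ln (1 - q) \<le> entropy_I x"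
  using mult_ln_divide_ge[of x q] mult_ln_divide_ge[of "1 - x" "1 - q"] assms
  unfolding entropy_I_def by linarith

text \<open>Taking \<open>q = 1\<close> in both summands gives \<open>- 1\<close> instead of the
  sharp \<open>- ln 2\<close>; the bound serves only to keep suprema finite.\<close>

lemma entropy_I_ge:
  assumes "0 \<le> x" "x \<le> 1"
  shows "- 1 \<le> entropy_I x"
  using mult_ln_divide_ge[of x 1] mult_ln_divide_ge[of "1 - x" 1] assms
  unfolding entropy_I_def by simp

text \<open>Fenchel-Young inequality: \<open>ln (1 + exp t)\<close> is the convex conjugate of
  \<open>entropy_I\<close>.\<close>

lemma ln_one_plus_exp_ge:
  fixes p t :: real
  assumes "0 \<le> p" "p \<le> 1"
  shows "p * t - entropy_I p \<le> ln (1 + exp t)"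
proof -
  \<comment> \<open>The maximizer of \<open>p * t - entropy_I p\<close> over \<open>p\<close>, so
    the Gibbs inequality at this \<open>q\<close> is the sharp bound.\<close>
  define q where "q = exp t / (1 + exp t)"
  have pos: "0 < 1 + exp t" by (simp add: add_pos_pos)
  have q: "0 < q" "q < 1" "1 - q = 1 / (1 + exp t)"
    using pos unfolding q_def by (auto simp: field_simps)
  have "ln q = t - ln (1 + exp t)" "ln (1 - q) = - ln (1 + exp t)"
    using pos unfolding q(3) by (auto simp: q_def ln_div)
  with gibbs_inequality[OF assms q(1,2)] show ?thesis by (simp add: algebra_simps)
qed

text \<open>With \<open>y (Suc n) = r * y n + x n\<close> and \<open>y 0 = 0\<close>, the form is at least \<open>(y n)\<^sup>2\<close>: each step adds
  \<open>(x n)\<^sup>2 + 2 * r * x n * y n\<close>, which completes \<open>(r * y n)\<^sup>2 \<le> (y n)\<^sup>2\<close> to a square.\<close>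
lemma geometric_kernel_form_nonneg:
  fixes r :: real and x :: "nat \<Rightarrow> real"
  assumes "0 \<le> r" "r \<le> 1"
  shows "0 \<le> (\<Sum>i<n. \<Sum>j<n. r ^ nat \<bar>int i - int j\<bar> * x i * x j)"
proof -
  define y where "y n = (\<Sum>i<n. r ^ (n - 1 - i) * x i)" for n
  have y_Suc: "y (Suc n) = r * y n + x n" for n
  proof -
    have "(\<Sum>i<n. r ^ (n - i) * x i) = (\<Sum>i<n. r * (r ^ (n - 1 - i) * x i))"
      by (intro sum.cong) (auto simp: power_Suc[symmetric] Suc_diff_Suc simp del: power_Suc)
    then show ?thesis by (simp add: y_def sum_distrib_left)
  qed
  have "(y n)\<^sup>2 \<le> (\<Sum>i<n. \<Sum>j<n. r ^ nat \<bar>int i - int j\<bar> * x i * x j)"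
  proof (induction n)
    case (Suc n)
    have "(\<Sum>j<n. r ^ nat \<bar>int n - int j\<bar> * x n * x j) = x n * (r * y n)"
    proof -
      have *: "r ^ nat \<bar>int n - int j\<bar> * x n * x j = x n * (r * (r ^ (n - 1 - j) * x j))" if "j < n" for j
      proof -
        have "nat \<bar>int n - int j\<bar> = Suc (n - 1 - j)" using that by auto
        then show ?thesis by (simp add: mult_ac)
      qed
      show ?thesis unfolding y_def sum_distrib_left by (intro sum.cong refl *) simp
    qed
    moreover have "(\<Sum>i<n. r ^ nat \<bar>int i - int n\<bar> * x i * x n)
        = (\<Sum>j<n. r ^ nat \<bar>int n - int j\<bar> * x n * x j)"
      by (intro sum.cong) (auto simp: abs_minus_commute)
    ultimately have "(\<Sum>i<Suc n. \<Sum>j<Suc n. r ^ nat \<bar>int i - int j\<bar> * x i * x j)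
      = (\<Sum>i<n. \<Sum>j<n. r ^ nat \<bar>int i - int j\<bar> * x i * x j) + 2 * (x n * (r * y n)) + (x n)\<^sup>2"
      by (simp add: sum.distrib power2_eq_square)
    moreover have "(r * y n)\<^sup>2 \<le> (y n)\<^sup>2"
    proof -
      have "r\<^sup>2 \<le> 1" using assms by (simp add: power_le_one)
      then show ?thesis by (simp add: power_mult_distrib mult_left_le_one_le)
    qed
    ultimately show ?case using Suc unfolding y_Suc by (simp add: power2_sum)
  qed (simp add: y_def)
  then show ?thesis using order_trans zero_le_power2 by blast
qed

section \<open>Lattice gas: interaction, free energy and the lower bound on the partition
  sum\<close>

text \<open>The diagonal is kept on purpose: a nonzero symmetric form with zero diagonal takes
  negative values.\<close>

definition kernel_form :: "real \<Rightarrow> nat \<Rightarrow> (nat \<Rightarrow> real) \<Rightarrow> real" where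
  "kernel_form a n p = (\<Sum>i<n. \<Sum>j<n. kernel_K a (i / n) (j / n) * p i * p j)"

text \<open>Divided by \<open>n\<close>, this is the functional of the variational formula for the Lyapunov exponent at
  the step function \<open>g'\<close> with values \<open>p 0, \<dots>, p (n - 1)\<close>, up to discretization of the kernel.\<close>
definition free_energy :: "real \<Rightarrow> real \<Rightarrow> real \<Rightarrow> nat \<Rightarrow> (nat \<Rightarrow> real) \<Rightarrow> real" where
  "free_energy a \<rho> \<beta> n p =
    (\<Sum>i<n. p i * ln \<rho> - entropy_I (p i)) + \<beta> / n * kernel_form a n p"

text \<open>Total functions on \<open>nat\<close>, so that one set serves every \<open>n\<close>;
  the free energy reads only the values below \<open>n\<close>.\<close>

definition profiles :: "(nat \<Rightarrow> real) set" where
  "profiles = {p. \<forall>i. 0 \<le> p i \<and> p i \<le> 1}"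

definition max_free_energy :: "real \<Rightarrow> real \<Rightarrow> real \<Rightarrow> nat \<Rightarrow> real" where
  "max_free_energy a \<rho> \<beta> n = (SUP p\<in>profiles. free_energy a \<rho> \<beta> n p / n)"

text \<open>Differs from \<open>E[x_n]\<close> by the self-interaction of the sites in
  \<open>S\<close>, which the variance normalisation of the noise cancels there.\<close>

definition partition_sum :: "real \<Rightarrow> real \<Rightarrow> real \<Rightarrow> nat \<Rightarrow> real" where
  "partition_sum a \<rho> \<beta> n =
    (\<Sum>S\<in>Pow {..<n}. \<rho> ^ card S * exp (\<beta> / n * kernel_form a n (indicator S)))"

lemma kernel_K_bounds:
  assumes "0 < a"
  shows "0 < kernel_K a x y" "kernel_K a x y \<le> 1 / (2 * a)"
  using assms by (auto simp: kernel_K_def divide_simps)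

lemma kernel_K_commute: "kernel_K a x y = kernel_K a y x"
  by (simp add: kernel_K_def abs_minus_commute)

lemma exp_minus_lipschitz:
  fixes x y :: real
  assumes "0 \<le> x" "0 \<le> y"
  shows "\<bar>exp (- x) - exp (- y)\<bar> \<le> \<bar>x - y\<bar>"
proof -
  have *: "exp (- x) - exp (- y) \<le> y - x" if "0 \<le> x" "x \<le> y" for x y :: real
  proof -
    have "exp (- x) - exp (- y) = exp (- x) * (1 - exp (- (y - x)))"
      by (simp add: algebra_simps flip: exp_add)
    also have "\<dots> \<le> 1 * (y - x)"
      using exp_ge_add_one_self[of "- (y - x)"] that
      by (intro mult_mono) (simp_all del: exp_ge_add_one_self)
    finally show ?thesis by simp
  qed
  show ?thesis
  proof (cases "x \<le> y")
    case True
    then have "exp (- y) \<le> exp (- x)" by simp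
    with *[of x y] True assms show ?thesis by linarith
  next
    case False
    then have "exp (- x) \<le> exp (- y)" by simp
    with *[of y x] False assms show ?thesis by linarith
  qed
qed

text \<open>The rate \<open>a\<close> of the exponential cancels against the prefactor
  \<open>1 / (2 * a)\<close>, so the constant \<open>1 / 2\<close> does not depend on
  \<open>a\<close>.\<close>

lemma kernel_K_lipschitz:
  assumes "0 < a"
  shows "\<bar>kernel_K a x y - kernel_K a x' y'\<bar> \<le> (\<bar>x - x'\<bar> + \<bar>y - y'\<bar>) / 2"
proof -
  have "\<bar>exp (- (a * \<bar>x - y\<bar>)) - exp (- (a * \<bar>x' - y'\<bar>))\<bar> \<le> \<bar>a * \<bar>x - y\<bar> - a * \<bar>x' - y'\<bar>\<bar>"
    using assms by (intro exp_minus_lipschitz) auto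
  also have "\<dots> = a * \<bar>\<bar>x - y\<bar> - \<bar>x' - y'\<bar>\<bar>"
    using assms by (simp add: abs_mult flip: right_diff_distrib)
  also have "\<dots> \<le> a * (\<bar>x - x'\<bar> + \<bar>y - y'\<bar>)"
    using assms by (intro mult_left_mono) auto
  finally have *: "\<bar>exp (- (a * \<bar>x - y\<bar>)) - exp (- (a * \<bar>x' - y'\<bar>))\<bar> \<le> a * (\<bar>x - x'\<bar> + \<bar>y - y'\<bar>)" .
  have "kernel_K a x y - kernel_K a x' y'
      = (exp (- (a * \<bar>x - y\<bar>)) - exp (- (a * \<bar>x' - y'\<bar>))) / (2 * a)"
    by (simp add: kernel_K_def diff_divide_distrib)
  then have "\<bar>kernel_K a x y - kernel_K a x' y'\<bar>
      = \<bar>exp (- (a * \<bar>x - y\<bar>)) - exp (- (a * \<bar>x' - y'\<bar>))\<bar> / (2 * a)"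
    using assms by (simp add: abs_divide)
  also have "\<dots> \<le> a * (\<bar>x - x'\<bar> + \<bar>y - y'\<bar>) / (2 * a)"
    using * assms by (intro divide_right_mono) auto
  finally show ?thesis using assms by simp
qed

text \<open>On the equidistant grid the kernel is geometric in the index distance, with ratio
  \<open>exp (- a / n)\<close>.\<close>

lemma kernel_form_nonneg:
  assumes "0 < a"
  shows "0 \<le> kernel_form a n p"
proof -
  define r where "r = exp (- a / n)"
  have "kernel_K a (i / n) (j / n) = 1 / (2 * a) * r ^ nat \<bar>int i - int j\<bar>" for i j
  proof -
    have "\<bar>real i / n - real j / n\<bar> = nat \<bar>int i - int j\<bar> / n"
      by (simp flip: diff_divide_distrib)
    then have "exp (- a * \<bar>real i / n - real j / n\<bar>) = exp (real (nat \<bar>int i - int j\<bar>) * (- a / n))"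
      by (simp only:) (simp add: field_simps)
    then show ?thesis by (simp only: kernel_K_def r_def exp_of_nat_mult)
  qed
  then have "kernel_form a n p
      = 1 / (2 * a) * (\<Sum>i<n. \<Sum>j<n. r ^ nat \<bar>int i - int j\<bar> * p i * p j)"
    by (simp add: kernel_form_def sum_distrib_left mult.assoc)
  moreover have "0 \<le> r" "r \<le> 1" using assms by (auto simp: r_def)
  ultimately show ?thesis using assms geometric_kernel_form_nonneg[of r p n] by simp
qed

text \<open>Nonnegativity of the form at \<open>s - p\<close>, expanded by symmetry: a convex
  quadratic form lies above its tangent at \<open>p\<close>.\<close>

lemma kernel_form_ge_linearization:
  assumes "0 < a"
  shows "2 * (\<Sum>i<n. \<Sum>j<n. kernel_K a (i / n) (j / n) * s i * p j) - kernel_form a n p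
    \<le> kernel_form a n s"
proof -
  let ?K = "\<lambda>i j. kernel_K a (i / n) (j / n)"
  have sym: "(\<Sum>i<n. \<Sum>j<n. ?K i j * p i * s j) = (\<Sum>i<n. \<Sum>j<n. ?K i j * s i * p j)"
    by (subst sum.swap) (intro sum.cong, auto simp: kernel_K_commute mult_ac)
  have "0 \<le> kernel_form a n (\<lambda>i. s i - p i)" using assms by (rule kernel_form_nonneg)
  also have "\<dots> = kernel_form a n s - (\<Sum>i<n. \<Sum>j<n. ?K i j * s i * p j)
      - (\<Sum>i<n. \<Sum>j<n. ?K i j * p i * s j) + kernel_form a n p"
    unfolding kernel_form_def
    by (simp add: sum_subtractf[symmetric] sum.distrib[symmetric]) (simp add: algebra_simps)
  finally show ?thesis unfolding sym by simp
qed

text \<open>The tangent is additive over the sites of \<open>S\<close>, so the sum over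
  \<open>S\<close> factorizes into independent sites, each contributing
  \<open>1 + exp (t i)\<close>. Conjugacy with the entropy then recovers the free energy of
  \<open>p\<close>.\<close>

lemma partition_sum_ge:
  assumes "0 < a" "0 < \<rho>" "0 \<le> \<beta>" "p \<in> profiles"
  shows "exp (free_energy a \<rho> \<beta> n p) \<le> partition_sum a \<rho> \<beta> n"
proof -
  let ?K = "\<lambda>i j. kernel_K a (i / n) (j / n)"
  \<comment> \<open>The mean field at site \<open>i\<close>: the derivative at \<open>p\<close> of
    the linear and interaction terms with respect to the density at \<open>i\<close>.\<close>
  define t where "t i = ln \<rho> + 2 * \<beta> / n * (\<Sum>j<n. ?K i j * p j)" for i :: nat
  have sum_p: "(\<Sum>i<n. p i * t i) = (\<Sum>i<n. p i * ln \<rho>) + 2 * \<beta> / n * kernel_form a n p"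
    by (simp add: t_def kernel_form_def distrib_left sum.distrib sum_distrib_left mult_ac)
  \<comment> \<open>The field counts the interaction twice; subtracting it once leaves the free
    energy.\<close>
  have "free_energy a \<rho> \<beta> n p
      = (\<Sum>i<n. p i * t i - entropy_I (p i)) - \<beta> / n * kernel_form a n p"
    using sum_p by (simp add: free_energy_def sum_subtractf algebra_simps)
  also have "\<dots> \<le> (\<Sum>i<n. ln (1 + exp (t i))) - \<beta> / n * kernel_form a n p"
    using assms by (intro diff_right_mono sum_mono ln_one_plus_exp_ge) (auto simp: profiles_def)
  finally have "exp (free_energy a \<rho> \<beta> n p)
      \<le> exp ((\<Sum>i<n. ln (1 + exp (t i))) - \<beta> / n * kernel_form a n p)" by simp
  also have "\<dots> = (\<Prod>i<n. exp (t i) + 1) * exp (- (\<beta> / n * kernel_form a n p))"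
    by (simp add: exp_diff exp_minus exp_sum field_simps add_pos_pos)
  also have "\<dots> = (\<Sum>S\<in>Pow {..<n}. (\<Prod>i\<in>S. exp (t i)) * exp (- (\<beta> / n * kernel_form a n p)))"
    by (simp add: prod_add sum_distrib_right)
  also have "\<dots> \<le> partition_sum a \<rho> \<beta> n"
    unfolding partition_sum_def
  proof (intro sum_mono)
    fix S assume "S \<in> Pow {..<n}"
    then have S: "S \<subseteq> {..<n}" "finite S" using finite_subset by auto
    have "(\<Sum>i<n. \<Sum>j<n. ?K i j * indicator S i * p j) = (\<Sum>i\<in>S. \<Sum>j<n. ?K i j * p j)"
      using S by (intro sum.mono_neutral_cong_right) auto
    then have "(\<Sum>i\<in>S. t i) = card S * ln \<rho> + 2 * \<beta> / n * (\<Sum>i<n. \<Sum>j<n. ?K i j * indicator S i * p j)"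
      by (simp add: t_def sum.distrib sum_distrib_left)
    then have "(\<Sum>i\<in>S. t i) - \<beta> / n * kernel_form a n p = card S * ln \<rho> + \<beta> / n *
        (2 * (\<Sum>i<n. \<Sum>j<n. ?K i j * indicator S i * p j) - kernel_form a n p)"
      by (simp add: algebra_simps)
    also have "\<dots> \<le> card S * ln \<rho> + \<beta> / n * kernel_form a n (indicator S)"
      using assms by (intro add_left_mono mult_left_mono kernel_form_ge_linearization) auto
    finally have "exp ((\<Sum>i\<in>S. t i) - \<beta> / n * kernel_form a n p)
      \<le> exp (card S * ln \<rho> + \<beta> / n * kernel_form a n (indicator S))" by simp
    moreover have "exp (card S * ln \<rho>) = \<rho> ^ card S" using assms by (simp add: exp_of_nat_mult)
    ultimately show "(\<Prod>i\<in>S. exp (t i)) * exp (- (\<beta> / n * kernel_form a n p))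
        \<le> \<rho> ^ card S * exp (\<beta> / n * kernel_form a n (indicator S))"
      using assms S by (simp add: exp_diff exp_minus exp_sum exp_add field_simps)
  qed
  finally show ?thesis .
qed

lemma kernel_form_le:
  assumes "0 < a" "p \<in> profiles"
  shows "kernel_form a n p \<le> (real n)\<^sup>2 / (2 * a)"
proof -
  have "kernel_K a (i / n) (j / n) * p i * p j \<le> 1 / (2 * a) * 1 * 1" for i j
    using assms kernel_K_bounds[OF assms(1), of "i / n" "j / n"]
    by (intro mult_mono) (auto simp: profiles_def less_imp_le)
  then have "kernel_form a n p \<le> (\<Sum>i<n. \<Sum>j<n. 1 / (2 * a) * 1 * 1)"
    unfolding kernel_form_def by (intro sum_mono)
  then show ?thesis by (simp add: power2_eq_square)
qed

lemma free_energy_le: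
  assumes "0 < a" "0 \<le> \<beta>" "p \<in> profiles" "0 < n"
  shows "free_energy a \<rho> \<beta> n p / n \<le> \<bar>ln \<rho>\<bar> + 1 + \<beta> / (2 * a)"
proof -
  have "p i * ln \<rho> - entropy_I (p i) \<le> \<bar>ln \<rho>\<bar> + 1" for i
  proof -
    have "p i * ln \<rho> \<le> p i * \<bar>ln \<rho>\<bar>"
      using assms(3) by (intro mult_left_mono) (auto simp: profiles_def)
    moreover have "p i * \<bar>ln \<rho>\<bar> \<le> 1 * \<bar>ln \<rho>\<bar>"
      using assms(3) by (intro mult_right_mono) (auto simp: profiles_def)
    moreover have "- 1 \<le> entropy_I (p i)"
      using assms(3) by (intro entropy_I_ge) (auto simp: profiles_def)
    ultimately show ?thesis by linarith
  qed
  then have "(\<Sum>i<n. p i * ln \<rho> - entropy_I (p i)) \<le> (\<Sum>i<n. \<bar>ln \<rho>\<bar> + 1)" by (intro sum_mono)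
  moreover have "\<beta> / n * kernel_form a n p \<le> \<beta> / n * ((real n)\<^sup>2 / (2 * a))"
    using assms by (intro mult_left_mono kernel_form_le) auto
  ultimately have "free_energy a \<rho> \<beta> n p \<le> n * (\<bar>ln \<rho>\<bar> + 1) + \<beta> / n * ((real n)\<^sup>2 / (2 * a))"
    unfolding free_energy_def by (intro add_mono) (simp_all add: distrib_left)
  also have "\<dots> = n * (\<bar>ln \<rho>\<bar> + 1 + \<beta> / (2 * a))"
    using assms(4) by (simp add: power2_eq_square distrib_left)
  finally show ?thesis using assms(4) by (simp add: pos_divide_le_eq mult.commute)
qed

lemma free_energy_le_max:
  assumes "0 < a" "0 \<le> \<beta>" "p \<in> profiles" "0 < n"
  shows "free_energy a \<rho> \<beta> n p / n \<le> max_free_energy a \<rho> \<beta> n"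
proof -
  have "bdd_above ((\<lambda>p. free_energy a \<rho> \<beta> n p / n) ` profiles)"
    using free_energy_le[OF assms(1,2) _ assms(4)] by (rule bdd_aboveI2)
  then show ?thesis unfolding max_free_energy_def using assms(3) by (intro cSUP_upper)
qed

lemma max_free_energy_le:
  assumes "\<And>p. p \<in> profiles \<Longrightarrow> free_energy a \<rho> \<beta> n p / n \<le> c"
  shows "max_free_energy a \<rho> \<beta> n \<le> c"
proof -
  have "(\<lambda>_. 0) \<in> profiles" by (simp add: profiles_def)
  then show ?thesis unfolding max_free_energy_def using assms by (intro cSUP_least) auto
qed

section \<open>Block densities and the upper bound on the partition sum\<close>

text \<open>Moving both arguments by at most \<open>1 / m\<close> changes an entry by at most
  \<open>1 / m\<close>, because the Lipschitz constant is \<open>1 / 2\<close>. The block map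
  \<open>b\<close> stays abstract since two are used: rounding \<open>i * m / n\<close> down, and
  \<open>i div k\<close>.\<close>

lemma kernel_form_block_approx:
  fixes b :: "nat \<Rightarrow> nat" and m n :: nat
  assumes "0 < a" "p \<in> profiles" and b: "\<And>i. i < n \<Longrightarrow> \<bar>i / n - b i / m\<bar> \<le> 1 / m"
  shows "\<bar>kernel_form a n p - (\<Sum>i<n. \<Sum>j<n. kernel_K a (b i / m) (b j / m) * p i * p j)\<bar>
    \<le> (real n)\<^sup>2 / m"
proof -
  have "\<bar>kernel_K a (i / n) (j / n) * p i * p j - kernel_K a (b i / m) (b j / m) * p i * p j\<bar>
      \<le> 1 / m" if "i < n" "j < n" for i j
  proof -
    have p: "0 \<le> p i" "p i \<le> 1" "0 \<le> p j" "p j \<le> 1" using assms(2) by (auto simp: profiles_def)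
    have "\<bar>kernel_K a (i / n) (j / n) - kernel_K a (b i / m) (b j / m)\<bar> \<le> 1 / m"
      using kernel_K_lipschitz[OF assms(1), of "i / n" "j / n" "b i / m" "b j / m"]
        add_mono[OF b[OF that(1)] b[OF that(2)]] by simp
    then have "\<bar>kernel_K a (i / n) (j / n) - kernel_K a (b i / m) (b j / m)\<bar> * (p i * p j) \<le> 1 / m * 1"
      using p by (intro mult_mono mult_le_one) auto
    moreover have "kernel_K a (i / n) (j / n) * p i * p j - kernel_K a (b i / m) (b j / m) * p i * p j
      = (kernel_K a (i / n) (j / n) - kernel_K a (b i / m) (b j / m)) * (p i * p j)"
      by (simp add: algebra_simps)
    ultimately show ?thesis using p by (simp add: abs_mult)
  qed
  then have "(\<Sum>i<n. \<Sum>j<n. \<bar>kernel_K a (i / n) (j / n) * p i * p j - kernel_K a (b i / m) (b j / m) * p i * p j\<bar>)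
      \<le> (\<Sum>i<n. \<Sum>j<n. 1 / m)" by (intro sum_mono) auto
  moreover have "\<bar>kernel_form a n p - (\<Sum>i<n. \<Sum>j<n. kernel_K a (b i / m) (b j / m) * p i * p j)\<bar>
      \<le> (\<Sum>i<n. \<Sum>j<n. \<bar>kernel_K a (i / n) (j / n) * p i * p j - kernel_K a (b i / m) (b j / m) * p i * p j\<bar>)"
    unfolding kernel_form_def sum_subtractf[symmetric]
    by (intro order_trans[OF sum_abs] sum_mono sum_abs)
  ultimately show ?thesis by (simp add: power2_eq_square)
qed

text \<open>Spreading the particles of a block evenly over its sites preserves their number, hence
  every sum whose summand depends only on the block. This trades a configuration for its densities
  without any error.\<close>

lemma sum_block_density:
  fixes b :: "nat \<Rightarrow> nat" and \<phi> :: "nat \<Rightarrow> real"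
  assumes "S \<subseteq> {..<n}"
    and q: "\<And>i. i < n \<Longrightarrow> q i = card {j\<in>S. b j = b i} / card {j\<in>{..<n}. b j = b i}"
  shows "(\<Sum>i\<in>S. \<phi> (b i)) = (\<Sum>i<n. q i * \<phi> (b i))"
proof -
  let ?B = "b ` {..<n}" and ?k = "\<lambda>c. card {j\<in>S. b j = c}" and ?l = "\<lambda>c. card {j\<in>{..<n}. b j = c}"
  have fin: "finite S" using assms(1) finite_subset by blast
  have "(\<Sum>i\<in>S. \<phi> (b i)) = (\<Sum>c\<in>?B. \<Sum>i\<in>{i\<in>S. b i = c}. \<phi> (b i))"
    using fin assms(1) by (subst sum.group) auto
  also have "\<dots> = (\<Sum>c\<in>?B. ?k c * \<phi> c)"
  proof (intro sum.cong refl)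
    fix c assume "c \<in> ?B"
    have "(\<Sum>i\<in>{i\<in>S. b i = c}. \<phi> (b i)) = (\<Sum>i\<in>{i\<in>S. b i = c}. \<phi> c)"
      by (intro sum.cong refl) auto
    then show "(\<Sum>i\<in>{i\<in>S. b i = c}. \<phi> (b i)) = ?k c * \<phi> c" by simp
  qed
  also have "\<dots> = (\<Sum>c\<in>?B. ?l c * (?k c / ?l c * \<phi> c))"
  proof (intro sum.cong refl)
    fix c assume "c \<in> ?B"
    \<comment> \<open>A block in the image of \<open>b\<close> contains a site, so the density is a
      genuine quotient.\<close>
    then have "?l c \<noteq> 0" by auto
    then show "?k c * \<phi> c = ?l c * (?k c / ?l c * \<phi> c)" by simp
  qed
  also have "\<dots> = (\<Sum>c\<in>?B. \<Sum>i\<in>{i\<in>{..<n}. b i = c}. q i * \<phi> (b i))"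
  proof (intro sum.cong refl)
    fix c assume "c \<in> ?B"
    have "(\<Sum>i\<in>{i\<in>{..<n}. b i = c}. q i * \<phi> (b i)) = (\<Sum>i\<in>{i\<in>{..<n}. b i = c}. ?k c / ?l c * \<phi> c)"
      by (intro sum.cong refl) (auto simp: q)
    then show "?l c * (?k c / ?l c * \<phi> c) = (\<Sum>i\<in>{i\<in>{..<n}. b i = c}. q i * \<phi> (b i))" by simp
  qed
  also have "\<dots> = (\<Sum>i<n. q i * \<phi> (b i))" by (subst sum.group) auto
  finally show ?thesis .
qed

lemma sum_indicator_form:
  fixes \<kappa> :: "nat \<Rightarrow> nat \<Rightarrow> real"
  assumes "S \<subseteq> {..<n}"
  shows "(\<Sum>i<n. \<Sum>j<n. \<kappa> i j * indicator S i * indicator S j) = (\<Sum>i\<in>S. \<Sum>j\<in>S. \<kappa> i j)"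
proof -
  have "(\<Sum>i<n. \<Sum>j<n. \<kappa> i j * indicator S i * indicator S j)
      = (\<Sum>i\<in>S. \<Sum>j<n. \<kappa> i j * indicator S j)"
    using assms by (intro sum.mono_neutral_cong_right) auto
  also have "\<dots> = (\<Sum>i\<in>S. \<Sum>j\<in>S. \<kappa> i j)"
    using assms by (intro sum.cong refl sum.mono_neutral_cong_right) auto
  finally show ?thesis .
qed

text \<open>On configurations with the block densities of \<open>S\<close>, the product measure with density \<open>q\<close> is
  constant and equals \<open>exp\<close> of the summed \<^const>\<open>entropy_I\<close>, so the entropy in the free energy of \<open>q\<close>
  is exactly what the probability of \<open>S\<close> costs.\<close>
lemma partition_weight_le:
  fixes b :: "nat \<Rightarrow> nat" and m n :: nat and \<beta> :: real
  assumes "0 < a" "0 < \<rho>" "0 \<le> \<beta>" "0 < n" and S: "S \<subseteq> {..<n}"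
    and b: "\<And>i. i < n \<Longrightarrow> \<bar>i / n - b i / m\<bar> \<le> 1 / m"
    and q: "\<And>i. i < n \<Longrightarrow> q i = card {j\<in>S. b j = b i} / card {j\<in>{..<n}. b j = b i}"
    and qp: "q \<in> profiles"
  shows "\<rho> ^ card S * exp (\<beta> / n * kernel_form a n (indicator S))
    \<le> exp (n * max_free_energy a \<rho> \<beta> n + 2 * \<beta> * n / m)
      * ((\<Prod>i\<in>S. q i) * (\<Prod>i\<in>{..<n} - S. 1 - q i))"
proof -
  let ?Kb = "\<lambda>i j. kernel_K a (b i / m) (b j / m)"
  \<comment> \<open>The density as a function of the block instead of the site, which is the form in
    which \<open>dens\<close> can absorb its logarithms.\<close>
  define d where "d c = card {j\<in>S. b j = c} / card {j\<in>{..<n}. b j = c}" for c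
  have fin: "finite S" using S finite_subset by blast
  have qd: "q i = d (b i)" if "i < n" for i using q[OF that] by (simp add: d_def)
  note dens = sum_block_density[OF S q]
  \<comment> \<open>The density can vanish off \<open>S\<close> and equal 1 on \<open>S\<close>.
    Strict inequalities hold exactly where \<open>ln (q i)\<close> and \<open>ln (1 - q i)\<close>
    are exponentiated at the end.\<close>
  have pos: "0 < q i" if "i \<in> S" for i
  proof -
    have "i < n" using that S by auto
    moreover have "{j\<in>S. b j = b i} \<noteq> {}" "{j\<in>{..<n}. b j = b i} \<noteq> {}"
      using that \<open>i < n\<close> by auto
    ultimately show ?thesis using fin by (simp add: q card_gt_0_iff)
  qed
  have less1: "q i < 1" if "i \<in> {..<n} - S" for i
  proof -
    have "card {j\<in>S. b j = b i} < card {j\<in>{..<n}. b j = b i}"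
      using that S by (intro psubset_card_mono) auto
    then show ?thesis using that by (simp add: q)
  qed
  have lin: "card S * ln \<rho> = (\<Sum>i<n. q i * ln \<rho>)"
    using dens[of "\<lambda>_. ln \<rho>"] by simp
  have ent: "(\<Sum>i<n. entropy_I (q i)) = (\<Sum>i\<in>S. ln (q i)) + (\<Sum>i\<in>{..<n} - S. ln (1 - q i))"
  proof -
    have "(\<Sum>i\<in>S. ln (q i)) = (\<Sum>i\<in>S. ln (d (b i)))"
      using S by (intro sum.cong) (auto simp: qd)
    also have "\<dots> = (\<Sum>i<n. q i * ln (q i))"
      using dens[of "\<lambda>c. ln (d c)"] by (simp add: qd)
    finally have 1: "(\<Sum>i\<in>S. ln (q i)) = (\<Sum>i<n. q i * ln (q i))" .
    have "(\<Sum>i\<in>S. ln (1 - q i)) = (\<Sum>i\<in>S. ln (1 - d (b i)))"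
      using S by (intro sum.cong) (auto simp: qd)
    also have "\<dots> = (\<Sum>i<n. q i * ln (1 - q i))"
      using dens[of "\<lambda>c. ln (1 - d c)"] by (simp add: qd)
    finally have "(\<Sum>i\<in>{..<n} - S. ln (1 - q i)) = (\<Sum>i<n. (1 - q i) * ln (1 - q i))"
      using S by (simp add: sum_diff algebra_simps sum_subtractf)
    with 1 show ?thesis by (simp add: entropy_I_def sum.distrib)
  qed
  have "indicator S \<in> profiles" by (auto simp: profiles_def indicator_def)
  then have "kernel_form a n (indicator S)
      \<le> (\<Sum>i<n. \<Sum>j<n. ?Kb i j * indicator S i * indicator S j) + (real n)\<^sup>2 / m"
    using kernel_form_block_approx[OF assms(1) _ b, of "indicator S"] by linarith
  also have "(\<Sum>i<n. \<Sum>j<n. ?Kb i j * indicator S i * indicator S j) = (\<Sum>i\<in>S. \<Sum>j\<in>S. ?Kb i j)"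
    using S by (rule sum_indicator_form)
  \<comment> \<open>With the block kernel in place, \<open>dens\<close> replaces \<open>S\<close> by
    the density in one index at a time. Entering and leaving the block kernel are the only losses,
    each \<open>n\<^sup>2 / m\<close>.\<close>
  also have "\<dots> = (\<Sum>i\<in>S. \<Sum>j<n. q j * kernel_K a (b i / m) (b j / m))"
    by (intro sum.cong refl dens)
  also have "\<dots> = (\<Sum>j<n. q j * (\<Sum>i\<in>S. ?Kb i j))"
    by (subst sum.swap) (simp add: sum_distrib_left)
  also have "\<dots> = (\<Sum>j<n. q j * (\<Sum>i<n. q i * ?Kb i j))"
    using dens[of "\<lambda>c. kernel_K a (c / m) (b _ / m)"] by simp
  also have "\<dots> = (\<Sum>i<n. \<Sum>j<n. ?Kb i j * q i * q j)"
    by (subst sum.swap) (simp add: sum_distrib_left mult_ac)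
  also have "\<dots> \<le> kernel_form a n q + (real n)\<^sup>2 / m"
    using kernel_form_block_approx[OF assms(1) qp b] by linarith
  finally have "\<beta> / n * kernel_form a n (indicator S) \<le> \<beta> / n * (kernel_form a n q + 2 * ((real n)\<^sup>2 / m))"
    using assms by (intro mult_left_mono) auto
  also have "\<dots> = \<beta> / n * kernel_form a n q + 2 * \<beta> * n / m"
    using assms by (simp add: power2_eq_square field_simps)
  finally have "card S * ln \<rho> + \<beta> / n * kernel_form a n (indicator S)
      \<le> free_energy a \<rho> \<beta> n q + 2 * \<beta> * n / m + (\<Sum>i<n. entropy_I (q i))"
    unfolding free_energy_def lin by (simp add: sum_subtractf)
  also have "\<dots> \<le> n * max_free_energy a \<rho> \<beta> n + 2 * \<beta> * n / m + (\<Sum>i<n. entropy_I (q i))"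
    using free_energy_le_max[OF assms(1,3) qp assms(4), of \<rho>] assms(4) by (simp add: field_simps)
  finally have "exp (card S * ln \<rho> + \<beta> / n * kernel_form a n (indicator S))
      \<le> exp (n * max_free_energy a \<rho> \<beta> n + 2 * \<beta> * n / m + (\<Sum>i<n. entropy_I (q i)))" by simp
  moreover have "exp (\<Sum>i<n. entropy_I (q i)) = (\<Prod>i\<in>S. q i) * (\<Prod>i\<in>{..<n} - S. 1 - q i)"
    unfolding ent exp_add using pos less1 fin by (simp add: exp_sum)
  moreover have "exp (card S * ln \<rho>) = \<rho> ^ card S" using assms by (simp add: exp_of_nat_mult)
  ultimately show ?thesis by (simp add: exp_add)
qed

text \<open>The density belonging to \<open>S\<close> varies with \<open>S\<close>; bounding its
  probability by the sum over all candidate densities in \<open>R\<close> allows the order of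
  summation to be exchanged. Each product measure then has total mass 1, so only the number of
  candidates remains.\<close>

lemma partition_sum_le:
  fixes m n :: nat and \<beta> :: real
  assumes "0 < a" "0 < \<rho>" "0 \<le> \<beta>" "0 < n" "0 < m"
  shows "partition_sum a \<rho> \<beta> n
    \<le> real ((n + 1) ^ m) * exp (n * max_free_energy a \<rho> \<beta> n + 2 * \<beta> * n / m)"
proof -
  define b where "b i = i * m div n" for i
  have b: "\<bar>i / n - b i / m\<bar> \<le> 1 / m" for i
  proof -
    have "i * m = b i * n + i * m mod n" by (simp add: b_def div_mult_mod_eq)
    then have "real i * m = real (b i) * n + real (i * m mod n)" by (metis of_nat_add of_nat_mult)
    moreover have "i * m mod n < n" using assms(4) by simp
    ultimately have "real (b i) * n \<le> real i * m" "real i * m \<le> real (b i) * n + n" by linarith+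
    then have "b i / m \<le> i / n" "i / n \<le> b i / m + 1 / m" using assms by (simp_all add: field_simps)
    then show ?thesis by linarith
  qed
  have bm: "b i < m" if "i < n" for i
    using that assms unfolding b_def by (simp add: div_less_iff_less_mult)
  \<comment> \<open>The density with \<open>k c\<close> particles in block \<open>c\<close>. The
    value 0 from \<open>n\<close> on makes it a profile on all of \<open>nat\<close>.\<close>
  define Q where "Q k i = (if i < n then real (k (b i)) / card {j\<in>{..<n}. b j = b i} else 0)"
    for k :: "nat \<Rightarrow> nat" and i
  \<comment> \<open>Some count vectors ask for more particles than a block has sites; intersecting
    with \<open>profiles\<close> discards them and keeps every \<open>P q S\<close>
    nonnegative.\<close>
  define R where "R = Q ` (\<Pi>\<^sub>E c\<in>{..<m}. {..n}) \<inter> profiles"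
  have finR: "finite R" unfolding R_def by (intro finite_Int disjI1 finite_imageI finite_PiE) auto
  have "card R \<le> card (Q ` (\<Pi>\<^sub>E c\<in>{..<m}. {..n}))"
    unfolding R_def by (intro card_mono finite_imageI finite_PiE) auto
  also have "\<dots> \<le> card (\<Pi>\<^sub>E c\<in>{..<m}. {..n})" by (intro card_image_le finite_PiE) auto
  also have "\<dots> = (n + 1) ^ m" by (simp add: card_PiE)
  finally have cardR: "card R \<le> (n + 1) ^ m" .
  define P where "P q S = (\<Prod>i\<in>S. q i) * (\<Prod>i\<in>{..<n} - S. 1 - q i)" for q :: "nat \<Rightarrow> real" and S
  have P_nonneg: "0 \<le> P q S" if "q \<in> profiles" for q S
    using that unfolding P_def profiles_def by (intro mult_nonneg_nonneg prod_nonneg) auto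
  let ?E = "exp (n * max_free_energy a \<rho> \<beta> n + 2 * \<beta> * n / m)"
  have "partition_sum a \<rho> \<beta> n \<le> (\<Sum>S\<in>Pow {..<n}. ?E * (\<Sum>q\<in>R. P q S))"
    unfolding partition_sum_def
  proof (intro sum_mono)
    fix S assume "S \<in> Pow {..<n}"
    then have S: "S \<subseteq> {..<n}" "finite S" using finite_subset by auto
    define k where "k = restrict (\<lambda>c. card {j\<in>S. b j = c}) {..<m}"
    have q: "Q k i = card {j\<in>S. b j = b i} / card {j\<in>{..<n}. b j = b i}" if "i < n" for i
      using that bm by (simp add: Q_def k_def)
    have "card {j\<in>S. b j = c} \<le> n" for c
      using card_mono[of "{..<n}" "{j\<in>S. b j = c}"] S by auto
    then have "k \<in> (\<Pi>\<^sub>E c\<in>{..<m}. {..n})" by (auto simp: k_def)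
    moreover have "Q k i \<le> 1" if "i < n" for i
    proof -
      have "card {j\<in>S. b j = b i} \<le> card {j\<in>{..<n}. b j = b i}"
        using S by (intro card_mono) auto
      then show ?thesis unfolding q[OF that]
        by (cases "card {j\<in>{..<n}. b j = b i} = 0") (simp_all only: div_by_0 of_nat_0 zero_le_one
            divide_le_eq_1 of_nat_le_iff of_nat_0_less_iff neq0_conv, simp)
    qed
    then have prof: "Q k \<in> profiles" by (auto simp: profiles_def Q_def)
    ultimately have "Q k \<in> R" by (auto simp: R_def)
    then have "P (Q k) S \<le> (\<Sum>q\<in>R. P q S)"
      using finR P_nonneg by (intro member_le_sum) (auto simp: R_def)
    then have "?E * P (Q k) S \<le> ?E * (\<Sum>q\<in>R. P q S)" by (intro mult_left_mono) auto
    moreover have "\<rho> ^ card S * exp (\<beta> / n * kernel_form a n (indicator S)) \<le> ?E * P (Q k) S"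
      unfolding P_def using assms S b q prof by (intro partition_weight_le) auto
    ultimately show "\<rho> ^ card S * exp (\<beta> / n * kernel_form a n (indicator S))
        \<le> ?E * (\<Sum>q\<in>R. P q S)" by linarith
  qed
  also have "\<dots> = ?E * (\<Sum>q\<in>R. \<Sum>S\<in>Pow {..<n}. P q S)"
    by (subst sum.swap) (simp add: sum_distrib_left)
  \<comment> \<open>Summing \<open>P q S\<close> over all \<open>S\<close> is the expansion of a
    product whose factors are \<open>q i + (1 - q i) = 1\<close>.\<close>
  also have "\<dots> = ?E * real (card R)"
    by (simp add: P_def prod_add[symmetric])
  also have "\<dots> \<le> ?E * real ((n + 1) ^ m)"
    using cardR by (intro mult_left_mono) (auto simp flip: of_nat_power of_nat_Suc)
  finally show ?thesis by (simp add: mult.commute)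
qed

section \<open>Convergence of the maximal free energy\<close>

text \<open>Jensen's inequality for \<open>entropy_I\<close>: sum the Gibbs inequality with the
  average as reference density. At average 0 or 1 the reference is degenerate, but then all the
  values coincide with the average.\<close>

lemma entropy_I_average_le:
  fixes x :: "nat \<Rightarrow> real"
  assumes "0 < k" and x: "\<And>r. r < k \<Longrightarrow> 0 \<le> x r \<and> x r \<le> 1"
  shows "k * entropy_I ((\<Sum>r<k. x r) / k) \<le> (\<Sum>r<k. entropy_I (x r))"
proof -
  define q where "q = (\<Sum>r<k. x r) / k"
  have sum_x: "(\<Sum>r<k. x r) = k * q" using assms(1) by (simp add: q_def)
  have "0 \<le> q" "q \<le> 1"
    using sum_nonneg[of "{..<k}" x] sum_bounded_above[of "{..<k}" x 1] x assms(1)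
    by (auto simp: q_def divide_le_eq)
  then consider "0 < q" "q < 1" | "q = 0" | "q = 1" by linarith
  then have "k * entropy_I q \<le> (\<Sum>r<k. entropy_I (x r))"
  proof cases
    case 1
    have "k * entropy_I q = (\<Sum>r<k. x r) * ln q + (k - (\<Sum>r<k. x r)) * ln (1 - q)"
      unfolding sum_x by (simp add: entropy_I_def algebra_simps)
    also have "\<dots> = (\<Sum>r<k. x r * ln q + (1 - x r) * ln (1 - q))"
      by (simp add: sum.distrib sum_subtractf flip: sum_distrib_right)
    also have "\<dots> \<le> (\<Sum>r<k. entropy_I (x r))"
      using 1 x by (intro sum_mono gibbs_inequality) auto
    finally show ?thesis .
  next
    case 2
    then have "x r = 0" if "r < k" for r
      using sum_x x that sum_nonneg_eq_0_iff[of "{..<k}" x] by auto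
    then show ?thesis using 2 by (simp add: entropy_I_def)
  next
    case 3
    then have "(\<Sum>r<k. 1 - x r) = 0" using sum_x by (simp add: sum_subtractf)
    then have "1 - x r = 0" if "r < k" for r
      using x that sum_nonneg_eq_0_iff[of "{..<k}" "\<lambda>r. 1 - x r"] by auto
    then show ?thesis using 3 by (simp add: entropy_I_def)
  qed
  then show ?thesis by (simp add: q_def)
qed

lemma sum_blocks:
  fixes f :: "nat \<Rightarrow> real"
  shows "(\<Sum>i<m * k. f i) = (\<Sum>c<m. \<Sum>r<k. f (c * k + r))"
proof -
  have "(\<Sum>r<k. f (c * k + r)) = sum f {c * k..<c * k + k}" for c
    using sum.shift_bounds_nat_ivl[of f 0 "c * k" k]
    by (simp add: lessThan_atLeast0 add.commute)
  then show ?thesis by (simp add: sum.nat_group)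
qed

lemma block_approx_div:
  fixes m k i :: nat
  assumes "0 < m" "0 < k"
  shows "\<bar>i / (m * k) - (i div k) / m\<bar> \<le> 1 / m"
proof -
  have "real i = real (i div k) * k + real (i mod k)"
    by (metis div_mult_mod_eq of_nat_add of_nat_mult)
  moreover have "i mod k < k" using assms by simp
  ultimately have "i div k / m \<le> i / (m * k)" "i / (m * k) \<le> i div k / m + 1 / m"
    using assms by (simp_all add: field_simps)
  then show ?thesis by linarith
qed

text \<open>Repeating every value of a profile \<open>k\<close> times multiplies the site terms by
  \<open>k\<close> and the block form by \<open>k\<^sup>2\<close>. The block error
  \<open>(m * k)\<^sup>2 / m\<close> in the form costs \<beta> \<open>/ m\<close> per site.\<close>

lemma max_free_energy_le_refined:
  fixes m k :: nat and \<beta> :: real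
  assumes "0 < a" "0 \<le> \<beta>" "0 < m" "0 < k"
  shows "max_free_energy a \<rho> \<beta> m \<le> max_free_energy a \<rho> \<beta> (m * k) + \<beta> / m"
proof (rule max_free_energy_le)
  fix p assume p: "p \<in> profiles"
  let ?n = "m * k"
  define p' where "p' i = p (i div k)" for i
  have p': "p' \<in> profiles" using p by (auto simp: p'_def profiles_def)
  have rep: "(\<Sum>i<?n. \<phi> (i div k)) = k * (\<Sum>c<m. \<phi> c)" for \<phi> :: "nat \<Rightarrow> real"
    using assms by (simp add: sum_blocks sum_distrib_left)
  have "k * (\<Sum>c<m. k * (\<Sum>c'<m. kernel_K a (c / m) (c' / m) * p c * p c'))
      = (\<Sum>i<?n. \<Sum>j<?n. kernel_K a ((i div k) / m) ((j div k) / m) * p' i * p' j)"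
    unfolding p'_def by (simp only: rep[symmetric])
  then have "k\<^sup>2 * kernel_form a m p
      = (\<Sum>i<?n. \<Sum>j<?n. kernel_K a ((i div k) / m) ((j div k) / m) * p' i * p' j)"
    by (simp add: kernel_form_def power2_eq_square sum_distrib_left mult_ac)
  then have "k\<^sup>2 * kernel_form a m p - (real ?n)\<^sup>2 / m \<le> kernel_form a ?n p'"
    using kernel_form_block_approx[OF assms(1) p' block_approx_div[OF assms(3,4)]] by linarith
  then have "\<beta> / ?n * (k\<^sup>2 * kernel_form a m p - (real ?n)\<^sup>2 / m) \<le> \<beta> / ?n * kernel_form a ?n p'"
    using assms by (intro mult_left_mono) auto
  moreover have "\<beta> / ?n * (k\<^sup>2 * kernel_form a m p - (real ?n)\<^sup>2 / m)
      = k * (\<beta> / m * kernel_form a m p) - k * \<beta>"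
    using assms by (simp add: power2_eq_square field_simps)
  moreover have "(\<Sum>i<?n. p' i * ln \<rho> - entropy_I (p' i)) = k * (\<Sum>i<m. p i * ln \<rho> - entropy_I (p i))"
    unfolding p'_def by (rule rep)
  ultimately have "k * free_energy a \<rho> \<beta> m p - k * \<beta> \<le> free_energy a \<rho> \<beta> ?n p'"
    unfolding free_energy_def by (simp add: distrib_left)
  then have "(k * free_energy a \<rho> \<beta> m p - k * \<beta>) / ?n \<le> free_energy a \<rho> \<beta> ?n p' / ?n"
    by (intro divide_right_mono) auto
  also have "\<dots> \<le> max_free_energy a \<rho> \<beta> ?n"
    using assms p' by (intro free_energy_le_max) auto
  finally have "(k * free_energy a \<rho> \<beta> m p - k * \<beta>) / ?n \<le> max_free_energy a \<rho> \<beta> ?n" .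
  moreover have "(k * free_energy a \<rho> \<beta> m p - k * \<beta>) / ?n = free_energy a \<rho> \<beta> m p / m - \<beta> / m"
    using assms by (simp add: diff_divide_distrib)
  ultimately show "free_energy a \<rho> \<beta> m p / m \<le> max_free_energy a \<rho> \<beta> ?n + \<beta> / m"
    by linarith
qed

text \<open>Averaging over blocks leaves the linear term and the block form unchanged, and convexity
  of \<open>entropy_I\<close> makes the entropy term favour the average; only the block error
  remains.\<close>

lemma max_free_energy_refined_le:
  fixes m k :: nat and \<beta> :: real
  assumes "0 < a" "0 \<le> \<beta>" "0 < m" "0 < k"
  shows "max_free_energy a \<rho> \<beta> (m * k) \<le> max_free_energy a \<rho> \<beta> m + \<beta> / m"
proof (rule max_free_energy_le)
  fix p assume p: "p \<in> profiles"
  let ?n = "m * k"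
  define q where "q c = (\<Sum>r<k. p (c * k + r)) / k" for c
  have sum_p: "(\<Sum>r<k. p (c * k + r)) = k * q c" for c using assms by (simp add: q_def)
  have q: "q \<in> profiles"
    using sum_nonneg[of "{..<k}" "\<lambda>r. p (_ * k + r)"] sum_bounded_above[of "{..<k}" "\<lambda>r. p (_ * k + r)" 1]
      p assms by (auto simp: q_def profiles_def divide_le_eq)
  have avg: "(\<Sum>i<?n. \<phi> (i div k) * p i) = k * (\<Sum>c<m. \<phi> c * q c)" for \<phi> :: "nat \<Rightarrow> real"
    using assms by (simp add: sum_blocks sum_distrib_left[symmetric] sum_p) (simp add: sum_distrib_left mult_ac)
  have "(\<Sum>i<?n. \<Sum>j<?n. kernel_K a ((i div k) / m) ((j div k) / m) * p i * p j)
      = (\<Sum>i<?n. p i * (\<Sum>j<?n. kernel_K a ((i div k) / m) ((j div k) / m) * p j))"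
    by (simp add: sum_distrib_left mult_ac)
  also have "\<dots> = (\<Sum>i<?n. k * (\<Sum>c'<m. kernel_K a ((i div k) / m) (c' / m) * q c') * p i)"
    by (subst avg) (simp add: mult.commute)
  also have "\<dots> = k * (\<Sum>c<m. k * (\<Sum>c'<m. kernel_K a (c / m) (c' / m) * q c') * q c)"
    by (rule avg)
  also have "\<dots> = k\<^sup>2 * kernel_form a m q"
    by (simp add: kernel_form_def sum_distrib_left sum_distrib_right power2_eq_square mult_ac)
  finally have "kernel_form a ?n p \<le> k\<^sup>2 * kernel_form a m q + (real ?n)\<^sup>2 / m"
    using kernel_form_block_approx[OF assms(1) p block_approx_div[OF assms(3,4)]] by linarith
  then have "\<beta> / ?n * kernel_form a ?n p \<le> \<beta> / ?n * (k\<^sup>2 * kernel_form a m q + (real ?n)\<^sup>2 / m)"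
    using assms by (intro mult_left_mono) auto
  moreover have "\<beta> / ?n * (k\<^sup>2 * kernel_form a m q + (real ?n)\<^sup>2 / m)
      = k * (\<beta> / m * kernel_form a m q) + k * \<beta>"
    using assms by (simp add: power2_eq_square field_simps)
  moreover have "(\<Sum>i<?n. p i * ln \<rho>) = k * (\<Sum>c<m. q c * ln \<rho>)"
    using avg[of "\<lambda>_. ln \<rho>"] by (simp add: mult.commute)
  moreover have "k * (\<Sum>c<m. entropy_I (q c)) \<le> (\<Sum>i<?n. entropy_I (p i))"
    unfolding sum_blocks sum_distrib_left q_def
    using p assms by (intro sum_mono entropy_I_average_le) (auto simp: profiles_def)
  ultimately have "free_energy a \<rho> \<beta> ?n p \<le> k * free_energy a \<rho> \<beta> m q + k * \<beta>"
    unfolding free_energy_def by (simp add: distrib_left sum_subtractf right_diff_distrib)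
  then have "free_energy a \<rho> \<beta> ?n p / ?n \<le> (k * free_energy a \<rho> \<beta> m q + k * \<beta>) / ?n"
    by (intro divide_right_mono) auto
  also have "\<dots> = free_energy a \<rho> \<beta> m q / m + \<beta> / m"
    using assms by (simp add: add_divide_distrib)
  also have "free_energy a \<rho> \<beta> m q / m \<le> max_free_energy a \<rho> \<beta> m"
    using assms q by (intro free_energy_le_max) auto
  finally show "free_energy a \<rho> \<beta> ?n p / ?n \<le> max_free_energy a \<rho> \<beta> m + \<beta> / m" by simp
qed

text \<open>Two sizes are compared through their common refinement \<open>m * k\<close>, which works
  without any divisibility between them.\<close>

lemma convergent_max_free_energy:
  fixes \<beta> :: real
  assumes "0 < a" "0 \<le> \<beta>"
  shows "convergent (max_free_energy a \<rho> \<beta>)"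
proof -
  have diff: "\<bar>max_free_energy a \<rho> \<beta> m - max_free_energy a \<rho> \<beta> k\<bar> \<le> \<beta> / m + \<beta> / k"
    if "0 < m" "0 < k" for m k
    using max_free_energy_le_refined[OF assms that, of \<rho>] max_free_energy_refined_le[OF assms that, of \<rho>]
      max_free_energy_le_refined[OF assms that(2,1), of \<rho>] max_free_energy_refined_le[OF assms that(2,1), of \<rho>]
    unfolding mult.commute[of k m] by linarith
  have "Cauchy (max_free_energy a \<rho> \<beta>)"
  proof (rule metric_CauchyI)
    fix e :: real assume "0 < e"
    have "(\<lambda>n. \<beta> / real n) \<longlonglongrightarrow> 0" by real_asymp
    then have "eventually (\<lambda>n. \<beta> / real n < e / 2) sequentially"
      using \<open>0 < e\<close> by (intro order_tendstoD(2)) auto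
    then obtain N where N: "\<And>n. n \<ge> N \<Longrightarrow> \<beta> / real n < e / 2"
      by (auto simp: eventually_sequentially)
    have "dist (max_free_energy a \<rho> \<beta> m) (max_free_energy a \<rho> \<beta> k) < e"
      if "m \<ge> Suc N" "k \<ge> Suc N" for m k
    proof -
      have "\<beta> / m < e / 2" "\<beta> / k < e / 2" using N that by auto
      then show ?thesis using diff[of m k] that unfolding dist_real_def by linarith
    qed
    then show "\<exists>M. \<forall>m\<ge>M. \<forall>n\<ge>M. dist (max_free_energy a \<rho> \<beta> m) (max_free_energy a \<rho> \<beta> n) < e"
      by blast
  qed
  then show ?thesis by (rule Cauchy_convergent)
qed

lemma ln_partition_sum_ge:
  fixes \<beta> :: real and m n :: nat
  assumes "0 < a" "0 < \<rho>" "0 \<le> \<beta>" "0 < n"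
  shows "max_free_energy a \<rho> \<beta> n \<le> ln (partition_sum a \<rho> \<beta> n) / n"
proof (rule max_free_energy_le)
  fix p assume "p \<in> profiles"
  then have *: "exp (free_energy a \<rho> \<beta> n p) \<le> partition_sum a \<rho> \<beta> n"
    using assms by (intro partition_sum_ge) auto
  then have "free_energy a \<rho> \<beta> n p \<le> ln (partition_sum a \<rho> \<beta> n)"
    by (subst ln_ge_iff) (auto intro: less_le_trans[OF exp_gt_zero])
  then show "free_energy a \<rho> \<beta> n p / n \<le> ln (partition_sum a \<rho> \<beta> n) / n"
    by (intro divide_right_mono) auto
qed

lemma partition_sum_pos:
  assumes "0 < \<rho>"
  shows "0 < partition_sum a \<rho> \<beta> n"
  unfolding partition_sum_def using assms by (intro sum_pos) auto

lemma ln_partition_sum_le: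
  fixes \<beta> :: real and m n :: nat
  assumes "0 < a" "0 < \<rho>" "0 \<le> \<beta>" "0 < n" "0 < m"
  shows "ln (partition_sum a \<rho> \<beta> n) / n
    \<le> max_free_energy a \<rho> \<beta> n + (2 * \<beta> / m + m * ln (real n + 1) / n)"
proof -
  have "ln (partition_sum a \<rho> \<beta> n)
      \<le> ln (real ((n + 1) ^ m) * exp (n * max_free_energy a \<rho> \<beta> n + 2 * \<beta> * n / m))"
    using partition_sum_le[OF assms] partition_sum_pos[OF assms(2)] by (intro ln_mono) auto
  also have "\<dots> = m * ln (n + 1) + (n * max_free_energy a \<rho> \<beta> n + 2 * \<beta> * n / m)"
    by (subst ln_mult) (simp_all add: ln_realpow add.commute)
  finally have "ln (partition_sum a \<rho> \<beta> n) / n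
      \<le> (m * ln (n + 1) + (n * max_free_energy a \<rho> \<beta> n + 2 * \<beta> * n / m)) / n"
    by (intro divide_right_mono) auto
  also have "\<dots> = max_free_energy a \<rho> \<beta> n + (2 * \<beta> / m + m * ln (real n + 1) / n)"
    using assms by (simp add: add_divide_distrib)
  finally show ?thesis .
qed

text \<open>The order of choices matters: \<open>m\<close> is fixed first to make the block error
  \<open>2 * \<beta> / m\<close> small, and then \<open>n\<close> is large enough for the counting
  term \<open>m * ln (n + 1) / n\<close>.\<close>

lemma ln_partition_sum_limit:
  fixes \<beta> :: real and m n :: nat
  assumes "0 < a" "0 < \<rho>" "0 \<le> \<beta>"
  shows "(\<lambda>n. ln (partition_sum a \<rho> \<beta> n) / n) \<longlonglongrightarrow> lim (max_free_energy a \<rho> \<beta>)"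
proof -
  let ?d = "\<lambda>n. ln (partition_sum a \<rho> \<beta> n) / n - max_free_energy a \<rho> \<beta> n"
  have "?d \<longlonglongrightarrow> 0"
  proof (rule LIMSEQ_I)
    fix e :: real assume "0 < e"
    obtain m :: nat where m: "m > 2 * \<beta> / (e / 2)" using reals_Archimedean2 by blast
    then have "real m > 0" using assms \<open>0 < e\<close> by (intro le_less_trans[OF _ m]) auto
    then have "m > 0" by simp
    have m': "2 * \<beta> / m < e / 2" using m \<open>m > 0\<close> \<open>0 < e\<close> by (simp add: field_simps)
    have "(\<lambda>n. real m * ln (real n + 1) / real n) \<longlonglongrightarrow> 0" by real_asymp
    then have "eventually (\<lambda>n. real m * ln (real n + 1) / real n < e / 2) sequentially"
      using \<open>0 < e\<close> by (intro order_tendstoD(2)) auto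
    then obtain N where N: "\<And>n. n \<ge> N \<Longrightarrow> real m * ln (real n + 1) / real n < e / 2"
      by (auto simp: eventually_sequentially)
    have "norm (?d n - 0) < e" if "n \<ge> Suc N" for n
    proof -
      have "0 < n" "m * ln (real n + 1) / n < e / 2" using N that by auto
      then show ?thesis
        using ln_partition_sum_ge[OF assms, of n] ln_partition_sum_le[OF assms _ \<open>m > 0\<close>, of n] m'
        unfolding real_norm_def diff_0_right by linarith
    qed
    then show "\<exists>N. \<forall>n\<ge>N. norm (?d n - 0) < e" by blast
  qed
  from tendsto_add[OF this convergent_max_free_energy[OF assms(1,3), unfolded convergent_LIMSEQ_iff, of \<rho>]]
  show ?thesis by simp
qed

section \<open>The exponential kernel\<close>

text \<open>Each of the \<open>n\<close> cells contributes an error of at most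
  \<open>L / n\<^sup>2\<close>. Left endpoints are the sampling points of
  \<open>kernel_form\<close>.\<close>

lemma riemann_sum_lipschitz:
  fixes \<phi> :: "real \<Rightarrow> real" and n :: nat
  assumes "0 < n" "0 \<le> L"
    and lip: "\<And>x y. x \<in> {0..1} \<Longrightarrow> y \<in> {0..1} \<Longrightarrow> \<bar>\<phi> x - \<phi> y\<bar> \<le> L * \<bar>x - y\<bar>"
  shows "\<bar>(\<Sum>i<n. \<phi> (i / n)) / n - integral {0..1} \<phi>\<bar> \<le> L / n"
proof -
  have "L-lipschitz_on {0..1} \<phi>"
    using assms by (intro lipschitz_onI) (auto simp: dist_real_def)
  then have cont: "continuous_on {0..1} \<phi>" by (rule lipschitz_on_continuous_on)
  have "\<bar>(\<Sum>i<k. \<phi> (i / n)) / n - integral {0..k / n} \<phi>\<bar> \<le> k * (L / n / n)" if "k \<le> n" for k :: nat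
    using that
  proof (induction k)
    case (Suc k)
    let ?s = "k / n" and ?t = "Suc k / n"
    have st: "0 \<le> ?s" "?s \<le> ?t" "?t \<le> 1" "?t - ?s = 1 / n"
      using Suc.prems assms(1) by (auto simp: divide_simps)
    have sub: "{0..?t} \<subseteq> {0..1}" "{?s..?t} \<subseteq> {0..1}"
      unfolding atLeastatMost_subset_iff using st by linarith+
    have int: "\<phi> integrable_on {0..?t}" "\<phi> integrable_on {?s..?t}"
      using sub continuous_on_subset[OF cont] integrable_continuous_real by blast+
    have "norm (integral {?s..?t} (\<lambda>x. \<phi> x - \<phi> ?s)) \<le> L / n * (?t - ?s)"
    proof (rule integral_bound)
      show "continuous_on {?s..?t} (\<lambda>x. \<phi> x - \<phi> ?s)"
        by (intro continuous_intros continuous_on_subset[OF cont sub(2)])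
      fix x assume x: "x \<in> {?s..?t}"
      have "x \<in> {0..1}" "?s \<in> {0..1}"
        using subsetD[OF sub(2) x] subsetD[OF sub(2), of ?s] st(2) by auto
      then have "\<bar>\<phi> x - \<phi> ?s\<bar> \<le> L * \<bar>x - ?s\<bar>" by (rule lip)
      also have "\<dots> \<le> L * (1 / n)" using x st assms by (intro mult_left_mono) auto
      finally show "norm (\<phi> x - \<phi> ?s) \<le> L / n" by simp
    qed (use st in auto)
    moreover have "integral {?s..?t} (\<lambda>x. \<phi> x - \<phi> ?s) = integral {?s..?t} \<phi> - \<phi> ?s / n"
      using int st by (subst integral_diff) auto
    ultimately have "\<bar>integral {?s..?t} \<phi> - \<phi> ?s / n\<bar> \<le> L / n / n" unfolding st(4) by simp
    moreover have "integral {0..?s} \<phi> + integral {?s..?t} \<phi> = integral {0..?t} \<phi>"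
      using st int by (intro Henstock_Kurzweil_Integration.integral_combine) auto
    moreover have "\<bar>(\<Sum>i<k. \<phi> (i / n)) / n - integral {0..?s} \<phi>\<bar> \<le> k * (L / n / n)"
      using Suc by simp
    moreover have "(\<Sum>i<Suc k. \<phi> (i / n)) / n = (\<Sum>i<k. \<phi> (i / n)) / n + \<phi> ?s / n"
      by (simp add: add_divide_distrib)
    moreover have "Suc k * (L / n / n) = k * (L / n / n) + L / n / n"
      by (simp add: distrib_right add_divide_distrib)
    ultimately show ?case by linarith
  qed simp
  from this[of n] show ?thesis using assms by simp
qed

text \<open>Bridge from the Bochner integrals of the definitions to gauge integrals, where
  antiderivatives can be used.\<close>

lemma lebesgue_integral_on_unit_interval:
  fixes f :: "real \<Rightarrow> real"
  assumes "continuous_on {0..1} f"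
  shows "integrable (lebesgue_on {0..1}) f"
    and "(\<integral>x. f x \<partial>lebesgue_on {0..1}) = integral {0..1} f"
proof -
  show *: "integrable (lebesgue_on {0..1}) f"
    using assms by (rule continuous_imp_integrable_real)
  show "(\<integral>x. f x \<partial>lebesgue_on {0..1}) = integral {0..1} f"
    using * by (rule lebesgue_integral_eq_integral) simp
qed

lemma continuous_on_kernel_K: "continuous_on S (kernel_K a x)"
  unfolding kernel_K_def by (intro continuous_intros)

text \<open>The kernel is smooth on either side of the diagonal, so the antiderivatives \<open>F\<close> and \<open>G\<close>
  of the two branches are joined at \<open>x\<close>.\<close>
lemma has_integral_kernel_K:
  fixes f F G :: "real \<Rightarrow> real"
  assumes "x \<in> {0..1}"
    and F: "\<And>y. (F has_real_derivative exp (- a * (x - y)) * f y) (at y)"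
    and G: "\<And>y. (G has_real_derivative exp (- a * (y - x)) * f y) (at y)"
  shows "((\<lambda>y. kernel_K a x y * f y) has_integral (F x - F 0 + (G 1 - G x)) / (2 * a)) {0..1}"
proof -
  have "((\<lambda>y. exp (- a * (x - y)) * f y) has_integral F x - F 0) {0..x}"
    using assms F by (intro fundamental_theorem_of_calculus)
      (auto simp: has_real_derivative_iff_has_vector_derivative[symmetric] intro: has_field_derivative_at_within)
  then have 1: "((\<lambda>y. exp (- a * \<bar>x - y\<bar>) * f y) has_integral F x - F 0) {0..x}"
    by (rule has_integral_eq[rotated]) auto
  have "((\<lambda>y. exp (- a * (y - x)) * f y) has_integral G 1 - G x) {x..1}"
    using assms G by (intro fundamental_theorem_of_calculus)
      (auto simp: has_real_derivative_iff_has_vector_derivative[symmetric] intro: has_field_derivative_at_within)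
  then have 2: "((\<lambda>y. exp (- a * \<bar>x - y\<bar>) * f y) has_integral G 1 - G x) {x..1}"
    by (rule has_integral_eq[rotated]) auto
  have "((\<lambda>y. exp (- a * \<bar>x - y\<bar>) * f y) has_integral (F x - F 0 + (G 1 - G x))) {0..1}"
    using assms by (intro has_integral_combine[OF _ _ 1 2]) auto
  from has_integral_mult_right[OF this, of "1 / (2 * a)"]
  show ?thesis by (simp add: kernel_K_def mult.assoc)
qed

lemma has_integral_kernel_K_const:
  assumes "0 < a" "x \<in> {0..1}"
  shows "(kernel_K a x has_integral (2 - exp (- (a * x)) - exp (- (a * (1 - x)))) / (2 * a\<^sup>2)) {0..1}"
proof -
  have "((\<lambda>y. kernel_K a x y * 1) has_integral
      (exp (- a * (x - x)) / a - exp (- a * (x - 0)) / a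
        + (- exp (- a * (1 - x)) / a - (- exp (- a * (x - x)) / a))) / (2 * a)) {0..1}"
    using assms by (intro has_integral_kernel_K) (auto intro!: derivative_eq_intros)
  moreover have "(exp (- a * (x - x)) / a - exp (- a * (x - 0)) / a
        + (- exp (- a * (1 - x)) / a - (- exp (- a * (x - x)) / a))) / (2 * a)
      = (2 - exp (- (a * x)) - exp (- (a * (1 - x)))) / (2 * a\<^sup>2)"
    using assms by (simp add: field_simps power2_eq_square)
  ultimately show ?thesis by simp
qed

lemma integral_kernel_K_const:
  assumes "0 < a" "x \<in> {0..1}"
  shows "integral {0..1} (kernel_K a x) = (2 - exp (- (a * x)) - exp (- (a * (1 - x)))) / (2 * a\<^sup>2)"
  using has_integral_kernel_K_const[OF assms] by (rule integral_unique)

lemma k_const_eq_integral: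
  assumes "0 < a"
  shows "k_const a = integral {0..1} (\<lambda>x. (2 - exp (- (a * x)) - exp (- (a * (1 - x)))) / (2 * a\<^sup>2))"
proof -
  have "k_const a = (\<integral>x. (2 - exp (- (a * x)) - exp (- (a * (1 - x)))) / (2 * a\<^sup>2) \<partial>lebesgue_on {0..1})"
    unfolding k_const_def using assms
    by (intro Bochner_Integration.integral_cong refl)
      (simp add: lebesgue_integral_on_unit_interval(2) continuous_on_kernel_K integral_kernel_K_const)
  also have "\<dots> = integral {0..1} (\<lambda>x. (2 - exp (- (a * x)) - exp (- (a * (1 - x)))) / (2 * a\<^sup>2))"
    using assms by (intro lebesgue_integral_on_unit_interval continuous_intros) auto
  finally show ?thesis .
qed

lemma k_const_formula:
  assumes "0 < a"
  shows "k_const a = 1 / a ^ 3 * (a + exp (- a) - 1)"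
proof -
  define F where "F x = (2 * x + exp (- (a * x)) / a - exp (- (a * (1 - x))) / a) / (2 * a\<^sup>2)" for x
  have "((\<lambda>x. (2 - exp (- (a * x)) - exp (- (a * (1 - x)))) / (2 * a\<^sup>2)) has_integral F 1 - F 0) {0..1}"
  proof (rule fundamental_theorem_of_calculus)
    fix x :: real
    have "(F has_real_derivative (2 - exp (- (a * x)) - exp (- (a * (1 - x)))) / (2 * a\<^sup>2)) (at x)"
      unfolding F_def using assms by (intro DERIV_cdivide) (auto intro!: derivative_eq_intros)
    then show "(F has_vector_derivative (2 - exp (- (a * x)) - exp (- (a * (1 - x)))) / (2 * a\<^sup>2)) (at x within {0..1})"
      by (simp add: has_real_derivative_iff_has_vector_derivative[symmetric] has_field_derivative_at_within)
  qed simp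
  then have "k_const a = F 1 - F 0" unfolding k_const_eq_integral[OF assms] by (rule integral_unique)
  also have "\<dots> = 1 / a ^ 3 * (a + exp (- a) - 1)"
    using assms by (simp add: F_def field_simps power2_eq_square power3_eq_cube)
  finally show ?thesis .
qed

text \<open>One variable at a time: each inner sum is within \<open>1 / (2 * n)\<close> of the row
  integral, uniformly in the row, and the closed form of the row integral is Lipschitz with constant
  \<open>1 / a\<close>, which controls the outer sum.\<close>

lemma kernel_form_const_limit:
  assumes "0 < a"
  shows "(\<lambda>n. kernel_form a n (\<lambda>_. x) / (real n)\<^sup>2) \<longlonglongrightarrow> k_const a * x\<^sup>2"
proof -
  let ?\<kappa> = "\<lambda>x. (2 - exp (- (a * x)) - exp (- (a * (1 - x)))) / (2 * a\<^sup>2)"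
  let ?D = "\<lambda>n::nat. (\<Sum>i<n. \<Sum>j<n. kernel_K a (i / n) (j / n)) / (real n)\<^sup>2"
  have "\<bar>?D n - k_const a\<bar> \<le> (1 / 2 + 1 / a) * (1 / n)" if "0 < n" for n
  proof -
    have "\<bar>(\<Sum>i<n. ?\<kappa> (i / n)) / n - integral {0..1} ?\<kappa>\<bar> \<le> 1 / a / n"
    proof (rule riemann_sum_lipschitz[where \<phi> = ?\<kappa> and L = "1 / a"])
      fix x y :: real assume xy: "x \<in> {0..1}" "y \<in> {0..1}"
      have 1: "\<bar>exp (- (a * x)) - exp (- (a * y))\<bar> \<le> \<bar>a * x - a * y\<bar>"
        and 2: "\<bar>exp (- (a * (1 - x))) - exp (- (a * (1 - y)))\<bar> \<le> \<bar>a * (1 - x) - a * (1 - y)\<bar>"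
        using xy assms by (intro exp_minus_lipschitz; simp)+
      have "a * (1 - x) - a * (1 - y) = - (a * x - a * y)" by (simp add: algebra_simps)
      then have "\<bar>a * (1 - x) - a * (1 - y)\<bar> = \<bar>a * x - a * y\<bar>" by simp
      moreover have "\<bar>a * x - a * y\<bar> = a * \<bar>x - y\<bar>"
        using assms by (simp add: abs_mult flip: right_diff_distrib)
      moreover have "\<bar>p - q\<bar> \<le> d \<Longrightarrow> \<bar>r - s\<bar> \<le> d \<Longrightarrow> \<bar>(2 - p - r) - (2 - q - s)\<bar> \<le> 2 * d"
        for p q r s d :: real by linarith
      ultimately have "\<bar>(2 - exp (- (a * x)) - exp (- (a * (1 - x)))) - (2 - exp (- (a * y)) - exp (- (a * (1 - y))))\<bar>
          \<le> 2 * (a * \<bar>x - y\<bar>)"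
        using 1 2 by metis
      then have "\<bar>(2 - exp (- (a * x)) - exp (- (a * (1 - x)))) - (2 - exp (- (a * y)) - exp (- (a * (1 - y))))\<bar> / (2 * a\<^sup>2)
          \<le> 2 * (a * \<bar>x - y\<bar>) / (2 * a\<^sup>2)"
        by (intro divide_right_mono) auto
      also have "\<dots> = 1 / a * \<bar>x - y\<bar>" using assms by (simp add: power2_eq_square)
      finally show "\<bar>?\<kappa> x - ?\<kappa> y\<bar> \<le> 1 / a * \<bar>x - y\<bar>"
        by (simp only: diff_divide_distrib[symmetric] abs_divide) simp
    qed (use that assms in auto)
    moreover have "\<bar>?D n - (\<Sum>i<n. ?\<kappa> (i / n)) / n\<bar> \<le> 1 / 2 / n"
    proof -
      have "\<bar>(\<Sum>j<n. kernel_K a (i / n) (j / n)) / n - ?\<kappa> (i / n)\<bar> \<le> 1 / 2 / n" if "i < n" for i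
      proof -
        have "\<bar>(\<Sum>j<n. kernel_K a (i / n) (j / n)) / n - integral {0..1} (kernel_K a (i / n))\<bar> \<le> 1 / 2 / n"
          using kernel_K_lipschitz[OF assms, of "i / n" _ "i / n"] that
          by (intro riemann_sum_lipschitz[where L = "1 / 2"]) auto
        then show ?thesis using assms that by (simp add: integral_kernel_K_const)
      qed
      then have "(\<Sum>i<n. \<bar>(\<Sum>j<n. kernel_K a (i / n) (j / n)) / n - ?\<kappa> (i / n)\<bar>) \<le> (\<Sum>i<n. 1 / 2 / n)"
        by (intro sum_mono) auto
      then have "\<bar>\<Sum>i<n. (\<Sum>j<n. kernel_K a (i / n) (j / n)) / n - ?\<kappa> (i / n)\<bar> \<le> 1 / 2"
        using that by (intro order_trans[OF sum_abs]) simp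
      then have "\<bar>\<Sum>i<n. (\<Sum>j<n. kernel_K a (i / n) (j / n)) / n - ?\<kappa> (i / n)\<bar> / n \<le> 1 / 2 / n"
        by (intro divide_right_mono) auto
      moreover have "?D n - (\<Sum>i<n. ?\<kappa> (i / n)) / n
          = (\<Sum>i<n. (\<Sum>j<n. kernel_K a (i / n) (j / n)) / n - ?\<kappa> (i / n)) / n"
        by (simp add: sum_subtractf diff_divide_distrib power2_eq_square flip: sum_divide_distrib)
      ultimately show ?thesis by simp
    qed
    ultimately show ?thesis unfolding k_const_eq_integral[OF assms] by (simp add: algebra_simps)
  qed
  then have "\<forall>\<^sub>F n in sequentially. norm (?D n - k_const a) \<le> (1 / 2 + 1 / a) * (1 / n)"
    by (intro eventually_mono[OF eventually_gt_at_top[of 0]]) (simp only: real_norm_def)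
  moreover have "(\<lambda>n. (1 / 2 + 1 / a) * (1 / real n)) \<longlonglongrightarrow> 0"
    using tendsto_mult[OF tendsto_const lim_1_over_n] by simp
  ultimately have "(\<lambda>n. ?D n - k_const a) \<longlonglongrightarrow> 0" by (rule Lim_null_comparison)
  then have "?D \<longlonglongrightarrow> k_const a" by (simp add: LIM_zero_iff)
  from tendsto_mult[OF this tendsto_const[of "x\<^sup>2"]]
  show ?thesis by (simp add: kernel_form_def sum_distrib_left sum_distrib_right power2_eq_square mult_ac)
qed

section \<open>The largest eigenvalue and the Schur test\<close>

text \<open>Multiplying the equation by the cosine removes the poles of \<open>tan\<close>, so the
  intermediate value theorem applies on the interval from 0 to \<open>pi / a\<close>. There
  \<open>y * tan (a * y / 2)\<close> is strictly increasing, which gives minimality. The pole-free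
  equation and \<open>y0 < pi / a\<close> are what the eigenfunction requires.\<close>

lemma smallest_positive_root_exists:
  assumes "0 < a"
  obtains y0 where "smallest_positive_root a y0" "y0 < pi / a" "y0 * sin (a * y0 / 2) = cos (a * y0 / 2)"
proof -
  let ?f = "\<lambda>y. y * sin (a * y / 2) - cos (a * y / 2)"
  \<comment> \<open>The endpoint values are \<open>- 1\<close> and \<open>pi / a\<close>.\<close>
  have "\<exists>y\<ge>0. y \<le> pi / a \<and> ?f y = 0"
    using assms by (intro IVT') (auto intro!: continuous_intros)
  then obtain y0 where y0: "0 \<le> y0" "y0 \<le> pi / a" "?f y0 = 0" by blast
  have "y0 \<noteq> 0" "y0 \<noteq> pi / a" using y0(3) assms by auto
  then have y0': "0 < y0" "y0 < pi / a" using y0 by auto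
  have range: "0 < a * y / 2" "a * y / 2 < pi / 2" if "0 < y" "y < pi / a" for y
    using that assms by (simp_all add: field_simps)
  have "cos (a * y0 / 2) > 0" using range[OF y0'] by (intro cos_gt_zero)
  then have root: "y0 * tan (a * y0 / 2) = 1" using y0(3) by (simp add: tan_def field_simps)
  have "y0 \<le> y" if y: "0 < y" "y * tan (a * y / 2) = 1" for y
  proof (rule ccontr)
    assume "\<not> y0 \<le> y"
    then have "y < y0" by simp
    have "tan (a * y / 2) < tan (a * y0 / 2)"
    proof (rule tan_monotone)
      show "- (pi / 2) < a * y / 2" using range(1)[of y] pi_gt_zero y \<open>y < y0\<close> y0' by linarith
      show "a * y / 2 < a * y0 / 2" using \<open>y < y0\<close> assms by simp
      show "a * y0 / 2 < pi / 2" by (rule range(2)[OF y0'])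
    qed
    moreover have "0 < tan (a * y / 2)" using range[of y] \<open>y < y0\<close> y y0' by (intro tan_gt_zero) auto
    ultimately have "y * tan (a * y / 2) < y0 * tan (a * y0 / 2)"
      using \<open>y < y0\<close> y by (intro mult_strict_mono) auto
    then show False using y root by simp
  qed
  then have "smallest_positive_root a y0"
    using y0' root by (simp add: smallest_positive_root_def)
  then show thesis using y0' y0(3) by (intro that) auto
qed

lemma AE_lebesgue_on_unit_interval_False: "\<not> (AE x in lebesgue_on {0..1::real}. False)"
proof
  assume "AE x in lebesgue_on {0..1::real}. False"
  then have "emeasure (lebesgue_on {0..1::real}) (space (lebesgue_on {0..1})) = 0"
    by (metis ae_filter_eq_bot_iff eventually_False)
  then show False by (simp add: emeasure_restrict_space)
qed

context
  fixes a y0 :: real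
  assumes a: "0 < a" and y0: "0 < y0" "y0 < pi / a" "y0 * sin (a * y0 / 2) = cos (a * y0 / 2)"
begin

definition top_eigenvalue :: real where
  "top_eigenvalue = 1 / (a\<^sup>2 * (1 + y0\<^sup>2))"

text \<open>The kernel is a Green function of \<open>a\<^sup>2\<close> minus the second derivative,
  so a cosine of frequency \<open>w\<close> can only have eigenvalue
  \<open>1 / (a\<^sup>2 + w\<^sup>2)\<close>. Centred at \<open>1 / 2\<close>, it is an
  eigenfunction when \<open>w * sin (w / 2) = a * cos (w / 2)\<close>, which is the root equation
  for \<open>w = a * y0\<close>.\<close>

definition top_eigenfunction :: "real \<Rightarrow> real" where
  "top_eigenfunction x = cos (a * y0 * (x - 1 / 2))"

lemma top_eigenvalue_pos: "0 < top_eigenvalue"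
  using a y0 by (simp add: top_eigenvalue_def add_pos_pos)

lemma continuous_on_top_eigenfunction: "continuous_on S top_eigenfunction"
  unfolding top_eigenfunction_def by (intro continuous_intros)

text \<open>The cosine decreases with the distance from \<open>1 / 2\<close>, so its minimum is at
  the endpoints. This positive lower bound lets additive errors be absorbed into multiples of the
  eigenfunction.\<close>

lemma top_eigenfunction_ge:
  assumes "x \<in> {0..1}"
  shows "cos (a * y0 / 2) \<le> top_eigenfunction x"
proof -
  have half: "\<bar>x - 1 / 2\<bar> \<le> 1 / 2" unfolding abs_le_iff using assms by auto
  have "\<bar>a * y0 * (x - 1 / 2)\<bar> = a * y0 * \<bar>x - 1 / 2\<bar>" using a y0 by (simp add: abs_mult)
  also have "\<dots> \<le> a * y0 * (1 / 2)" using half a y0 by (intro mult_left_mono) auto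
  finally have "\<bar>a * y0 * (x - 1 / 2)\<bar> \<le> a * y0 / 2" by simp
  moreover have "a * y0 < pi" using a y0 by (simp add: field_simps)
  then have "a * y0 / 2 \<le> pi" using pi_gt_zero by linarith
  ultimately have "cos (a * y0 / 2) \<le> cos \<bar>a * y0 * (x - 1 / 2)\<bar>"
    by (intro cos_monotone_0_pi_le) auto
  then show ?thesis by (simp add: top_eigenfunction_def)
qed

lemma cos_half_pos: "0 < cos (a * y0 / 2)"
  using a y0 by (intro cos_gt_zero) (auto simp: field_simps)

lemma top_eigenfunction_pos: "x \<in> {0..1} \<Longrightarrow> 0 < top_eigenfunction x"
  using top_eigenfunction_ge[of x] cos_half_pos by linarith

text \<open>In the difference of the two antiderivatives at the diagonal the sines cancel and the
  cosines add up; the boundary terms vanish.\<close>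

lemma has_integral_top_eigenfunction:
  assumes "x \<in> {0..1}"
  shows "((\<lambda>y. kernel_K a x y * top_eigenfunction y) has_integral top_eigenvalue * top_eigenfunction x) {0..1}"
proof -
  define w where "w = a * y0"
  define F where "F y = exp (- a * (x - y)) * (a * cos (w * (y - 1 / 2)) + w * sin (w * (y - 1 / 2))) / (a\<^sup>2 + w\<^sup>2)" for y
  define G where "G y = exp (- a * (y - x)) * (w * sin (w * (y - 1 / 2)) - a * cos (w * (y - 1 / 2))) / (a\<^sup>2 + w\<^sup>2)" for y
  define D where "D = a\<^sup>2 + w\<^sup>2"
  have D: "D \<noteq> 0" using a by (simp add: D_def sum_power2_eq_zero_iff)
  have dF: "(F has_real_derivative exp (- a * (x - y)) * top_eigenfunction y) (at y)" for y
  proof -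
    have "(F has_real_derivative (D * (exp (- a * (x - y)) * cos (w * (y - 1 / 2)))) / D) (at y)"
      unfolding F_def D_def by (intro DERIV_cdivide)
        (auto intro!: derivative_eq_intros simp: algebra_simps power2_eq_square)
    then show ?thesis using D by (simp add: top_eigenfunction_def w_def)
  qed
  have dG: "(G has_real_derivative exp (- a * (y - x)) * top_eigenfunction y) (at y)" for y
  proof -
    have "(G has_real_derivative (D * (exp (- a * (y - x)) * cos (w * (y - 1 / 2)))) / D) (at y)"
      unfolding G_def D_def by (intro DERIV_cdivide)
        (auto intro!: derivative_eq_intros simp: algebra_simps power2_eq_square)
    then show ?thesis using D by (simp add: top_eigenfunction_def w_def)
  qed
  have root: "w * sin (w / 2) = a * cos (w / 2)" using y0(3) by (simp add: w_def mult.assoc)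
  \<comment> \<open>This is where the root equation enters: it says exactly that no boundary term
    survives.\<close>
  have "F 0 = 0" "G 1 = 0" using root by (simp_all add: F_def G_def)
  moreover have "F x - G x = 2 * a * (cos (w * (x - 1 / 2)) / (a\<^sup>2 + w\<^sup>2))"
    by (simp add: F_def G_def flip: diff_divide_distrib)
  moreover have "cos (w * (x - 1 / 2)) / (a\<^sup>2 + w\<^sup>2) = top_eigenvalue * top_eigenfunction x"
    by (simp add: top_eigenvalue_def top_eigenfunction_def w_def power_mult_distrib distrib_left)
  ultimately have "(F x - F 0 + (G 1 - G x)) / (2 * a) = top_eigenvalue * top_eigenfunction x"
    using a by simp
  with has_integral_kernel_K[OF assms dF dG] show ?thesis by simp
qed

lemma kernel_eigenvalue_top: "kernel_eigenvalue (kernel_K a) top_eigenvalue"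
  unfolding kernel_eigenvalue_def
proof (intro bexI conjI)
  show "top_eigenfunction \<in> borel_measurable (lebesgue_on {0..1})"
    by (intro continuous_imp_measurable_on_sets_lebesgue continuous_on_top_eigenfunction) auto
  show "integrable (lebesgue_on {0..1}) (\<lambda>x. (top_eigenfunction x)\<^sup>2)"
    by (intro lebesgue_integral_on_unit_interval continuous_intros continuous_on_top_eigenfunction)
  show "\<not> (AE x in lebesgue_on {0..1}. top_eigenfunction x = 0)"
  proof
    assume "AE x in lebesgue_on {0..1}. top_eigenfunction x = 0"
    moreover have "AE x in lebesgue_on {0..1}. top_eigenfunction x = 0 \<longrightarrow> False"
      using top_eigenfunction_pos by (intro AE_I2) force
    ultimately have "AE x in lebesgue_on {0..1::real}. False" by (rule AE_mp)
    then show False using AE_lebesgue_on_unit_interval_False by blast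
  qed
  show "AE x in lebesgue_on {0..1}. (\<integral>y. kernel_K a x y * top_eigenfunction y \<partial>lebesgue_on {0..1})
      = top_eigenvalue * top_eigenfunction x"
    using has_integral_top_eigenfunction
    by (intro AE_I2) (auto simp: lebesgue_integral_on_unit_interval continuous_intros
        continuous_on_kernel_K continuous_on_top_eigenfunction intro!: integral_unique)
qed

text \<open>A bound of an eigenfunction by a multiple of the positive eigenfunction improves by the
  factor \<open>top_eigenvalue / \<mu>\<close> each time the eigenvalue equation is applied.\<close>
lemma kernel_eigenvalue_le_top:
  assumes "kernel_eigenvalue (kernel_K a) \<mu>"
  shows "\<mu> \<le> top_eigenvalue"
proof (rule ccontr)
  assume "\<not> \<mu> \<le> top_eigenvalue"
  then have \<mu>: "top_eigenvalue < \<mu>" by simp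
  then have "0 < \<mu>" using top_eigenvalue_pos by linarith
  let ?M = "lebesgue_on {0..1::real}"
  obtain f where f_meas: "f \<in> borel_measurable ?M"
    and f_props: "integrable ?M (\<lambda>x. (f x)\<^sup>2) \<and> \<not> (AE x in ?M. f x = 0) \<and>
      (AE x in ?M. (\<integral>y. kernel_K a x y * f y \<partial>?M) = \<mu> * f x)"
    using assms[unfolded kernel_eigenvalue_def] by (rule bexE)
  note f = f_meas f_props[THEN conjunct1] f_props[THEN conjunct2, THEN conjunct1]
    f_props[THEN conjunct2, THEN conjunct2]
  interpret finite_measure ?M by (rule finite_measure_lebesgue_on) simp
  have int_f: "integrable ?M (\<lambda>y. \<bar>f y\<bar>)"
    by (rule integrable_abs[OF square_integrable_imp_integrable[OF f(1,2)]])
  have meas_K: "kernel_K a x \<in> borel_measurable ?M" for x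
    by (intro continuous_imp_measurable_on_sets_lebesgue continuous_on_kernel_K) simp
  have K_bound: "\<bar>kernel_K a x y\<bar> \<le> 1 / (2 * a)" "0 \<le> kernel_K a x y" for x y
    using kernel_K_bounds[OF a, of x y] by linarith+
  have int_K: "integrable ?M (\<lambda>y. kernel_K a x y * \<bar>f y\<bar>)" for x
  proof (rule Bochner_Integration.integrable_bound)
    show "integrable ?M (\<lambda>y. 1 / (2 * a) * \<bar>f y\<bar>)" using int_f by simp
    have "norm (kernel_K a x y * \<bar>f y\<bar>) \<le> norm (1 / (2 * a) * \<bar>f y\<bar>)" for y
      using mult_right_mono[OF K_bound(1)[of x y], of "\<bar>f y\<bar>"] a by (simp add: abs_mult)
    then show "AE y in ?M. norm (kernel_K a x y * \<bar>f y\<bar>) \<le> norm (1 / (2 * a) * \<bar>f y\<bar>)"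
      by (intro AE_I2)
    show "(\<lambda>y. kernel_K a x y * \<bar>f y\<bar>) \<in> borel_measurable ?M"
      by (intro borel_measurable_times borel_measurable_abs meas_K f(1))
  qed
  \<comment> \<open>Positivity of the kernel and of \<mu> lets absolute values pass inside, so
    \<open>\<bar>f\<bar>\<close> satisfies the eigenvalue equation as an inequality.\<close>
  have f_le: "AE x in ?M. \<mu> * \<bar>f x\<bar> \<le> (\<integral>y. kernel_K a x y * \<bar>f y\<bar> \<partial>?M)"
    using f(4)
  proof eventually_elim
    case (elim x)
    then have "\<mu> * \<bar>f x\<bar> = norm (\<integral>y. kernel_K a x y * f y \<partial>?M)"
      using \<open>0 < \<mu>\<close> by (simp add: abs_mult)
    also have "\<dots> \<le> (\<integral>y. norm (kernel_K a x y * f y) \<partial>?M)" by (rule integral_norm_bound)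
    finally show ?case using K_bound(2)[of x] by (simp add: abs_mult)
  qed
  define B where "B = (\<integral>y. 1 / (2 * a) * \<bar>f y\<bar> \<partial>?M)"
  \<comment> \<open>One application of the operator to an integrable function bounds
    \<open>\<bar>f\<bar>\<close> by \<open>B / \<mu>\<close>; dividing by the minimum of the
    eigenfunction turns this constant into a multiple of it and starts the iteration.\<close>
  define C where "C = B / \<mu> / cos (a * y0 / 2)"
  have "0 \<le> B" unfolding B_def using a by (intro Bochner_Integration.integral_nonneg) auto
  then have "0 \<le> C" using \<open>0 < \<mu>\<close> cos_half_pos by (simp add: C_def)
  have bound: "AE x in ?M. \<bar>f x\<bar> \<le> C * (top_eigenvalue / \<mu>) ^ k * top_eigenfunction x" for k
  proof (induction k)
    case 0
    have *: "AE x in ?M. x \<in> {0..1}" by (intro AE_I2) auto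
    show ?case using f_le *
    proof eventually_elim
      case (elim x)
      have "kernel_K a x y * \<bar>f y\<bar> \<le> 1 / (2 * a) * \<bar>f y\<bar>" for y
        using K_bound[of x y] by (intro mult_right_mono) auto
      then have "(\<integral>y. kernel_K a x y * \<bar>f y\<bar> \<partial>?M) \<le> B"
        unfolding B_def using int_f by (intro integral_mono int_K integrable_mult_right)
      then have "\<bar>f x\<bar> \<le> B / \<mu>" using elim \<open>0 < \<mu>\<close> by (simp add: field_simps)
      also have "\<dots> = C * cos (a * y0 / 2)" using cos_half_pos by (simp add: C_def)
      also have "\<dots> \<le> C * top_eigenfunction x"
        using \<open>0 \<le> C\<close> top_eigenfunction_ge elim by (intro mult_left_mono) auto
      finally show ?case by simp
    qed
  next
    case (Suc k)
    let ?c = "C * (top_eigenvalue / \<mu>) ^ k"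
    have *: "AE x in ?M. x \<in> {0..1}" by (intro AE_I2) auto
    show ?case using f_le *
    proof eventually_elim
      case (elim x)
      have int: "integrable ?M (\<lambda>y. kernel_K a x y * top_eigenfunction y)"
        "(\<integral>y. kernel_K a x y * top_eigenfunction y \<partial>?M) = top_eigenvalue * top_eigenfunction x"
        using has_integral_top_eigenfunction[OF elim(2)]
        by (auto simp: lebesgue_integral_on_unit_interval continuous_intros
          continuous_on_kernel_K continuous_on_top_eigenfunction intro!: integral_unique)
      have "(\<integral>y. kernel_K a x y * \<bar>f y\<bar> \<partial>?M) \<le> (\<integral>y. ?c * (kernel_K a x y * top_eigenfunction y) \<partial>?M)"
      proof (intro integral_mono_AE int_K integrable_mult_right int)
        show "AE y in ?M. kernel_K a x y * \<bar>f y\<bar> \<le> ?c * (kernel_K a x y * top_eigenfunction y)"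
          using Suc
        proof eventually_elim
          case (elim y)
          from mult_left_mono[OF this K_bound(2)[of x y]] show ?case by (simp add: mult_ac)
        qed
      qed
      then have "\<mu> * \<bar>f x\<bar> \<le> ?c * (top_eigenvalue * top_eigenfunction x)"
        using elim by (simp only: integral_mult_right_zero int(2))
      then show ?case using \<open>0 < \<mu>\<close> by (simp add: field_simps)
    qed
  qed
  \<comment> \<open>The exceptional null set depends on \<open>k\<close>; countably many of them can
    be merged before \<open>k\<close> tends to infinity.\<close>
  have "AE x in ?M. \<forall>k. \<bar>f x\<bar> \<le> C * (top_eigenvalue / \<mu>) ^ k * top_eigenfunction x"
    using bound by (simp add: AE_all_countable)
  then have "AE x in ?M. f x = 0"
  proof eventually_elim
    case (elim x)
    have "(\<lambda>k. C * (top_eigenvalue / \<mu>) ^ k * top_eigenfunction x) \<longlonglongrightarrow> C * 0 * top_eigenfunction x"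
      using \<mu> top_eigenvalue_pos by (intro tendsto_intros LIMSEQ_power_zero) auto
    then have "\<bar>f x\<bar> \<le> C * 0 * top_eigenfunction x"
      using elim by (intro LIMSEQ_le_const[rotated]) auto
    then show ?case by simp
  qed
  then show False using f by blast
qed

lemma lambda0_eq_top: "lambda0 a = top_eigenvalue"
  unfolding lambda0_def using kernel_eigenvalue_top kernel_eigenvalue_le_top
  by (intro Greatest_equality) auto

lemma lambda0_formula: "lambda0 a = 1 / (a\<^sup>2 * (1 + y0\<^sup>2))"
  unfolding lambda0_eq_top top_eigenvalue_def ..

lemma abs_cos_diff_le: "\<bar>cos x - cos y\<bar> \<le> \<bar>x - y :: real\<bar>"
proof -
  have "\<bar>cos x - cos y\<bar> = 2 * (\<bar>sin ((x + y) / 2)\<bar> * \<bar>sin ((y - x) / 2)\<bar>)"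
    by (simp add: cos_diff_cos abs_mult)
  also have "\<dots> \<le> 2 * (1 * \<bar>(y - x) / 2\<bar>)"
    by (intro mult_left_mono mult_mono abs_sin_le_one abs_sin_x_le_abs_x) auto
  finally show ?thesis by (simp add: abs_minus_commute)
qed

text \<open>The numerator is a Lipschitz constant of
  \<open>kernel_K a x y * top_eigenfunction y\<close> in \<open>y\<close>: \<open>1 / 2\<close> from
  the kernel and \<open>1 / (2 * a) * (a * y0)\<close> from the cosine. Division by the minimum of
  the eigenfunction makes the discretization error relative.\<close>

definition schur_error :: real where
  "schur_error = (1 / 2 + y0 / 2) / cos (a * y0 / 2)"

lemma schur_error_nonneg: "0 \<le> schur_error"
  unfolding schur_error_def using cos_half_pos y0 by simp

lemma top_eigenfunction_riemann_sum_le: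
  fixes i n :: nat
  assumes "i < n"
  shows "(\<Sum>j<n. kernel_K a (i / n) (j / n) * top_eigenfunction (j / n))
    \<le> n * (top_eigenvalue + schur_error / n) * top_eigenfunction (i / n)"
proof -
  let ?x = "real i / n"
  have x: "?x \<in> {0..1}" and n: "0 < n" using assms by auto
  have "\<bar>(\<Sum>j<n. kernel_K a ?x (j / n) * top_eigenfunction (j / n)) / n
      - integral {0..1} (\<lambda>y. kernel_K a ?x y * top_eigenfunction y)\<bar> \<le> (1 / 2 + y0 / 2) / n"
  proof (rule riemann_sum_lipschitz)
    fix y z :: real
    have K: "\<bar>kernel_K a ?x y - kernel_K a ?x z\<bar> \<le> \<bar>y - z\<bar> / 2"
      using kernel_K_lipschitz[OF a, of ?x y ?x z] by simp
    have "\<bar>top_eigenfunction y - top_eigenfunction z\<bar> \<le> \<bar>a * y0 * (y - 1 / 2) - a * y0 * (z - 1 / 2)\<bar>"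
      unfolding top_eigenfunction_def by (rule abs_cos_diff_le)
    also have "\<dots> = \<bar>a * y0 * (y - z)\<bar>" by (simp add: algebra_simps)
    finally have u: "\<bar>top_eigenfunction y - top_eigenfunction z\<bar> \<le> a * y0 * \<bar>y - z\<bar>"
      using a y0 by (simp add: abs_mult)
    have "kernel_K a ?x y * top_eigenfunction y - kernel_K a ?x z * top_eigenfunction z
        = (kernel_K a ?x y - kernel_K a ?x z) * top_eigenfunction y
          + kernel_K a ?x z * (top_eigenfunction y - top_eigenfunction z)"
      by (simp add: algebra_simps)
    also have "\<bar>\<dots>\<bar> \<le> \<bar>kernel_K a ?x y - kernel_K a ?x z\<bar> * \<bar>top_eigenfunction y\<bar>
        + kernel_K a ?x z * \<bar>top_eigenfunction y - top_eigenfunction z\<bar>"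
      using abs_triangle_ineq abs_mult abs_of_pos[OF kernel_K_bounds(1)[OF a, of ?x z]] by metis
    also have "\<dots> \<le> \<bar>y - z\<bar> / 2 * 1 + 1 / (2 * a) * (a * y0 * \<bar>y - z\<bar>)"
    proof (rule add_mono)
      show "\<bar>kernel_K a ?x y - kernel_K a ?x z\<bar> * \<bar>top_eigenfunction y\<bar> \<le> \<bar>y - z\<bar> / 2 * 1"
        using K by (rule mult_mono) (auto simp: top_eigenfunction_def)
      show "kernel_K a ?x z * \<bar>top_eigenfunction y - top_eigenfunction z\<bar>
          \<le> 1 / (2 * a) * (a * y0 * \<bar>y - z\<bar>)"
        using kernel_K_bounds(2)[OF a] u by (rule mult_mono) (use a in auto)
    qed
    finally show "\<bar>kernel_K a ?x y * top_eigenfunction y - kernel_K a ?x z * top_eigenfunction z\<bar>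
        \<le> (1 / 2 + y0 / 2) * \<bar>y - z\<bar>"
      using a by (simp add: algebra_simps)
  qed (use n y0 in auto)
  then have "(\<Sum>j<n. kernel_K a ?x (j / n) * top_eigenfunction (j / n)) / n
      \<le> top_eigenvalue * top_eigenfunction ?x + (1 / 2 + y0 / 2) / n"
    unfolding integral_unique[OF has_integral_top_eigenfunction[OF x]] by linarith
  also have "(1 / 2 + y0 / 2) / n = schur_error / n * cos (a * y0 / 2)"
    using cos_half_pos by (simp add: schur_error_def)
  also have "\<dots> \<le> schur_error / n * top_eigenfunction ?x"
    using schur_error_nonneg by (intro mult_left_mono top_eigenfunction_ge x) simp
  also have "top_eigenvalue * top_eigenfunction ?x + schur_error / n * top_eigenfunction ?x
      = (top_eigenvalue + schur_error / n) * top_eigenfunction ?x"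
    by (simp add: distrib_right)
  finally show ?thesis using n by (simp only: pos_divide_le_eq of_nat_0_less_iff mult_ac)
qed

text \<open>Schur test: \<open>2 * p i * p j\<close> is at most
  \<open>(p i)\<^sup>2 * u j / u i + (p j)\<^sup>2 * u i / u j\<close> for positive weights
  \<open>u\<close>. With the sampled eigenfunction as weight, the row sums reproduce the eigenvalue
  up to the discretization error.\<close>

lemma kernel_form_le_top_eigenvalue:
  "kernel_form a n p \<le> n * (top_eigenvalue + schur_error / n) * (\<Sum>i<n. (p i)\<^sup>2)"
proof -
  let ?K = "\<lambda>i j :: nat. kernel_K a (i / n) (j / n)" and ?u = "\<lambda>i :: nat. top_eigenfunction (i / n)"
  have u: "0 < ?u i" if "i < n" for i using that by (intro top_eigenfunction_pos) auto
  have "kernel_form a n p \<le> (\<Sum>i<n. \<Sum>j<n. ?K i j * ((p i)\<^sup>2 * (?u j / ?u i) + (p j)\<^sup>2 * (?u i / ?u j)) / 2)"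
    unfolding kernel_form_def
  proof (intro sum_mono)
    fix i j assume "i \<in> {..<n}" "j \<in> {..<n}"
    then have ij: "0 < ?u i" "0 < ?u j" using u by auto
    have "0 \<le> (p i * ?u j - p j * ?u i)\<^sup>2 / (?u i * ?u j)" using ij by simp
    also have "\<dots> = (p i)\<^sup>2 * (?u j / ?u i) + (p j)\<^sup>2 * (?u i / ?u j) - 2 * (p i * p j)"
      using ij by (simp add: power2_diff field_simps power2_eq_square)
    finally have "?K i j * (2 * (p i * p j)) \<le> ?K i j * ((p i)\<^sup>2 * (?u j / ?u i) + (p j)\<^sup>2 * (?u i / ?u j))"
      using kernel_K_bounds[OF a, of "i / n" "j / n"] by (intro mult_left_mono) auto
    then show "?K i j * p i * p j \<le> ?K i j * ((p i)\<^sup>2 * (?u j / ?u i) + (p j)\<^sup>2 * (?u i / ?u j)) / 2"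
      by (simp add: mult_ac)
  qed
  also have "\<dots> = (\<Sum>i<n. \<Sum>j<n. ?K i j * ((p i)\<^sup>2 * (?u j / ?u i))) / 2
      + (\<Sum>i<n. \<Sum>j<n. ?K i j * ((p j)\<^sup>2 * (?u i / ?u j))) / 2"
    by (simp add: sum_divide_distrib add_divide_distrib distrib_left sum.distrib)
  also have "(\<Sum>i<n. \<Sum>j<n. ?K i j * ((p j)\<^sup>2 * (?u i / ?u j)))
      = (\<Sum>i<n. \<Sum>j<n. ?K i j * ((p i)\<^sup>2 * (?u j / ?u i)))"
    by (subst sum.swap) (simp add: kernel_K_commute)
  also have "(\<Sum>i<n. \<Sum>j<n. ?K i j * ((p i)\<^sup>2 * (?u j / ?u i))) / 2
      + (\<Sum>i<n. \<Sum>j<n. ?K i j * ((p i)\<^sup>2 * (?u j / ?u i))) / 2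
      = (\<Sum>i<n. (p i)\<^sup>2 / ?u i * (\<Sum>j<n. ?K i j * ?u j))"
    by (simp add: sum_distrib_left mult_ac)
  also have "\<dots> \<le> (\<Sum>i<n. (p i)\<^sup>2 / ?u i * (n * (top_eigenvalue + schur_error / n) * ?u i))"
    using u by (intro sum_mono mult_left_mono top_eigenfunction_riemann_sum_le) (auto simp: less_imp_le)
  also have "\<dots> = (\<Sum>i<n. n * (top_eigenvalue + schur_error / n) * (p i)\<^sup>2)"
  proof (intro sum.cong refl)
    fix i assume "i \<in> {..<n}"
    then show "(p i)\<^sup>2 / ?u i * (n * (top_eigenvalue + schur_error / n) * ?u i)
        = n * (top_eigenvalue + schur_error / n) * (p i)\<^sup>2"
      using u[of i] by (simp add: mult_ac)
  qed
  finally show ?thesis by (simp add: sum_distrib_left)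
qed

end

section \<open>Bounds for the limiting free energy\<close>

text \<open>Hides the root \<open>y0\<close>; what matters later is that \<open>c\<close> is uniform
  in \<open>n\<close> and \<open>p\<close>.\<close>

lemma kernel_form_le_lambda0:
  assumes "0 < a"
  obtains c where "0 \<le> c"
    "\<And>n p. kernel_form a n p \<le> n * (lambda0 a + c / n) * (\<Sum>i<n. (p i)\<^sup>2)"
proof -
  obtain y0 where y0: "smallest_positive_root a y0" "y0 < pi / a"
      "y0 * sin (a * y0 / 2) = cos (a * y0 / 2)"
    using smallest_positive_root_exists[OF assms] .
  then have "0 < y0" by (simp add: smallest_positive_root_def)
  note y0' = assms this y0(2,3)
  show thesis
    using schur_error_nonneg[OF y0'] kernel_form_le_top_eigenvalue[OF y0']
    unfolding lambda0_eq_top[OF y0', symmetric] by (rule that)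
qed

lemma lambda0_properties:
  assumes "0 < a"
  shows "0 < lambda0 a" "kernel_eigenvalue (kernel_K a) (lambda0 a)"
    "\<And>\<mu>. kernel_eigenvalue (kernel_K a) \<mu> \<Longrightarrow> \<mu> \<le> lambda0 a"
    "\<exists>y0. smallest_positive_root a y0 \<and> lambda0 a = 1 / (a\<^sup>2 * (1 + y0\<^sup>2))"
proof -
  obtain y0 where y0: "smallest_positive_root a y0" "y0 < pi / a"
      "y0 * sin (a * y0 / 2) = cos (a * y0 / 2)"
    using smallest_positive_root_exists[OF assms] .
  then have "0 < y0" by (simp add: smallest_positive_root_def)
  note y0' = assms this y0(2,3)
  note top = lambda0_eq_top[OF y0']
  show "0 < lambda0 a" unfolding top by (rule top_eigenvalue_pos[OF y0'])
  show "kernel_eigenvalue (kernel_K a) (lambda0 a)" unfolding top by (rule kernel_eigenvalue_top[OF y0'])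
  show "\<mu> \<le> lambda0 a" if "kernel_eigenvalue (kernel_K a) \<mu>" for \<mu>
    unfolding top using that by (rule kernel_eigenvalue_le_top[OF y0'])
  show "\<exists>y0. smallest_positive_root a y0 \<and> lambda0 a = 1 / (a\<^sup>2 * (1 + y0\<^sup>2))"
    using y0(1) lambda0_formula[OF y0'] by (intro exI conjI)
qed

lemma lyapunov_upper_ge:
  assumes "0 < a" "0 \<le> \<beta>" "0 \<le> x" "x \<le> 1"
  shows "x * ln \<rho> + lambda0 a * \<beta> * x\<^sup>2 - entropy_I x \<le> lyapunov_upper a \<rho> \<beta>"
  unfolding lyapunov_upper_def
proof (rule cSUP_upper)
  show "bdd_above ((\<lambda>x. x * ln \<rho> + lambda0 a * \<beta> * x\<^sup>2 - entropy_I x) ` {0..1})"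
  proof (rule bdd_aboveI2)
    fix x :: real assume x: "x \<in> {0..1}"
    have "x * ln \<rho> \<le> x * \<bar>ln \<rho>\<bar>" using x by (intro mult_left_mono) auto
    also have "\<dots> \<le> 1 * \<bar>ln \<rho>\<bar>" using x by (intro mult_right_mono) auto
    finally have "x * ln \<rho> \<le> \<bar>ln \<rho>\<bar>" by simp
    moreover have "lambda0 a * \<beta> * x\<^sup>2 \<le> lambda0 a * \<beta> * 1"
      using x assms lambda0_properties(1)[OF assms(1)]
      by (intro mult_left_mono mult_nonneg_nonneg) (auto simp: power_le_one)
    moreover have "- 1 \<le> entropy_I x" using x by (intro entropy_I_ge) auto
    ultimately show "x * ln \<rho> + lambda0 a * \<beta> * x\<^sup>2 - entropy_I x \<le> \<bar>ln \<rho>\<bar> + lambda0 a * \<beta> + 1"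
      by linarith
  qed
qed (use assms in auto)

lemma lim_max_free_energy_le_upper:
  fixes \<beta> :: real
  assumes "0 < a" "0 \<le> \<beta>"
  shows "lim (max_free_energy a \<rho> \<beta>) \<le> lyapunov_upper a \<rho> \<beta>"
proof -
  obtain c where c: "0 \<le> c" "\<And>n p. kernel_form a n p \<le> n * (lambda0 a + c / n) * (\<Sum>i<n. (p i)\<^sup>2)"
    using kernel_form_le_lambda0[OF assms(1)] by blast
  have le: "max_free_energy a \<rho> \<beta> n \<le> lyapunov_upper a \<rho> \<beta> + \<beta> * c * (1 / n)" if "0 < n" for n
  proof (rule max_free_energy_le)
    fix p assume p: "p \<in> profiles"
    let ?s = "\<Sum>i<n. (p i)\<^sup>2"
    \<comment> \<open>Since the squares sum to at most \<open>n\<close>, the correction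
      \<open>c / n\<close> contributes at most \<open>\<beta> * c\<close> to the total free energy,
      which vanishes per site.\<close>
    have "?s \<le> (\<Sum>i<n. 1)" using p by (intro sum_mono) (auto simp: profiles_def power_le_one)
    then have s: "?s \<le> n" by simp
    have "\<beta> / n * kernel_form a n p \<le> \<beta> / n * (n * (lambda0 a + c / n) * ?s)"
      using assms c by (intro mult_left_mono) auto
    also have "\<dots> = lambda0 a * \<beta> * ?s + \<beta> * c / n * ?s"
      using that by (simp add: field_simps)
    also have "\<dots> \<le> lambda0 a * \<beta> * ?s + \<beta> * c / n * n"
      using s assms c by (intro add_left_mono mult_left_mono) auto
    finally have "free_energy a \<rho> \<beta> n p
        \<le> (\<Sum>i<n. p i * ln \<rho> + lambda0 a * \<beta> * (p i)\<^sup>2 - entropy_I (p i)) + \<beta> * c"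
      using that unfolding free_energy_def by (simp add: sum.distrib sum_subtractf sum_distrib_left)
    also have "(\<Sum>i<n. p i * ln \<rho> + lambda0 a * \<beta> * (p i)\<^sup>2 - entropy_I (p i))
        \<le> (\<Sum>i<n. lyapunov_upper a \<rho> \<beta>)"
      using p assms by (intro sum_mono lyapunov_upper_ge) (auto simp: profiles_def)
    finally have "free_energy a \<rho> \<beta> n p \<le> n * lyapunov_upper a \<rho> \<beta> + \<beta> * c" by simp
    then have "free_energy a \<rho> \<beta> n p / n \<le> (n * lyapunov_upper a \<rho> \<beta> + \<beta> * c) / n"
      by (rule divide_right_mono) simp
    then show "free_energy a \<rho> \<beta> n p / n \<le> lyapunov_upper a \<rho> \<beta> + \<beta> * c * (1 / n)"
      using that by (simp add: add_divide_distrib)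
  qed
  have "(\<lambda>n. lyapunov_upper a \<rho> \<beta> + \<beta> * c * (1 / real n)) \<longlonglongrightarrow> lyapunov_upper a \<rho> \<beta> + \<beta> * c * 0"
    by (intro tendsto_intros lim_1_over_n)
  then show ?thesis
    using convergent_max_free_energy[OF assms, unfolded convergent_LIMSEQ_iff, of \<rho>] le
    by (intro LIMSEQ_le[of _ _ "\<lambda>n. lyapunov_upper a \<rho> \<beta> + \<beta> * c * (1 / real n)"])
      (auto intro!: exI[of _ 1])
qed

lemma lower_le_lim_max_free_energy:
  fixes \<beta> :: real
  assumes "0 < a" "0 \<le> \<beta>"
  shows "lyapunov_lower a \<rho> \<beta> \<le> lim (max_free_energy a \<rho> \<beta>)"
  unfolding lyapunov_lower_def
proof (rule cSUP_least)
  fix x :: real assume x: "x \<in> {0..1}"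
  let ?f = "\<lambda>n. x * ln \<rho> - entropy_I x + \<beta> * (kernel_form a n (\<lambda>_. x) / (real n)\<^sup>2)"
  have "?f n \<le> max_free_energy a \<rho> \<beta> n" if "0 < n" for n
  proof -
    have "free_energy a \<rho> \<beta> n (\<lambda>_. x) / n = ?f n"
      using that by (simp add: free_energy_def field_simps power2_eq_square)
    then show ?thesis using free_energy_le_max[OF assms, of "\<lambda>_. x" n \<rho>] x that
      by (simp add: profiles_def)
  qed
  moreover have "?f \<longlonglongrightarrow> x * ln \<rho> - entropy_I x + \<beta> * (k_const a * x\<^sup>2)"
    using assms by (intro tendsto_intros kernel_form_const_limit)
  ultimately have "x * ln \<rho> - entropy_I x + \<beta> * (k_const a * x\<^sup>2) \<le> lim (max_free_energy a \<rho> \<beta>)"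
    using convergent_max_free_energy[OF assms, unfolded convergent_LIMSEQ_iff, of \<rho>]
    by (intro LIMSEQ_le[of ?f]) (auto intro!: exI[of _ 1])
  then show "x * ln \<rho> + k_const a * \<beta> * x\<^sup>2 - entropy_I x \<le> lim (max_free_energy a \<rho> \<beta>)"
    by (simp add: algebra_simps)
qed simp

text \<open>The interaction lies between \<open>0\<close> and \<open>n * (\<beta> / (2 * a))\<close>
  for every \<open>S\<close>, and without interaction the sum is the expansion of
  \<open>(1 + \<rho>) ^ n\<close>. The window closes as \<beta> tends to 0.\<close>

lemma partition_sum_bounds:
  fixes \<beta> :: real
  assumes "0 < a" "0 < \<rho>" "0 \<le> \<beta>" "0 < n"
  shows "(1 + \<rho>) ^ n \<le> partition_sum a \<rho> \<beta> n"
    "partition_sum a \<rho> \<beta> n \<le> exp (n * (\<beta> / (2 * a))) * (1 + \<rho>) ^ n"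
proof -
  have binomial: "(\<Sum>S\<in>Pow {..<n}. \<rho> ^ card S) = (1 + \<rho>) ^ n"
    using prod_add[of "{..<n}" "\<lambda>_. \<rho>" "\<lambda>_. 1"] by (simp add: add.commute)
  have "0 \<le> \<beta> / n * kernel_form a n (indicator S)" for S
    using assms by (intro mult_nonneg_nonneg kernel_form_nonneg) auto
  then show "(1 + \<rho>) ^ n \<le> partition_sum a \<rho> \<beta> n"
    unfolding partition_sum_def binomial[symmetric] using assms by (intro sum_mono) auto
  have "\<beta> / n * kernel_form a n (indicator S) \<le> n * (\<beta> / (2 * a))" for S
  proof -
    have "\<beta> / n * kernel_form a n (indicator S) \<le> \<beta> / n * ((real n)\<^sup>2 / (2 * a))"
      using assms by (intro mult_left_mono kernel_form_le) (auto simp: profiles_def indicator_def)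
    then show ?thesis using assms by (simp add: power2_eq_square mult.commute)
  qed
  then have "partition_sum a \<rho> \<beta> n \<le> (\<Sum>S\<in>Pow {..<n}. \<rho> ^ card S * exp (n * (\<beta> / (2 * a))))"
    unfolding partition_sum_def using assms by (intro sum_mono mult_left_mono) auto
  then show "partition_sum a \<rho> \<beta> n \<le> exp (n * (\<beta> / (2 * a))) * (1 + \<rho>) ^ n"
    by (simp add: binomial mult.commute flip: sum_distrib_right)
qed

lemma lim_max_free_energy_bounds:
  fixes \<beta> :: real
  assumes "0 < a" "0 < \<rho>" "0 \<le> \<beta>"
  shows "ln (\<rho> + 1) \<le> lim (max_free_energy a \<rho> \<beta>)"
    "lim (max_free_energy a \<rho> \<beta>) \<le> ln (\<rho> + 1) + \<beta> / (2 * a)"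
proof -
  note lim = ln_partition_sum_limit[OF assms]
  have "ln (\<rho> + 1) \<le> ln (partition_sum a \<rho> \<beta> n) / n" if "0 < n" for n
  proof -
    have "n * ln (1 + \<rho>) = ln ((1 + \<rho>) ^ n)" using assms by (simp add: ln_realpow)
    also have "\<dots> \<le> ln (partition_sum a \<rho> \<beta> n)"
      using partition_sum_bounds(1)[OF assms that] assms by (intro ln_mono) auto
    finally show ?thesis using that by (simp add: field_simps)
  qed
  then show "ln (\<rho> + 1) \<le> lim (max_free_energy a \<rho> \<beta>)"
    by (intro LIMSEQ_le_const[OF lim]) (auto intro!: exI[of _ 1])
  have "ln (partition_sum a \<rho> \<beta> n) / n \<le> ln (\<rho> + 1) + \<beta> / (2 * a)" if "0 < n" for n
  proof -
    have "ln (partition_sum a \<rho> \<beta> n) \<le> ln (exp (n * (\<beta> / (2 * a))) * (1 + \<rho>) ^ n)"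
      using partition_sum_bounds(2)[OF assms that] partition_sum_pos[OF assms(2)] by (intro ln_mono) auto
    also have "\<dots> = n * (\<beta> / (2 * a)) + n * ln (1 + \<rho>)"
      using assms by (subst ln_mult) (auto simp: ln_realpow)
    finally have "ln (partition_sum a \<rho> \<beta> n) / n \<le> (n * (\<beta> / (2 * a)) + n * ln (1 + \<rho>)) / n"
      by (rule divide_right_mono) simp
    also have "\<dots> = ln (\<rho> + 1) + \<beta> / (2 * a)"
      using that by (simp add: add_divide_distrib add.commute)
    finally show ?thesis .
  qed
  then show "lim (max_free_energy a \<rho> \<beta>) \<le> ln (\<rho> + 1) + \<beta> / (2 * a)"
    by (intro LIMSEQ_le_const2[OF lim]) (auto intro!: exI[of _ 1])
qed

section \<open>Joint law of the stationary Ornstein-Uhlenbeck process\<close>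

text \<open>Writing the law as a scaled standard normal treats the point mass \<open>v = 0\<close>
  and the nondegenerate case uniformly from here on.\<close>

lemma normal_law_eq_distr:
  assumes "0 \<le> v"
  shows "normal_law 0 v = distr std_normal_distribution borel (\<lambda>x. sqrt v * x)"
proof -
  interpret std: prob_space std_normal_distribution by (rule prob_space_normal_density) simp
  show ?thesis
  proof (cases "v = 0")
    case True
    have "distr std_normal_distribution borel (\<lambda>x. 0 :: real) = return borel 0"
      by (rule std.distr_const) simp
    then show ?thesis using True by (simp add: normal_law_def)
  next
    case False
    then have "0 < v" using assms by simp
    have "distributed std_normal_distribution lborel (\<lambda>x. x) std_normal_density"
      unfolding distributed_def by (auto simp: distr_id2)
    then have "distributed std_normal_distribution lborel (\<lambda>x. 0 + sqrt v * x)
        (normal_density (0 + sqrt v * 0) (\<bar>sqrt v\<bar> * 1))"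
      using \<open>0 < v\<close> by (intro std.normal_density_affine) auto
    then have "distr std_normal_distribution lborel (\<lambda>x. sqrt v * x)
        = density lborel (\<lambda>x. ennreal (normal_density 0 (sqrt v) x))"
      using \<open>0 < v\<close> by (simp add: distributed_def)
    moreover have "distr std_normal_distribution lborel (\<lambda>x. sqrt v * x)
        = distr std_normal_distribution borel (\<lambda>x. sqrt v * x)"
      by (rule distr_cong) auto
    ultimately show ?thesis using False by (simp add: normal_law_def)
  qed
qed

lemma real_distribution_normal_law: "0 \<le> v \<Longrightarrow> real_distribution (normal_law 0 v)"
proof -
  assume "0 \<le> v"
  interpret std: prob_space std_normal_distribution by (rule prob_space_normal_density) simp
  show ?thesis unfolding normal_law_eq_distr[OF \<open>0 \<le> v\<close>] by (rule std.real_distribution_distr) simp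
qed

lemma char_distr_scale:
  assumes "X \<in> borel_measurable M"
  shows "char (distr M borel (\<lambda>\<omega>. c * X \<omega>)) u = char (distr M borel X) (c * u)"
  using assms by (simp add: char_def integral_distr mult_ac)

lemma char_normal_law:
  assumes "0 \<le> v"
  shows "char (normal_law 0 v) u = exp (- (v * u\<^sup>2) / 2)"
proof -
  have "char (normal_law 0 v) u = char (distr std_normal_distribution borel (\<lambda>x. x)) (sqrt v * u)"
    unfolding normal_law_eq_distr[OF assms] by (rule char_distr_scale) simp
  also have "distr std_normal_distribution borel (\<lambda>x. x) = std_normal_distribution"
    by (rule distr_id2) simp
  finally show ?thesis
    using assms by (simp add: char_std_normal_distribution power_mult_distrib)
qed

text \<open>All integrals are moved to the standard normal density, where \<open>v = 0\<close> is
  merely scaling by zero.\<close>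

lemma (in prob_space) normal_law_moments:
  assumes X: "X \<in> borel_measurable M" and law: "distr M borel X = normal_law 0 v" and v: "0 \<le> v"
  shows "integrable M (\<lambda>\<omega>. exp (X \<omega>))" "expectation (\<lambda>\<omega>. exp (X \<omega>)) = exp (v / 2)"
    "variance X = v"
proof -
  have transfer: "(integrable M (\<lambda>\<omega>. f (X \<omega>)) \<longleftrightarrow> integrable lborel (\<lambda>x. std_normal_density x * f (sqrt v * x)))
      \<and> expectation (\<lambda>\<omega>. f (X \<omega>)) = (\<integral>x. std_normal_density x * f (sqrt v * x) \<partial>lborel)"
    if f: "f \<in> borel_measurable borel" for f :: "real \<Rightarrow> real"
  proof -
    have "integrable M (\<lambda>\<omega>. f (X \<omega>)) \<longleftrightarrow> integrable (normal_law 0 v) f"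
      unfolding law[symmetric] using X f by (simp add: integrable_distr_eq)
    also have "\<dots> \<longleftrightarrow> integrable std_normal_distribution (\<lambda>x. f (sqrt v * x))"
      unfolding normal_law_eq_distr[OF v] using f by (subst integrable_distr_eq) auto
    also have "\<dots> \<longleftrightarrow> integrable lborel (\<lambda>x. std_normal_density x * f (sqrt v * x))"
      using f by (subst integrable_density) auto
    finally have 1: "integrable M (\<lambda>\<omega>. f (X \<omega>)) \<longleftrightarrow> integrable lborel (\<lambda>x. std_normal_density x * f (sqrt v * x))" .
    have "expectation (\<lambda>\<omega>. f (X \<omega>)) = (\<integral>x. f x \<partial>normal_law 0 v)"
      unfolding law[symmetric] using X f by (simp add: integral_distr)
    also have "\<dots> = (\<integral>x. f (sqrt v * x) \<partial>std_normal_distribution)"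
      unfolding normal_law_eq_distr[OF v] using f by (subst integral_distr) auto
    also have "\<dots> = (\<integral>x. std_normal_density x * f (sqrt v * x) \<partial>lborel)"
      using f by (subst integral_density) auto
    finally show ?thesis using 1 by simp
  qed
  have "std_normal_density x * exp (sqrt v * x) = exp (v / 2) * normal_density (sqrt v) 1 x" for x
  proof -
    \<comment> \<open>Completing the square: the exponential weight shifts the mean to
      \<open>sqrt v\<close> and leaves the factor \<open>exp (v / 2)\<close>.\<close>
    have "- x\<^sup>2 / 2 + sqrt v * x = v / 2 + - (x - sqrt v)\<^sup>2 / 2"
      using v by (simp add: power2_diff field_simps)
    then have "exp (- x\<^sup>2 / 2) * exp (sqrt v * x) = exp (v / 2) * exp (- (x - sqrt v)\<^sup>2 / 2)"
      by (simp only: exp_add[symmetric])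
    then show ?thesis by (simp add: normal_density_def)
  qed
  then have dens: "(\<lambda>x. std_normal_density x * exp (sqrt v * x)) = (\<lambda>x. exp (v / 2) * normal_density (sqrt v) 1 x)"
    by (rule ext)
  show "integrable M (\<lambda>\<omega>. exp (X \<omega>))"
    using transfer[of exp] integrable_normal_density[of 1 "sqrt v"] unfolding dens by simp
  show "expectation (\<lambda>\<omega>. exp (X \<omega>)) = exp (v / 2)"
    using transfer[of exp] integral_normal_density[of 1 "sqrt v"] unfolding dens by simp
  have "expectation X = (\<integral>x. std_normal_density x * (sqrt v * x) \<partial>lborel)"
    using transfer[of "\<lambda>x. x"] by simp
  also have "\<dots> = sqrt v * (\<integral>x. std_normal_density x * x ^ 1 \<partial>lborel)"
    by (subst integral_mult_right_zero[symmetric]) (simp add: mult_ac)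
  also have "(\<integral>x. std_normal_density x * x ^ 1 \<partial>lborel) = 0"
    using integral_std_normal_moment_odd[of 0] by simp
  finally have mean: "expectation X = 0" by simp
  have "variance X = (\<integral>x. std_normal_density x * (sqrt v * x)\<^sup>2 \<partial>lborel)"
    using transfer[of "\<lambda>x. x\<^sup>2"] by (simp add: mean)
  also have "\<dots> = v * (\<integral>x. std_normal_density x * x\<^sup>2 \<partial>lborel)"
    using v by (subst integral_mult_right_zero[symmetric]) (simp add: power_mult_distrib mult_ac)
  also have "(\<integral>x. std_normal_density x * x\<^sup>2 \<partial>lborel) = 1"
    using integral_std_normal_moment_even[of 1] by (simp add: fact_2)
  finally show "variance X = v" by simp
qed

text \<open>Dominated convergence passes the characteristic functions to the limit, where they
  identify the law. A limit variance of zero is included.\<close>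

lemma (in prob_space) normal_law_AE_limit:
  assumes X: "X \<in> borel_measurable M" and XN: "\<And>N. Y N \<in> borel_measurable M"
    and lim: "AE \<omega> in M. (\<lambda>N. Y N \<omega>) \<longlonglongrightarrow> X \<omega>"
    and char: "\<And>N u. char (distr M borel (Y N)) u = exp (- (v N * u\<^sup>2) / 2)"
    and v: "v \<longlonglongrightarrow> V" "0 \<le> V"
  shows "distr M borel X = normal_law 0 V"
proof (rule Levy_uniqueness)
  show "real_distribution (distr M borel X)" using X by (rule real_distribution_distr)
  show "real_distribution (normal_law 0 V)" using v(2) by (rule real_distribution_normal_law)
  show "char (distr M borel X) = char (normal_law 0 V)"
  proof
    fix u
    have "(\<lambda>N. CLINT \<omega>|M. iexp (u * Y N \<omega>)) \<longlonglongrightarrow> (CLINT \<omega>|M. iexp (u * X \<omega>))"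
    proof (rule integral_dominated_convergence[where w = "\<lambda>_. 1"])
      show "AE \<omega> in M. (\<lambda>N. iexp (u * Y N \<omega>)) \<longlonglongrightarrow> iexp (u * X \<omega>)"
        using lim by eventually_elim (intro tendsto_intros)
    qed (use X XN in auto)
    then have "(\<lambda>N. char (distr M borel (Y N)) u) \<longlonglongrightarrow> char (distr M borel X) u"
      using X XN by (simp add: char_def integral_distr)
    moreover have "(\<lambda>N. complex_of_real (exp (- (v N * u\<^sup>2) / 2))) \<longlonglongrightarrow> complex_of_real (exp (- (V * u\<^sup>2) / 2))"
      by (intro tendsto_intros v(1)) simp
    ultimately show "char (distr M borel X) u = char (normal_law 0 V) u"
      unfolding char char_normal_law[OF v(2)] by (rule LIMSEQ_unique)
  qed
qed

section \<open>Approximation by Brownian increments\<close>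

text \<open>Independence of \<open>Z 0\<close> from the sigma-algebra of the Brownian motion, and of
  the increments among themselves, factorizes the characteristic function. Combinations of this
  shape approximate the sampled process.\<close>

lemma (in stationary_OU) char_initial_plus_increments:
  fixes c :: "nat \<Rightarrow> real" and c0 h u :: real and m :: nat
  assumes "0 < \<gamma>" "0 < h"
  shows "char (distr M borel (\<lambda>\<omega>. c0 * Z 0 \<omega> + (\<Sum>k<m. c k * (W (real (Suc k) * h) \<omega> - W (real k * h) \<omega>)))) u
    = exp (- ((c0\<^sup>2 * (\<sigma>\<^sup>2 / (2 * \<gamma>)) + (\<Sum>k<m. (c k)\<^sup>2 * h)) * u\<^sup>2) / 2)"
proof -
  define D where "D k \<omega> = W (real (Suc k) * h) \<omega> - W (real k * h) \<omega>" for k \<omega>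
  define S where "S \<omega> = (\<Sum>k<m. c k * D k \<omega>)" for \<omega>
  have Wm [measurable]: "W (real k * h) \<in> borel_measurable M" for k
    using assms by (intro W_measurable) auto
  have Dm [measurable]: "D k \<in> borel_measurable M" for k
    unfolding D_def by measurable
  have Sm [measurable]: "S \<in> borel_measurable M" unfolding S_def by measurable
  have Z0m [measurable]: "Z 0 \<in> borel_measurable M" by (rule Z_measurable) simp
  have "indep_vars (\<lambda>_. borel) D {..<m}"
  proof -
    have "mono (\<lambda>k. real k * h)" using assms by (intro monoI mult_right_mono) auto
    then show ?thesis unfolding D_def[abs_def] by (intro W_indep) auto
  qed
  then have indep_D: "indep_vars (\<lambda>_. borel) (\<lambda>k \<omega>. c k * D k \<omega>) {..<m}"
    by (rule indep_vars_compose2) simp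
  have char_D: "char (distr M borel (\<lambda>\<omega>. c k * D k \<omega>)) u = exp (- ((c k)\<^sup>2 * h * u\<^sup>2) / 2)" for k
  proof -
    have "distributed M lborel (D k) (normal_density 0 (sqrt (real (Suc k) * h - real k * h)))"
      unfolding D_def using assms by (intro W_increment) auto
    then have "distr M lborel (D k) = normal_law 0 h"
      using assms by (simp add: distributed_def normal_law_def algebra_simps)
    moreover have "distr M lborel (D k) = distr M borel (D k)" by (rule distr_cong) auto
    ultimately have "distr M borel (D k) = normal_law 0 h" by simp
    then show ?thesis
      using assms by (simp add: char_distr_scale char_normal_law power_mult_distrib mult_ac)
  qed
  have char_S: "char (distr M borel S) u = exp (- ((\<Sum>k<m. (c k)\<^sup>2 * h) * u\<^sup>2) / 2)"
  proof -
    have "char (distr M borel S) u = (\<Prod>k<m. char (distr M borel (\<lambda>\<omega>. c k * D k \<omega>)) u)"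
      unfolding S_def[abs_def] by (rule char_distr_sum[OF indep_D])
    also have "\<dots> = complex_of_real (\<Prod>k<m. exp (- ((c k)\<^sup>2 * h * u\<^sup>2) / 2))"
      unfolding char_D by simp
    also have "(\<Prod>k<m. exp (- ((c k)\<^sup>2 * h * u\<^sup>2) / 2)) = exp (\<Sum>k<m. - ((c k)\<^sup>2 * h * u\<^sup>2) / 2)"
      by (simp add: exp_sum)
    also have "(\<Sum>k<m. - ((c k)\<^sup>2 * h * u\<^sup>2) / 2) = - ((\<Sum>k<m. (c k)\<^sup>2 * h) * u\<^sup>2) / 2"
      by (simp add: sum_distrib_right sum_divide_distrib sum_negf)
    finally show ?thesis .
  qed
  have char_Z: "char (distr M borel (\<lambda>\<omega>. c0 * Z 0 \<omega>)) u = exp (- (c0\<^sup>2 * (\<sigma>\<^sup>2 / (2 * \<gamma>)) * u\<^sup>2) / 2)"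
    using assms by (subst char_distr_scale) (auto simp: Z_initial char_normal_law power_mult_distrib mult_ac)
  \<comment> \<open>Stated for an arbitrary measure space \<open>F\<close>, to be used with the
    sigma-algebra generated by \<open>W\<close>; this places the events of \<open>S\<close> inside
    the family that is independent of \<open>Z 0\<close>.\<close>
  have S_meas: "S \<in> borel_measurable F"
    if [measurable]: "\<And>t. 0 \<le> t \<Longrightarrow> W t \<in> borel_measurable F" for F :: "'w measure"
  proof -
    have [measurable]: "W (real k * h) \<in> borel_measurable F" for k
      using assms that by simp
    show ?thesis unfolding S_def D_def by measurable
  qed
  have "indep_var borel (Z 0) borel S"
    unfolding indep_var_eq
  proof (intro conjI)
    let ?G = "{Z 0 -` A \<inter> space M | A. A \<in> sets borel}"
    let ?W = "{W t -` A \<inter> space M | t A. 0 \<le> t \<and> A \<in> sets borel}"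
    have sub: "?W \<subseteq> Pow (space M)" by auto
    have "Int_stable ?G"
    proof (rule Int_stableI)
      fix a b assume "a \<in> ?G" "b \<in> ?G"
      then obtain A B where "a = Z 0 -` A \<inter> space M" "A \<in> sets borel"
        "b = Z 0 -` B \<inter> space M" "B \<in> sets borel" by blast
      then have "a \<inter> b = Z 0 -` (A \<inter> B) \<inter> space M" "A \<inter> B \<in> sets borel" by auto
      then show "a \<inter> b \<in> ?G" by blast
    qed
    moreover interpret F: sigma_algebra "space M" "sigma_sets (space M) ?W"
      using sub by (rule sigma_algebra_sigma_sets)
    have "Int_stable (sigma_sets (space M) ?W)" by (rule F.Int_stable)
    ultimately have "indep_set (sigma_sets (space M) ?G) (sigma_sets (space M) (sigma_sets (space M) ?W))"
      by (intro indep_set_sigma_sets Z_indep)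
    then have ind: "indep_set (sigma_sets (space M) ?G) (sigma_sets (space M) ?W)"
      by (simp only: F.sigma_sets_eq)
    let ?F = "sigma (space M) ?W"
    have setsF: "sets ?F = sigma_sets (space M) ?W" by (rule sets_measure_of[OF sub])
    have spaceF: "space ?F = space M" by (rule space_measure_of[OF sub])
    have WF: "W t \<in> borel_measurable ?F" if "0 \<le> t" for t
    proof (rule measurableI)
      show "W t x \<in> space borel" for x by simp
      fix A :: "real set" assume "A \<in> sets borel"
      then have "W t -` A \<inter> space M \<in> ?W" using that by blast
      then show "W t -` A \<inter> space ?F \<in> sets ?F"
        unfolding setsF spaceF by (rule sigma_sets.Basic)
    qed
    have S_F: "S \<in> borel_measurable ?F" using WF by (rule S_meas)
    have "S -` A \<inter> space M \<in> sigma_sets (space M) ?W" if "A \<in> sets borel" for A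
      using measurable_sets[OF S_F that] unfolding setsF spaceF .
    then have "{S -` A \<inter> space M | A. A \<in> sets borel} \<subseteq> sigma_sets (space M) ?W"
      by clarify
    then have le: "sigma_sets (space M) {S -` A \<inter> space M | A. A \<in> sets borel} \<subseteq> sigma_sets (space M) ?W"
      by (rule F.sigma_sets_subset)
    show "indep_set (sigma_sets (space M) ?G) (sigma_sets (space M) {S -` A \<inter> space M | A. A \<in> sets borel})"
      unfolding indep_set_def
    proof (rule indep_sets_mono_sets[OF ind[unfolded indep_set_def]])
      fix b :: bool
      show "(case b of True \<Rightarrow> sigma_sets (space M) ?G
            | False \<Rightarrow> sigma_sets (space M) {S -` A \<inter> space M | A. A \<in> sets borel})
          \<subseteq> (case b of True \<Rightarrow> sigma_sets (space M) ?G | False \<Rightarrow> sigma_sets (space M) ?W)"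
        using le by (cases b) (simp_all only: bool.case order_refl)
    qed
  qed (rule Z0m, rule Sm)
  then have "indep_var borel ((\<lambda>x. c0 * x) \<circ> Z 0) borel ((\<lambda>x. x) \<circ> S)"
    by (rule indep_var_compose) auto
  then have "indep_var borel (\<lambda>\<omega>. c0 * Z 0 \<omega>) borel S" by (simp add: comp_def)
  then have "char (distr M borel (\<lambda>\<omega>. c0 * Z 0 \<omega> + S \<omega>)) u
      = complex_of_real (exp (- (c0\<^sup>2 * (\<sigma>\<^sup>2 / (2 * \<gamma>)) * u\<^sup>2) / 2) * exp (- ((\<Sum>k<m. (c k)\<^sup>2 * h) * u\<^sup>2) / 2))"
    by (simp only: char_distr_add char_S char_Z of_real_mult)
  then show ?thesis
    unfolding S_def D_def exp_add[symmetric] by (simp only: distrib_right add_divide_distrib minus_add_distrib)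
qed

text \<open>The integrating factor \<open>exp (g * t)\<close> removes the drift up to an error that is small on a short
  interval.\<close>
lemma ou_cell:
  fixes z w :: "real \<Rightarrow> real" and g s :: real
  assumes cont: "continuous_on {0..} z"
    and eq: "\<And>t. 0 \<le> t \<Longrightarrow> z t = z 0 - g * integral {0..t} z + s * w t"
    and st: "0 \<le> u" "u \<le> v"
  shows "exp (g * u) * (s * (w v - w u)) - (exp (g * v) * z v - exp (g * u) * z u)
    = integral {u..v} (\<lambda>y. g * (exp (g * u) * z y - exp (g * y) * z v))"
proof -
  have int: "z integrable_on {0..v}" "z integrable_on {u..v}"
    using st by (auto intro!: integrable_continuous_real continuous_on_subset[OF cont])
  have "integral {0..u} z + integral {u..v} z = integral {0..v} z"
    using st int by (intro Henstock_Kurzweil_Integration.integral_combine) auto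
  then have iv: "integral {0..v} z = integral {0..u} z + integral {u..v} z" by simp
  have "z v - z u = - g * integral {u..v} z + s * (w v - w u)"
    using eq[of u] eq[of v] st unfolding iv by (simp add: algebra_simps)
  then have noise: "s * (w v - w u) = z v - z u + g * integral {u..v} z" by simp
  have "((\<lambda>y. g * exp (g * y)) has_integral exp (g * v) - exp (g * u)) {u..v}"
    using st by (intro fundamental_theorem_of_calculus)
      (auto simp: has_real_derivative_iff_has_vector_derivative[symmetric] intro!: derivative_eq_intros)
  from has_integral_diff[OF has_integral_mult_right[OF integrable_integral[OF int(2)], of "g * exp (g * u)"]
      has_integral_mult_left[OF this, of "z v"]]
  have "((\<lambda>y. g * exp (g * u) * z y - g * exp (g * y) * z v) has_integral
      g * exp (g * u) * integral {u..v} z - (exp (g * v) - exp (g * u)) * z v) {u..v}" .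
  then have "((\<lambda>y. g * (exp (g * u) * z y - exp (g * y) * z v)) has_integral
      g * exp (g * u) * integral {u..v} z - (exp (g * v) - exp (g * u)) * z v) {u..v}"
    by (simp add: algebra_simps)
  then have "integral {u..v} (\<lambda>y. g * (exp (g * u) * z y - exp (g * y) * z v))
      = g * exp (g * u) * integral {u..v} z - (exp (g * v) - exp (g * u)) * z v"
    by (rule integral_unique)
  then show ?thesis unfolding noise by (simp add: algebra_simps)
qed

text \<open>The increments of \<open>exp (g * t) * z t\<close> telescope, and each differs from the
  noise term of its cell by an integral that uniform continuity makes small relative to the mesh.
  Everything is pathwise, so no stochastic integral appears.\<close>

lemma ou_path_limit:
  fixes z w :: "real \<Rightarrow> real" and i :: nat and g s \<tau> :: real
  assumes cont: "continuous_on {0..} z"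
    and eq: "\<And>t. 0 \<le> t \<Longrightarrow> z t = z 0 - g * integral {0..t} z + s * w t"
    and pos: "0 < g" "0 < \<tau>"
  shows "(\<lambda>N. \<Sum>k<i * N. exp (g * (k * (\<tau> / N))) * (s * (w (Suc k * (\<tau> / N)) - w (k * (\<tau> / N)))))
    \<longlonglongrightarrow> exp (g * (i * \<tau>)) * z (i * \<tau>) - z 0"
proof (rule LIMSEQ_I)
  fix e :: real assume e: "0 < e"
  define T where "T = i * \<tau>"
  \<comment> \<open>With two separate time arguments, a single modulus of continuity controls
    \<open>exp (g * u) * z y - exp (g * y) * z v\<close>, where the two factors sit at different
    times.\<close>
  define \<phi> where "\<phi> p = exp (g * fst p) * z (snd p)" for p :: "real \<times> real"
  have T: "0 \<le> T" using pos by (simp add: T_def)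
  \<comment> \<open>Chosen so that the accumulated error \<open>g * d * T\<close> stays below
    \<open>e\<close>; the added 1 also covers \<open>T = 0\<close>.\<close>
  define d where "d = e / 2 / (g * T + 1)"
  have gT: "0 < g * T + 1" using pos T by (simp add: add_nonneg_pos)
  then have d: "0 < d" using e by (simp add: d_def)
  have "continuous_on ({0..T} \<times> {0..T}) \<phi>"
    unfolding \<phi>_def
    by (intro continuous_intros continuous_on_compose2[OF cont]) auto
  then have "uniformly_continuous_on ({0..T} \<times> {0..T}) \<phi>"
    by (rule compact_uniformly_continuous) (intro compact_Times compact_Icc)
  then obtain r where r: "0 < r" "\<And>p q. p \<in> {0..T} \<times> {0..T} \<Longrightarrow> q \<in> {0..T} \<times> {0..T} \<Longrightarrow>
      dist q p < r \<Longrightarrow> dist (\<phi> q) (\<phi> p) < d"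
    using d unfolding uniformly_continuous_on_def by metis
  \<comment> \<open>The points \<open>(u, y)\<close> and \<open>(y, v)\<close> of one cell are at
    distance at most twice the mesh, which must fall below \<open>r\<close>.\<close>
  obtain N0 :: nat where N0: "2 * \<tau> / r < N0" using reals_Archimedean2 by blast
  have "norm ((\<Sum>k<i * N. exp (g * (k * (\<tau> / N))) * (s * (w (Suc k * (\<tau> / N)) - w (k * (\<tau> / N)))))
      - (exp (g * (i * \<tau>)) * z (i * \<tau>) - z 0)) < e" if N: "N \<ge> Suc N0" for N
  proof -
    define h where "h = \<tau> / N"
    have N': "0 < N" "2 * \<tau> / r < N" using N N0 by auto
    have h: "0 < h" using pos N' by (simp add: h_def)
    have h2: "2 * h < r" using N' r(1) by (simp add: h_def field_simps)
    have iNh: "real (i * N) * h = T" using N' by (simp add: h_def T_def)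
    have cell: "\<bar>exp (g * (k * h)) * (s * (w (Suc k * h) - w (k * h)))
        - (exp (g * (Suc k * h)) * z (Suc k * h) - exp (g * (k * h)) * z (k * h))\<bar> \<le> g * d * h"
      if k: "k < i * N" for k
    proof -
      let ?u = "k * h" and ?v = "Suc k * h"
      have "real (Suc k) \<le> real (i * N)" using k by (intro of_nat_mono) simp
      then have "?v \<le> T" unfolding iNh[symmetric] using h by (intro mult_right_mono) auto
      moreover have "0 \<le> ?u" "?v = ?u + h" using h by (auto simp: algebra_simps)
      ultimately have uv: "0 \<le> ?u" "?u \<le> ?v" "?v \<le> T" "?v = ?u + h" using h by auto
      have "norm (integral {?u..?v} (\<lambda>y. g * (exp (g * ?u) * z y - exp (g * y) * z ?v))) \<le> (g * d) * (?v - ?u)"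
      proof (rule integral_bound)
        show "continuous_on {?u..?v} (\<lambda>y. g * (exp (g * ?u) * z y - exp (g * y) * z ?v))"
          using uv(1) by (intro continuous_intros continuous_on_subset[OF cont]) auto
        fix y assume y: "y \<in> {?u..?v}"
        have yb: "0 \<le> y" "y \<le> T" "?u \<le> T" "0 \<le> ?v"
          using y uv unfolding atLeastAtMost_iff by linarith+
        have "dist (?u, y) (y, ?v) \<le> dist ?u y + dist y ?v"
          unfolding dist_prod_def by (simp add: sqrt_sum_squares_le_sum)
        also have "\<dots> \<le> h + h" using y uv by (intro add_mono) (auto simp: dist_real_def)
        finally have "dist (?u, y) (y, ?v) < r" using h2 by linarith
        then have "dist (\<phi> (?u, y)) (\<phi> (y, ?v)) < d"
          using yb uv(1,3) by (intro r(2)) (simp_all only: mem_Times_iff fst_conv snd_conv atLeastAtMost_iff)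
        then have "\<bar>exp (g * ?u) * z y - exp (g * y) * z ?v\<bar> \<le> d"
          by (simp add: \<phi>_def dist_real_def)
        then show "norm (g * (exp (g * ?u) * z y - exp (g * y) * z ?v)) \<le> g * d"
          using pos by (simp add: abs_mult)
      qed (use uv in auto)
      moreover have "?v - ?u = h" using uv(4) by linarith
      ultimately have "norm (integral {?u..?v} (\<lambda>y. g * (exp (g * ?u) * z y - exp (g * y) * z ?v))) \<le> g * d * h"
        by (simp only:)
      moreover have "exp (g * ?u) * (s * (w ?v - w ?u)) - (exp (g * ?v) * z ?v - exp (g * ?u) * z ?u)
          = integral {?u..?v} (\<lambda>y. g * (exp (g * ?u) * z y - exp (g * y) * z ?v))"
        using cont eq uv(1,2) by (rule ou_cell)
      ultimately show ?thesis by (simp only: real_norm_def)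
    qed
    have "(\<Sum>k<i * N. exp (g * (Suc k * h)) * z (Suc k * h) - exp (g * (k * h)) * z (k * h))
        = exp (g * T) * z T - z 0"
      using sum_lessThan_telescope[of "\<lambda>k. exp (g * (k * h)) * z (k * h)" "i * N"]
      unfolding iNh by simp
    then have "\<bar>(\<Sum>k<i * N. exp (g * (k * h)) * (s * (w (Suc k * h) - w (k * h)))) - (exp (g * T) * z T - z 0)\<bar>
      = \<bar>\<Sum>k<i * N. exp (g * (k * h)) * (s * (w (Suc k * h) - w (k * h)))
        - (exp (g * (Suc k * h)) * z (Suc k * h) - exp (g * (k * h)) * z (k * h))\<bar>"
      by (simp only: sum_subtractf)
    also have "\<dots> \<le> (\<Sum>k<i * N. g * d * h)"
      by (intro order_trans[OF sum_abs] sum_mono cell) auto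
    also have "\<dots> = g * d * T" unfolding iNh[symmetric] by simp
    also have "\<dots> < e"
    proof -
      have "g * T * d \<le> (g * T + 1) * d" using d by simp
      also have "\<dots> = e / 2"
      proof -
        have "c * (x / c) = x" if "c \<noteq> 0" for c x :: real using that by simp
        from this[of "g * T + 1" "e / 2"] show ?thesis using gT by (simp only: d_def)
      qed
      finally show ?thesis using e by (simp add: mult_ac)
    qed
    finally show ?thesis by (simp add: h_def T_def)
  qed
  then show "\<exists>N0. \<forall>N\<ge>N0. norm ((\<Sum>k<i * N. exp (g * (k * (\<tau> / N))) * (s * (w (Suc k * (\<tau> / N)) - w (k * (\<tau> / N)))))
      - (exp (g * (i * \<tau>)) * z (i * \<tau>) - z 0)) < e" by blast
qed

text \<open>The sum is geometric, so the limit reduces to that of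
  \<open>h / (exp (2 * g * h) - 1)\<close> as the mesh \<open>h\<close> tends to 0. It supplies the
  variance of the noise accumulated up to time \<open>m * \<tau>\<close>.\<close>

lemma exponential_riemann_sum_limit:
  fixes m :: nat and g \<tau> :: real
  assumes "0 < g" "0 < \<tau>"
  shows "(\<lambda>N. \<Sum>k<m * N. exp (2 * g * (k * (\<tau> / N))) * (\<tau> / N)) \<longlonglongrightarrow> (exp (2 * g * (m * \<tau>)) - 1) / (2 * g)"
proof -
  have "(\<lambda>N. (exp (2 * g * (m * \<tau>)) - 1) * ((\<tau> / real N) / (exp (2 * g * (\<tau> / real N)) - 1)))
      \<longlonglongrightarrow> (exp (2 * g * (m * \<tau>)) - 1) * (1 / (2 * g))"
    using assms by (intro tendsto_mult tendsto_const) (real_asymp simp: field_simps)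
  moreover have "\<forall>\<^sub>F N in sequentially. (exp (2 * g * (m * \<tau>)) - 1) * ((\<tau> / real N) / (exp (2 * g * (\<tau> / real N)) - 1))
      = (\<Sum>k<m * N. exp (2 * g * (k * (\<tau> / N))) * (\<tau> / N))"
    using eventually_gt_at_top[of 0]
  proof eventually_elim
    case (elim N)
    define q where "q = exp (2 * g * (\<tau> / N))"
    have "1 < q" using assms elim by (simp add: q_def)
    have pow: "exp (2 * g * (k * (\<tau> / N))) = q ^ k" for k :: nat
      unfolding q_def exp_of_nat_mult[symmetric] by (simp add: mult_ac)
    have "q ^ (m * N) = exp (2 * g * (m * \<tau>))"
      using elim unfolding pow[symmetric] by simp
    then show ?case
      using \<open>1 < q\<close> unfolding pow sum_distrib_right[symmetric] q_def[symmetric]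
      by (simp add: geometric_sum)
  qed
  ultimately show ?thesis by (auto elim!: Lim_transform_eventually)
qed

text \<open>Variation of constants: \<open>Z\<close> at time \<open>t\<close> is
  \<open>exp (- \<gamma> * t)\<close> times \<open>Z 0\<close> plus the noise weighted by the
  integrating factor. Mesh \<open>\<tau> / N\<close> makes every sampling time a grid point.\<close>

lemma (in stationary_OU) sum_approximation:
  fixes S :: "nat set" and \<tau> :: real
  assumes "0 < \<gamma>" "0 < \<tau>" "finite S"
  shows "AE \<omega> in M. (\<lambda>N. \<Sum>i\<in>S. exp (- (\<gamma> * (i * \<tau>))) * (Z 0 \<omega>
      + (\<Sum>k<i * N. exp (\<gamma> * (k * (\<tau> / N))) * (\<sigma> * (W (Suc k * (\<tau> / N)) \<omega> - W (k * (\<tau> / N)) \<omega>)))))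
    \<longlonglongrightarrow> (\<Sum>i\<in>S. Z (i * \<tau>) \<omega>)"
  using Z_continuous Z_sde
proof eventually_elim
  case (elim \<omega>)
  have "(\<lambda>N. exp (- (\<gamma> * (i * \<tau>))) * (Z 0 \<omega>
      + (\<Sum>k<i * N. exp (\<gamma> * (k * (\<tau> / N))) * (\<sigma> * (W (Suc k * (\<tau> / N)) \<omega> - W (k * (\<tau> / N)) \<omega>)))))
    \<longlonglongrightarrow> exp (- (\<gamma> * (i * \<tau>))) * (Z 0 \<omega> + (exp (\<gamma> * (i * \<tau>)) * Z (i * \<tau>) \<omega> - Z 0 \<omega>))" for i :: nat
  proof -
    have "(\<lambda>N. \<Sum>k<i * N. exp (\<gamma> * (k * (\<tau> / N))) * (\<sigma> * (W (Suc k * (\<tau> / N)) \<omega> - W (k * (\<tau> / N)) \<omega>)))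
        \<longlonglongrightarrow> exp (\<gamma> * (i * \<tau>)) * Z (i * \<tau>) \<omega> - Z 0 \<omega>"
    proof (rule ou_path_limit[where z = "\<lambda>t. Z t \<omega>" and w = "\<lambda>t. W t \<omega>", OF elim(1) _ assms(1,2)])
      show "Z t \<omega> = Z 0 \<omega> - \<gamma> * integral {0..t} (\<lambda>t. Z t \<omega>) + \<sigma> * W t \<omega>" if "0 \<le> t" for t
        using elim(2) that by blast
    qed
    then show ?thesis by (rule tendsto_mult[OF tendsto_const tendsto_add[OF tendsto_const]])
  qed
  moreover have "exp (- (\<gamma> * (i * \<tau>))) * (Z 0 \<omega> + (exp (\<gamma> * (i * \<tau>)) * Z (i * \<tau>) \<omega> - Z 0 \<omega>)) = Z (i * \<tau>) \<omega>" for i :: nat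
    by (simp add: exp_minus)
  ultimately show ?case by (intro tendsto_sum) (simp only:)
qed

text \<open>All approximants for times in \<open>S\<close> live on one grid, so their sum is a
  single combination of \<open>Z 0\<close> and increments; its variance \<open>v N\<close> is a
  Riemann sum tending to the double sum of stationary covariances.\<close>

lemma (in stationary_OU) distr_sum:
  fixes S :: "nat set" and \<tau> :: real
  assumes "0 < \<gamma>" "0 < \<tau>" "finite S"
  defines "V \<equiv> (\<Sum>i\<in>S. \<Sum>j\<in>S. \<sigma>\<^sup>2 / (2 * \<gamma>) * exp (- (\<gamma> * \<tau> * \<bar>real i - real j\<bar>)))"
  shows "distr M borel (\<lambda>\<omega>. \<Sum>i\<in>S. Z (i * \<tau>) \<omega>) = normal_law 0 V" "0 \<le> V"
proof -
  define e where "e i = exp (- (\<gamma> * (i * \<tau>)))" for i :: nat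
  \<comment> \<open>A common horizon for \<open>S\<close>; inserting 0 keeps \<open>Max\<close>
    meaningful for empty \<open>S\<close>.\<close>
  define n where "n = Suc (Max (insert 0 S))"
  have n: "i < n" if "i \<in> S" for i
    using that assms(3) Max_ge[of "insert 0 S" i] by (simp add: n_def less_Suc_eq_le)
  \<comment> \<open>Total weight of the increment with index \<open>k\<close>: only sampling times
    after it contribute.\<close>
  define c where "c N k = \<sigma> * (\<Sum>i\<in>S. if k < i * N then e i * exp (\<gamma> * (k * (\<tau> / N))) else 0)"
    for N k :: nat
  define Y where "Y N \<omega> = (\<Sum>i\<in>S. e i) * Z 0 \<omega>
      + (\<Sum>k<n * N. c N k * (W (real (Suc k) * (\<tau> / N)) \<omega> - W (real k * (\<tau> / N)) \<omega>))" for N \<omega>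
  define v where "v N = (\<Sum>i\<in>S. e i)\<^sup>2 * (\<sigma>\<^sup>2 / (2 * \<gamma>)) + (\<Sum>k<n * N. (c N k)\<^sup>2 * (\<tau> / N))" for N :: nat
  have restrict: "(\<Sum>k<n * N. if k < i * N then f k else 0) = (\<Sum>k<i * N. f k)"
    if "i \<in> S" for f :: "nat \<Rightarrow> real" and i N
  proof -
    have "i * N \<le> n * N" using n[OF that] by (intro mult_right_mono) auto
    then have "{..<n * N} \<inter> {k. k < i * N} = {..<i * N}"
      unfolding set_eq_iff Int_iff mem_Collect_eq lessThan_iff by (metis less_le_trans)
    then show ?thesis by (simp add: sum.If_cases)
  qed
  have Y_eq: "Y N \<omega> = (\<Sum>i\<in>S. e i * (Z 0 \<omega>
      + (\<Sum>k<i * N. exp (\<gamma> * (k * (\<tau> / N))) * (\<sigma> * (W (Suc k * (\<tau> / N)) \<omega> - W (k * (\<tau> / N)) \<omega>)))))" for N \<omega>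
  proof -
    let ?D = "\<lambda>k. W (real (Suc k) * (\<tau> / N)) \<omega> - W (real k * (\<tau> / N)) \<omega>"
    have "(\<Sum>k<n * N. c N k * ?D k)
        = (\<Sum>k<n * N. \<Sum>i\<in>S. if k < i * N then e i * (exp (\<gamma> * (k * (\<tau> / N))) * (\<sigma> * ?D k)) else 0)"
      by (intro sum.cong refl) (auto simp: c_def sum_distrib_left sum_distrib_right mult_ac intro!: sum.cong)
    also have "\<dots> = (\<Sum>i\<in>S. \<Sum>k<i * N. e i * (exp (\<gamma> * (k * (\<tau> / N))) * (\<sigma> * ?D k)))"
      by (subst sum.swap) (intro sum.cong refl restrict)
    also have "\<dots> = (\<Sum>i\<in>S. e i * (\<Sum>k<i * N. exp (\<gamma> * (k * (\<tau> / N))) * (\<sigma> * ?D k)))"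
      by (simp add: sum_distrib_left)
    finally show ?thesis
      by (simp add: Y_def distrib_left sum.distrib sum_distrib_right)
  qed
  have v_eq: "v N = (\<Sum>i\<in>S. \<Sum>j\<in>S. e i * e j * (\<sigma>\<^sup>2 / (2 * \<gamma>)
      + \<sigma>\<^sup>2 * (\<Sum>k<min i j * N. exp (2 * \<gamma> * (k * (\<tau> / N))) * (\<tau> / N))))" for N
  proof -
    have c2: "(c N k)\<^sup>2 * (\<tau> / N) = (\<Sum>i\<in>S. \<Sum>j\<in>S. if k < min i j * N
        then e i * e j * \<sigma>\<^sup>2 * (exp (2 * \<gamma> * (k * (\<tau> / N))) * (\<tau> / N)) else 0)" for k
    proof -
      let ?x = "exp (\<gamma> * (k * (\<tau> / N)))"
      have x2: "?x * ?x = exp (2 * \<gamma> * (k * (\<tau> / N)))" by (simp add: algebra_simps flip: exp_add)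
      have "(c N k)\<^sup>2 * (\<tau> / N) = (\<Sum>i\<in>S. \<Sum>j\<in>S. \<sigma>\<^sup>2 * (\<tau> / N)
          * ((if k < i * N then e i * ?x else 0) * (if k < j * N then e j * ?x else 0)))"
        unfolding c_def power_mult_distrib
        by (simp only: power2_eq_square[of "sum _ _"] sum_product sum_distrib_left[symmetric] mult_ac)
      also have "\<dots> = (\<Sum>i\<in>S. \<Sum>j\<in>S. if k < min i j * N
        then e i * e j * \<sigma>\<^sup>2 * ((?x * ?x) * (\<tau> / N)) else 0)"
      proof (intro sum.cong refl)
        fix i j
        \<comment> \<open>Two sampling times share exactly the noise up to the earlier one; this
          produces the minimum in the covariance.\<close>
        have "k < min i j * N \<longleftrightarrow> k < i * N \<and> k < j * N"
          using mult_le_mono1[of i j N] mult_le_mono1[of j i N] nat_le_linear[of i j]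
          by (metis less_le_trans min_def)
        then show "\<sigma>\<^sup>2 * (\<tau> / N) * ((if k < i * N then e i * ?x else 0) * (if k < j * N then e j * ?x else 0))
            = (if k < min i j * N then e i * e j * \<sigma>\<^sup>2 * ((?x * ?x) * (\<tau> / N)) else 0)"
          by (simp add: mult_ac)
      qed
      finally show ?thesis unfolding x2 .
    qed
    have "(\<Sum>k<n * N. (c N k)\<^sup>2 * (\<tau> / N)) = (\<Sum>i\<in>S. \<Sum>j\<in>S. \<Sum>k<n * N. if k < min i j * N
        then e i * e j * \<sigma>\<^sup>2 * (exp (2 * \<gamma> * (k * (\<tau> / N))) * (\<tau> / N)) else 0)"
      unfolding c2 by (subst sum.swap) (intro sum.cong refl sum.swap)
    also have "\<dots> = (\<Sum>i\<in>S. \<Sum>j\<in>S. \<Sum>k<min i j * N. e i * e j * \<sigma>\<^sup>2 * (exp (2 * \<gamma> * (k * (\<tau> / N))) * (\<tau> / N)))"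
      by (intro sum.cong refl restrict) (auto simp: min_def)
    also have "\<dots> = (\<Sum>i\<in>S. \<Sum>j\<in>S. e i * e j * (\<sigma>\<^sup>2 * (\<Sum>k<min i j * N. exp (2 * \<gamma> * (k * (\<tau> / N))) * (\<tau> / N))))"
      by (simp only: sum_distrib_left mult.assoc)
    finally have increments: "(\<Sum>k<n * N. (c N k)\<^sup>2 * (\<tau> / N)) = (\<Sum>i\<in>S. \<Sum>j\<in>S. e i * e j
        * (\<sigma>\<^sup>2 * (\<Sum>k<min i j * N. exp (2 * \<gamma> * (k * (\<tau> / N))) * (\<tau> / N))))" .
    have "(\<Sum>i\<in>S. e i)\<^sup>2 * (\<sigma>\<^sup>2 / (2 * \<gamma>)) = (\<Sum>i\<in>S. \<Sum>j\<in>S. e i * e j * (\<sigma>\<^sup>2 / (2 * \<gamma>)))"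
      unfolding power2_eq_square[of "sum e S"] sum_product by (simp only: sum_distrib_right)
    then show ?thesis unfolding v_def increments by (simp only: distrib_left sum.distrib)
  qed
  have V_eq: "V = (\<Sum>i\<in>S. \<Sum>j\<in>S. e i * e j * (\<sigma>\<^sup>2 / (2 * \<gamma>)
      + \<sigma>\<^sup>2 * ((exp (2 * \<gamma> * (min i j * \<tau>)) - 1) / (2 * \<gamma>))))"
    unfolding V_def
  proof (intro sum.cong refl)
    fix i j
    \<comment> \<open>\<open>\<bar>i - j\<bar> = i + j - 2 * min i j\<close> splits the stationary
      covariance into two decay factors and the shared noise; the stationary initial variance
      cancels the \<open>- 1\<close>.\<close>
    have "- (\<gamma> * \<tau> * \<bar>real i - real j\<bar>) = - (\<gamma> * (i * \<tau>)) + - (\<gamma> * (j * \<tau>)) + 2 * \<gamma> * (min i j * \<tau>)"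
      by (cases "i \<le> j") (simp_all add: min_def algebra_simps)
    then have "exp (- (\<gamma> * \<tau> * \<bar>real i - real j\<bar>)) = e i * e j * exp (2 * \<gamma> * (min i j * \<tau>))"
      by (simp only: e_def exp_add)
    then show "\<sigma>\<^sup>2 / (2 * \<gamma>) * exp (- (\<gamma> * \<tau> * \<bar>real i - real j\<bar>)) = e i * e j * (\<sigma>\<^sup>2 / (2 * \<gamma>)
      + \<sigma>\<^sup>2 * ((exp (2 * \<gamma> * (min i j * \<tau>)) - 1) / (2 * \<gamma>)))"
      using assms by (simp add: field_simps)
  qed
  have lim_v: "v \<longlonglongrightarrow> V"
    unfolding v_eq V_eq using assms by (intro tendsto_intros exponential_riemann_sum_limit)
  have "0 \<le> v N" for N
    unfolding v_def using assms by (intro add_nonneg_nonneg mult_nonneg_nonneg sum_nonneg) auto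
  then show V: "0 \<le> V" by (intro LIMSEQ_le_const[OF lim_v]) auto
  have Zm: "Z (real i * \<tau>) \<in> borel_measurable M" for i
    using assms by (intro Z_measurable) auto
  have Wm [measurable]: "W (real k * (\<tau> / real N)) \<in> borel_measurable M" for k N
    using assms by (intro W_measurable) auto
  have Z0m [measurable]: "Z 0 \<in> borel_measurable M" by (rule Z_measurable) simp
  text \<open>The grid with \<open>N = 0\<close> has no positive mesh, so the sequence starts at \<open>N = 1\<close>.\<close>
  show "distr M borel (\<lambda>\<omega>. \<Sum>i\<in>S. Z (i * \<tau>) \<omega>) = normal_law 0 V"
  proof (rule normal_law_AE_limit[where Y = "\<lambda>N. Y (Suc N)" and v = "\<lambda>N. v (Suc N)"])
    show "(\<lambda>\<omega>. \<Sum>i\<in>S. Z (i * \<tau>) \<omega>) \<in> borel_measurable M"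
      by (intro borel_measurable_sum Zm)
    show "Y (Suc N) \<in> borel_measurable M" for N
      unfolding Y_def[abs_def] by measurable
    show "AE \<omega> in M. (\<lambda>N. Y (Suc N) \<omega>) \<longlonglongrightarrow> (\<Sum>i\<in>S. Z (i * \<tau>) \<omega>)"
      using sum_approximation[OF assms(1-3)]
    proof eventually_elim
      case (elim \<omega>)
      then have "(\<lambda>N. Y N \<omega>) \<longlonglongrightarrow> (\<Sum>i\<in>S. Z (i * \<tau>) \<omega>)" unfolding Y_eq e_def .
      then show ?case by (rule LIMSEQ_Suc)
    qed
    show "char (distr M borel (Y (Suc N))) u = exp (- (v (Suc N) * u\<^sup>2) / 2)" for N u
      unfolding Y_def[abs_def] v_def using assms by (intro char_initial_plus_increments) auto
    show "(\<lambda>N. v (Suc N)) \<longlonglongrightarrow> V" using lim_v by (rule LIMSEQ_Suc)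
  qed (rule V)
qed

section \<open>Expected growth\<close>

lemma growth_eq_prod:
  "growth M \<rho> Y n \<omega> = (\<Prod>i<n. \<rho> * exp (Y i \<omega> - 1/2 * prob_space.variance M (Y i)) + 1)"
  by (induction n) (simp_all add: mult_ac add.commute)

text \<open>Each term of the expanded product is the exponential of a sum over \<open>S\<close>, so
  the laws of such sums suffice; singletons give the variances in the normalisation.\<close>

lemma (in prob_space) expectation_growth:
  fixes Y :: "nat \<Rightarrow> 'a \<Rightarrow> real" and c :: "nat \<Rightarrow> nat \<Rightarrow> real"
  assumes Y: "\<And>i. Y i \<in> borel_measurable M"
    and law: "\<And>S. finite S \<Longrightarrow> distr M borel (\<lambda>\<omega>. \<Sum>i\<in>S. Y i \<omega>) = normal_law 0 (\<Sum>i\<in>S. \<Sum>j\<in>S. c i j)"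
    and nonneg: "\<And>S. finite S \<Longrightarrow> 0 \<le> (\<Sum>i\<in>S. \<Sum>j\<in>S. c i j)"
  shows "expectation (growth M \<rho> Y n)
    = (\<Sum>S\<in>Pow {..<n}. \<rho> ^ card S * exp ((\<Sum>i\<in>S. \<Sum>j\<in>S. c i j) / 2 - (\<Sum>i\<in>S. c i i) / 2))"
proof -
  have var: "variance (Y i) = c i i" for i
  proof -
    have "distr M borel (Y i) = normal_law 0 (c i i)" "0 \<le> c i i"
      using law[of "{i}"] nonneg[of "{i}"] by simp_all
    then show ?thesis using Y by (intro normal_law_moments)
  qed
  have expand: "growth M \<rho> Y n \<omega> = (\<Sum>S\<in>Pow {..<n}. \<rho> ^ card S * exp (- (\<Sum>i\<in>S. c i i) / 2) * exp (\<Sum>i\<in>S. Y i \<omega>))" for \<omega>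
  proof -
    have "growth M \<rho> Y n \<omega> = (\<Sum>S\<in>Pow {..<n}. \<Prod>i\<in>S. \<rho> * exp (Y i \<omega> - 1/2 * c i i))"
      unfolding growth_eq_prod var by (simp add: prod_add)
    also have "\<dots> = (\<Sum>S\<in>Pow {..<n}. \<rho> ^ card S * exp (- (\<Sum>i\<in>S. c i i) / 2) * exp (\<Sum>i\<in>S. Y i \<omega>))"
    proof (intro sum.cong refl)
      fix S assume "S \<in> Pow {..<n}"
      then have "finite S" using finite_subset by auto
      have "(\<Sum>i\<in>S. Y i \<omega> - 1/2 * c i i) = - (\<Sum>i\<in>S. c i i) / 2 + (\<Sum>i\<in>S. Y i \<omega>)"
        by (simp add: sum_subtractf sum_divide_distrib)
      then have "exp (- (\<Sum>i\<in>S. c i i) / 2) * exp (\<Sum>i\<in>S. Y i \<omega>) = exp (\<Sum>i\<in>S. Y i \<omega> - 1/2 * c i i)"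
        by (simp only: exp_add)
      also have "\<dots> = (\<Prod>i\<in>S. exp (Y i \<omega> - 1/2 * c i i))" by (rule exp_sum[OF \<open>finite S\<close>])
      finally show "(\<Prod>i\<in>S. \<rho> * exp (Y i \<omega> - 1/2 * c i i))
          = \<rho> ^ card S * exp (- (\<Sum>i\<in>S. c i i) / 2) * exp (\<Sum>i\<in>S. Y i \<omega>)"
        by (simp only: prod.distrib prod_constant mult.assoc)
    qed
    finally show ?thesis .
  qed
  have mom: "integrable M (\<lambda>\<omega>. exp (\<Sum>i\<in>S. Y i \<omega>))"
    "expectation (\<lambda>\<omega>. exp (\<Sum>i\<in>S. Y i \<omega>)) = exp ((\<Sum>i\<in>S. \<Sum>j\<in>S. c i j) / 2)"
    if "S \<in> Pow {..<n}" for S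
  proof -
    have "finite S" using that by (auto intro: finite_subset)
    have "(\<lambda>\<omega>. \<Sum>i\<in>S. Y i \<omega>) \<in> borel_measurable M" using Y by (intro borel_measurable_sum)
    note moments = normal_law_moments[OF this law[OF \<open>finite S\<close>] nonneg[OF \<open>finite S\<close>]]
    show "integrable M (\<lambda>\<omega>. exp (\<Sum>i\<in>S. Y i \<omega>))" by (rule moments(1))
    show "expectation (\<lambda>\<omega>. exp (\<Sum>i\<in>S. Y i \<omega>)) = exp ((\<Sum>i\<in>S. \<Sum>j\<in>S. c i j) / 2)"
      by (rule moments(2))
  qed
  have "expectation (growth M \<rho> Y n)
      = (\<Sum>S\<in>Pow {..<n}. expectation (\<lambda>\<omega>. \<rho> ^ card S * exp (- (\<Sum>i\<in>S. c i i) / 2) * exp (\<Sum>i\<in>S. Y i \<omega>)))"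
    unfolding expand using mom by (intro Bochner_Integration.integral_sum integrable_mult_right) auto
  also have "\<dots> = (\<Sum>S\<in>Pow {..<n}. \<rho> ^ card S * exp ((\<Sum>i\<in>S. \<Sum>j\<in>S. c i j) / 2 - (\<Sum>i\<in>S. c i i) / 2))"
  proof (intro sum.cong refl)
    fix S assume "S \<in> Pow {..<n}"
    then show "expectation (\<lambda>\<omega>. \<rho> ^ card S * exp (- (\<Sum>i\<in>S. c i i) / 2) * exp (\<Sum>i\<in>S. Y i \<omega>))
        = \<rho> ^ card S * exp ((\<Sum>i\<in>S. \<Sum>j\<in>S. c i j) / 2 - (\<Sum>i\<in>S. c i i) / 2)"
      by (simp only: integral_mult_right_zero mom(2)) (simp only: mult.assoc exp_add[symmetric], simp)
  qed
  finally show ?thesis .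
qed

text \<open>The scaling makes every diagonal entry \<open>c i i\<close> equal to
  \<open>\<beta> / (a * n)\<close>. Half of the diagonal over at most \<open>n\<close> sites is at
  most \<open>\<beta> / (2 * a)\<close>, a bound independent of \<open>n\<close>.\<close>

lemma (in scaled_OU) expectation_growth_bounds:
  fixes n :: nat
  assumes n: "1 \<le> n" and "0 < a" "0 < \<rho>"
  defines "E \<equiv> prob_space.expectation (M n) (growth (M n) \<rho> (\<lambda>i. Z n (real i * \<tau> n)) n)"
  shows "exp (- (\<beta> / (2 * a))) * partition_sum a \<rho> \<beta> n \<le> E" "E \<le> partition_sum a \<rho> \<beta> n"
proof -
  interpret ou: stationary_OU "M n" "W n" "\<gamma> n" "\<sigma> n" "Z n" using n by (rule OU)
  note params = gamma_pos[OF n] tau_pos[OF n]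
  define c where "c i j = (\<sigma> n)\<^sup>2 / (2 * \<gamma> n) * exp (- (\<gamma> n * \<tau> n * \<bar>real i - real j\<bar>))" for i j :: nat
  have "0 \<le> \<beta>" unfolding scaling_beta[OF n, symmetric] using params by simp
  have scale: "\<gamma> n * \<tau> n = a / n" using scaling_a[OF n] n by (simp add: field_simps)
  have "(\<sigma> n)\<^sup>2 * (\<tau> n * n) = 2 * \<beta> / n"
    using scaling_beta[OF n] n by (simp add: field_simps power2_eq_square)
  then have "\<beta> / (a * n) = (\<sigma> n)\<^sup>2 * (\<tau> n * n) / (2 * (\<gamma> n * \<tau> n * n))"
    unfolding scaling_a[OF n] by simp
  also have "\<dots> = (\<sigma> n)\<^sup>2 / (2 * \<gamma> n)" using params n by simp
  finally have "(\<sigma> n)\<^sup>2 / (2 * \<gamma> n) = \<beta> / (a * n)" ..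
  then have c_eq: "c i j = 2 * (\<beta> / n * kernel_K a (i / n) (j / n))" for i j
    using n by (simp add: c_def scale kernel_K_def flip: diff_divide_distrib)
  have E: "E = (\<Sum>S\<in>Pow {..<n}. \<rho> ^ card S * exp ((\<Sum>i\<in>S. \<Sum>j\<in>S. c i j) / 2 - (\<Sum>i\<in>S. c i i) / 2))"
    unfolding E_def
  proof (rule ou.expectation_growth)
    show "Z n (real i * \<tau> n) \<in> borel_measurable (M n)" for i
      using params by (intro ou.Z_measurable) simp
    show "distr (M n) borel (\<lambda>\<omega>. \<Sum>i\<in>S. Z n (real i * \<tau> n) \<omega>) = normal_law 0 (\<Sum>i\<in>S. \<Sum>j\<in>S. c i j)"
      "0 \<le> (\<Sum>i\<in>S. \<Sum>j\<in>S. c i j)" if "finite S" for S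
      using ou.distr_sum[OF params that] unfolding c_def .
  qed
  have form: "(\<Sum>i\<in>S. \<Sum>j\<in>S. c i j) / 2 = \<beta> / n * kernel_form a n (indicator S)" if "S \<in> Pow {..<n}" for S
    using that unfolding kernel_form_def by (subst sum_indicator_form) (auto simp: c_eq sum_distrib_left sum_divide_distrib)
  have diag: "0 \<le> (\<Sum>i\<in>S. c i i) / 2" "(\<Sum>i\<in>S. c i i) / 2 \<le> \<beta> / (2 * a)" if "S \<in> Pow {..<n}" for S
  proof -
    have card: "card S \<le> n" using that card_mono[of "{..<n}" S] by auto
    have sum: "(\<Sum>i\<in>S. c i i) / 2 = card S * (\<beta> / n / (2 * a))"
      by (simp add: c_eq kernel_K_def)
    show "0 \<le> (\<Sum>i\<in>S. c i i) / 2" unfolding sum using \<open>0 \<le> \<beta>\<close> assms(2) by simp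
    have "card S * (\<beta> / n / (2 * a)) \<le> n * (\<beta> / n / (2 * a))"
      using card \<open>0 \<le> \<beta>\<close> assms(2) by (intro mult_right_mono) auto
    then show "(\<Sum>i\<in>S. c i i) / 2 \<le> \<beta> / (2 * a)" unfolding sum using n by simp
  qed
  show "E \<le> partition_sum a \<rho> \<beta> n"
    unfolding E partition_sum_def using form diag assms(3)
    by (intro sum_mono mult_left_mono) auto
  have "exp (- (\<beta> / (2 * a))) * (\<rho> ^ card S * exp (\<beta> / n * kernel_form a n (indicator S)))
      \<le> \<rho> ^ card S * exp ((\<Sum>i\<in>S. \<Sum>j\<in>S. c i j) / 2 - (\<Sum>i\<in>S. c i i) / 2)" if "S \<in> Pow {..<n}" for S
  proof -
    have "- (\<beta> / (2 * a)) + \<beta> / n * kernel_form a n (indicator S)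
        \<le> (\<Sum>i\<in>S. \<Sum>j\<in>S. c i j) / 2 - (\<Sum>i\<in>S. c i i) / 2"
      using diag(2)[OF that] unfolding form[OF that] by simp
    then have "\<rho> ^ card S * exp (- (\<beta> / (2 * a)) + \<beta> / n * kernel_form a n (indicator S))
        \<le> \<rho> ^ card S * exp ((\<Sum>i\<in>S. \<Sum>j\<in>S. c i j) / 2 - (\<Sum>i\<in>S. c i i) / 2)"
      using assms(3) by (intro mult_left_mono) auto
    then show ?thesis by (simp only: exp_add mult.left_commute)
  qed
  then show "exp (- (\<beta> / (2 * a))) * partition_sum a \<rho> \<beta> n \<le> E"
    unfolding E partition_sum_def sum_distrib_left by (intro sum_mono)
qed

lemma (in scaled_OU) log_growth_rate_limit:
  assumes "0 < a" "0 < \<rho>"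
  shows "log_growth_rate \<rho> \<tau> M Z \<longlonglongrightarrow> lim (max_free_energy a \<rho> \<beta>)"
proof -
  \<comment> \<open>The sign of \<beta> is built into the scaling relation, read off here at
    \<open>n = 1\<close>.\<close>
  have "0 \<le> 1/2 * (\<sigma> 1)\<^sup>2 * \<tau> 1 * (real 1)\<^sup>2" using tau_pos[of 1] by simp
  then have "0 \<le> \<beta>" unfolding scaling_beta[of 1, OF order_refl] .
  note lim = ln_partition_sum_limit[OF assms this]
  have bounds: "ln (partition_sum a \<rho> \<beta> n) / n - \<beta> / (2 * a) * (1 / n) \<le> log_growth_rate \<rho> \<tau> M Z n \<and>
      log_growth_rate \<rho> \<tau> M Z n \<le> ln (partition_sum a \<rho> \<beta> n) / n" if n: "1 \<le> n" for n
  proof -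
    let ?E = "prob_space.expectation (M n) (growth (M n) \<rho> (\<lambda>i. Z n (real i * \<tau> n)) n)"
    have pos: "0 < partition_sum a \<rho> \<beta> n" using assms(2) by (rule partition_sum_pos)
    note E = expectation_growth_bounds[OF n assms]
    have "0 < exp (- (\<beta> / (2 * a))) * partition_sum a \<rho> \<beta> n" using pos by simp
    then have "0 < ?E" using E(1) by (rule less_le_trans)
    then have "ln ?E \<le> ln (partition_sum a \<rho> \<beta> n)" using E(2) pos by simp
    moreover have "- (\<beta> / (2 * a)) + ln (partition_sum a \<rho> \<beta> n) \<le> ln ?E"
    proof -
      have "ln (exp (- (\<beta> / (2 * a))) * partition_sum a \<rho> \<beta> n) \<le> ln ?E"
        using E(1) pos \<open>0 < ?E\<close> by (intro ln_mono) auto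
      then show ?thesis using pos by (simp add: ln_mult)
    qed
    ultimately have "(- (\<beta> / (2 * a)) + ln (partition_sum a \<rho> \<beta> n)) / n \<le> ln ?E / n"
      "ln ?E / n \<le> ln (partition_sum a \<rho> \<beta> n) / n"
      by (auto intro!: divide_right_mono)
    then show ?thesis by (simp add: log_growth_rate_def diff_divide_distrib)
  qed
  have "(\<lambda>n. ln (partition_sum a \<rho> \<beta> n) / n - \<beta> / (2 * a) * (1 / real n))
      \<longlonglongrightarrow> lim (max_free_energy a \<rho> \<beta>) - \<beta> / (2 * a) * 0"
    by (intro tendsto_intros lim lim_1_over_n)
  then have low: "(\<lambda>n. ln (partition_sum a \<rho> \<beta> n) / n - \<beta> / (2 * a) * (1 / real n))
      \<longlonglongrightarrow> lim (max_free_energy a \<rho> \<beta>)" by simp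
  show ?thesis
    using bounds by (intro tendsto_sandwich[OF _ _ low lim]) (auto simp: eventually_sequentially)
qed

text \<open>Convergence is part of the conclusion so that \<open>lim\<close> in
  \<open>lyapunov_exponent\<close> denotes a genuine limit; likewise the eigenvalue property and the
  maximality of \<open>lambda0 a\<close> give its \<open>GREATEST\<close> a meaning. A process for
  each \<beta> makes the exponent a function of \<beta>, as the limit at 0 requires.\<close>

theorem proposition3:
  fixes \<rho> a :: real
    and \<sigma> \<gamma> \<tau> :: "real \<Rightarrow> nat \<Rightarrow> real"
    and M :: "real \<Rightarrow> nat \<Rightarrow> 'w measure"
    and W Z :: "real \<Rightarrow> nat \<Rightarrow> real \<Rightarrow> 'w \<Rightarrow> real"
    and lam :: "real \<Rightarrow> real"
  assumes "0 < \<rho>" and "0 < a"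
    and "\<And>\<beta>. 0 \<le> \<beta> \<Longrightarrow> scaled_OU a \<beta> (\<sigma> \<beta>) (\<gamma> \<beta>) (\<tau> \<beta>) (M \<beta>) (W \<beta>) (Z \<beta>)"
  defines "lam \<equiv> \<lambda>\<beta>. lyapunov_exponent \<rho> (\<tau> \<beta>) (M \<beta>) (Z \<beta>)"
  shows "(\<forall>\<beta>\<ge>0. convergent (log_growth_rate \<rho> (\<tau> \<beta>) (M \<beta>) (Z \<beta>)))
    \<and> (lam \<longlongrightarrow> lam 0) (at_right 0) \<and> lam 0 = ln (\<rho> + 1)
    \<and> (\<forall>\<beta>\<ge>0. lyapunov_lower a \<rho> \<beta> \<le> lam \<beta> \<and> lam \<beta> \<le> lyapunov_upper a \<rho> \<beta>)
    \<and> k_const a = 1 / a ^ 3 * (a + exp (- a) - 1)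
    \<and> kernel_eigenvalue (kernel_K a) (lambda0 a)
    \<and> (\<forall>\<mu>. kernel_eigenvalue (kernel_K a) \<mu> \<longrightarrow> \<mu> \<le> lambda0 a)
    \<and> (\<exists>y0. smallest_positive_root a y0 \<and> lambda0 a = 1 / (a\<^sup>2 * (1 + y0\<^sup>2)))"
proof -
  have limit: "log_growth_rate \<rho> (\<tau> \<beta>) (M \<beta>) (Z \<beta>) \<longlonglongrightarrow> lim (max_free_energy a \<rho> \<beta>)"
    if "0 \<le> \<beta>" for \<beta>
    using assms(3)[OF that] assms(2,1) by (rule scaled_OU.log_growth_rate_limit)
  have lam: "lam \<beta> = lim (max_free_energy a \<rho> \<beta>)" if "0 \<le> \<beta>" for \<beta>
    unfolding lam_def lyapunov_exponent_def using limit[OF that] by (rule limI)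
  have bounds: "ln (\<rho> + 1) \<le> lam \<beta>" "lam \<beta> \<le> ln (\<rho> + 1) + \<beta> / (2 * a)" if "0 \<le> \<beta>" for \<beta>
    using lim_max_free_energy_bounds[OF assms(2,1) that] unfolding lam[OF that] .
  have lam0: "lam 0 = ln (\<rho> + 1)" using bounds[of 0] by simp
  have "((\<lambda>\<beta>. ln (\<rho> + 1) + \<beta> / (2 * a)) \<longlongrightarrow> ln (\<rho> + 1) + 0 / (2 * a)) (at_right 0)"
    using assms(2) by (intro tendsto_intros) auto
  then have upper: "((\<lambda>\<beta>. ln (\<rho> + 1) + \<beta> / (2 * a)) \<longlongrightarrow> ln (\<rho> + 1)) (at_right 0)" by simp
  have pos: "\<forall>\<^sub>F \<beta> in at_right (0 :: real). 0 \<le> \<beta>"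
    using eventually_at_right_less[of "0 :: real"] by (rule eventually_mono) simp
  have "(lam \<longlongrightarrow> lam 0) (at_right 0)"
    unfolding lam0
  proof (rule tendsto_sandwich[OF _ _ tendsto_const upper])
    show "\<forall>\<^sub>F \<beta> in at_right 0. ln (\<rho> + 1) \<le> lam \<beta>"
      using pos by (rule eventually_mono) (rule bounds)
    show "\<forall>\<^sub>F \<beta> in at_right 0. lam \<beta> \<le> ln (\<rho> + 1) + \<beta> / (2 * a)"
      using pos by (rule eventually_mono) (rule bounds)
  qed
  moreover have "convergent (log_growth_rate \<rho> (\<tau> \<beta>) (M \<beta>) (Z \<beta>))" if "0 \<le> \<beta>" for \<beta>
    using limit[OF that] by (rule convergentI)
  moreover have "lyapunov_lower a \<rho> \<beta> \<le> lam \<beta> \<and> lam \<beta> \<le> lyapunov_upper a \<rho> \<beta>" if "0 \<le> \<beta>" for \<beta>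
    unfolding lam[OF that]
    using lower_le_lim_max_free_energy[OF assms(2) that] lim_max_free_energy_le_upper[OF assms(2) that] by blast
  ultimately show ?thesis
    using lam0 k_const_formula[OF assms(2)] lambda0_properties[OF assms(2)] by blast
qed

end
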